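(* Let $G$ be a planar graph with maximum degree $\Delta$ that contains no $4$-cycles and no $5$-cycles. If $\Delta \ge 32$, then there exists an ordering $v_1, \ldots, v_n$ of $V(G)$ such that each $v_i$ has at most $3$ neighbors in $G$ that appear earlier in the ordering and at most $\Delta+2$ neighbors in $G^2$ that appear earlier in the ordering.
   Context: Graphs are finite and simple. "Contains no $k$-cycle" means $G$ has no cycle of length $k$ as a (not necessarily induced) subgraph. The square $G^2$ of a graph $G$ is the graph on $V(G)$ formed from $G$ by adding an edge between each pair of vertices at distance two in $G$. *)

theory Defs
  imports
    "HOL-Analysis.Analysis"
    "Graph_Theory.Pair_Digraph"
    "Graph_Theory.Shortest_Path"
begin

text \<open>
  A finite simple graph is a \<^locale>\<open>pair_graph\<close>: a finite loopless symmetric digraph whose arcs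
  are pairs of vertices. An undirected edge \<open>uv\<close> is the pair of arcs \<open>(u, v)\<close> and \<open>(v, u)\<close>, so that
  the degree of a vertex is its out-degree.
\<close>

text \<open>
  The element \<open>0\<close> only serves to give the graph without vertices maximum degree \<open>0\<close>.
\<close>
definition max_degree :: "'a pair_pre_digraph \<Rightarrow> nat" where
  "max_degree G = Max (insert 0 (out_degree (with_proj G) ` pverts G))"

text \<open>
  A plane drawing \<open>(p, g)\<close> puts the vertex \<open>v\<close> at the point \<open>p v\<close> of the plane and draws the edge
  \<open>uv\<close> as the arc \<open>g {u, v}\<close> (a continuous injective image of the unit interval). Indexing the arcs
  by the sets \<open>{u, v}\<close> makes the two orientations of an edge share one curve, whose direction is
  irrelevant.
\<close>
definition plane_drawing ::
    "'a pair_pre_digraph \<Rightarrow> ('a \<Rightarrow> complex) \<Rightarrow> ('a set \<Rightarrow> real \<Rightarrow> complex) \<Rightarrow> bool" where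
  "plane_drawing G p g \<longleftrightarrow>
     inj_on p (pverts G) \<and>
     (\<forall>(u, v) \<in> parcs G.
        arc (g {u, v}) \<and>
        {pathstart (g {u, v}), pathfinish (g {u, v})} = {p u, p v} \<and>
        path_image (g {u, v}) \<inter> p ` pverts G = {p u, p v}) \<and>
     (\<forall>(u, v) \<in> parcs G. \<forall>(x, y) \<in> parcs G. {u, v} \<noteq> {x, y} \<longrightarrow>
        path_image (g {u, v}) \<inter> path_image (g {x, y}) \<subseteq> p ` ({u, v} \<inter> {x, y}))"

definition planar :: "'a pair_pre_digraph \<Rightarrow> bool" where
  "planar G \<longleftrightarrow> (\<exists>p g. plane_drawing G p g)"

text \<open>
  To be used for \<open>k \<ge> 3\<close> only: a walk \<open>u, v, u\<close> along one edge and back is a cycle of length \<open>2\<close> of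
  the symmetric digraph, but not of the undirected graph.
\<close>
definition has_cycle_of_length :: "'a pair_pre_digraph \<Rightarrow> nat \<Rightarrow> bool" where
  "has_cycle_of_length G k \<longleftrightarrow> (\<exists>c. pre_digraph.cycle (with_proj G) c \<and> length c = k)"

text \<open>With unit weights, \<open>\<mu>\<close> is the usual distance in a graph.\<close>
definition square :: "'a pair_pre_digraph \<Rightarrow> 'a pair_pre_digraph" where
  "square G = \<lparr> pverts = pverts G,
     parcs = parcs G \<union>
       {(u, v). u \<in> pverts G \<and> v \<in> pverts G \<and>
          wf_digraph.\<mu> (with_proj G) (\<lambda>_. 1) u v = 2} \<rparr>"

definition earlier_neighbors :: "'a pair_pre_digraph \<Rightarrow> 'a list \<Rightarrow> nat \<Rightarrow> 'a set" where
  "earlier_neighbors H vs i = {w \<in> set (take i vs). (vs ! i, w) \<in> parcs H}"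

end

theory Submission
  imports Defs
begin

text \<open>
  Write \<open>D\<close> for the maximum degree. Starting from the end of the ordering, repeatedly remove a vertex
  with at most \<open>3\<close> remaining neighbors and at most \<open>D + 2\<close> remaining neighbors in the square; let \<open>S\<close>
  be the set on which this gets stuck. If two removed vertices were adjacent, the edge between them
  could be deleted: by induction the smaller graph has an ordering, which is restricted to \<open>S\<close> and
  followed by the removed vertices. So the removed vertices are independent, and similarly none of
  them is a leaf; hence they have degree \<open>0\<close>, \<open>2\<close> or \<open>3\<close>, and every vertex of \<open>S\<close> has at least \<open>4\<close>
  neighbors in \<open>S\<close> or at least \<open>D + 3\<close> square neighbors in \<open>S\<close>.

  Euler's formula for plane graphs without \<open>4\<close>- and \<open>5\<close>-cycles is needed only as the inequality
  \<open>4 |E| < 6 |V| + 3 |T|\<close>, with \<open>T\<close> the set of triangles. It is proved without faces: a disc bounded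
  by a cycle of length \<open>l\<close> satisfies \<open>4 |E| \<le> 6 |V| + 3 |T| - l - 6\<close>, by induction, cutting the disc
  along chord paths with the theta-curve lemma; a general graph is cut along a cycle, and the
  outside is turned into a disc by the inversion \<open>1 / (z - z0)\<close>.

  The inequality is applied to \<open>S\<close> together with the removed vertices, except the vertices of degree
  \<open>2\<close> that lie in a triangle, and is contradicted by discharging: a vertex with \<open>k \<ge> 4\<close> neighbors in
  \<open>S\<close> sends \<open>2 - 6 / k\<close> along each edge of \<open>S\<close>, to the triangle of \<open>S\<close> containing that edge if there is
  one, and otherwise to the other end; a vertex with \<open>3\<close> neighbors in \<open>S\<close> sends \<open>1 / 5\<close> to each
  neighbor with \<open>2\<close> neighbors in \<open>S\<close> outside triangles of \<open>S\<close>. A vertex of \<open>S\<close> with at most \<open>3\<close>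
  neighbors in \<open>S\<close> has many square neighbors, hence a neighbor of large degree that pays for it.
\<close>

section \<open>Paths and cycles as vertex lists\<close>

fun path_edges :: "'a list \<Rightarrow> 'a set set" where
  "path_edges (x # y # zs) = insert {x, y} (path_edges (y # zs))"
| "path_edges _ = {}"

definition cycle_edges :: "'a list \<Rightarrow> 'a set set" where
  "cycle_edges c = path_edges (c @ [hd c])"

definition is_cycle :: "'a set set \<Rightarrow> 'a list \<Rightarrow> bool" where
  "is_cycle E c \<longleftrightarrow> distinct c \<and> 3 \<le> length c \<and> cycle_edges c \<subseteq> E"

lemma path_edges_append:
  "path_edges (xs @ x # ys) = path_edges (xs @ [x]) \<union> path_edges (x # ys)"
  by (induction xs rule: path_edges.induct) auto

lemma path_edges_snoc2: "path_edges (xs @ [x, y]) = insert {x, y} (path_edges (xs @ [x]))"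
  using path_edges_append[of xs x "[y]"] by auto

lemma path_edges_rev: "path_edges (rev xs) = path_edges xs"
proof (induction xs rule: path_edges.induct)
  case (1 x y zs)
  have "path_edges (rev (x # y # zs)) = path_edges (rev zs @ [y, x])" by simp
  also have "\<dots> = insert {x, y} (path_edges (rev (y # zs)))"
    by (simp only: path_edges_snoc2) (simp add: insert_commute)
  finally show ?case using 1 by simp
qed auto

lemma finite_path_edges [simp]: "finite (path_edges xs)"
  by (induction xs rule: path_edges.induct) auto

lemma path_edges_subset: "e \<in> path_edges xs \<Longrightarrow> e \<subseteq> set xs"
  by (induction xs rule: path_edges.induct) auto

lemma Union_path_edges: "2 \<le> length xs \<Longrightarrow> \<Union> (path_edges xs) = set xs"
proof (induction xs rule: path_edges.induct)
  case (1 x y zs)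
  then show ?case by (cases zs) auto
qed auto

lemma path_edges_nth: "path_edges xs = {{xs ! i, xs ! Suc i} | i. Suc i < length xs}"
proof (induction xs rule: path_edges.induct)
  case (1 x y zs)
  have "{{(x # y # zs) ! i, (x # y # zs) ! Suc i} | i. Suc i < length (x # y # zs)}
     = insert {x, y} {{(y # zs) ! i, (y # zs) ! Suc i} | i. Suc i < length (y # zs)}" (is "?l = ?r")
  proof
    show "?l \<subseteq> ?r"
    proof
      fix e assume "e \<in> ?l"
      then obtain i where "e = {(x # y # zs) ! i, (x # y # zs) ! Suc i}" "Suc i < length (x # y # zs)"
        by blast
      then show "e \<in> ?r" by (cases i) auto
    qed
    have "{x, y} \<in> ?l" by (rule CollectI, rule exI[of _ 0]) simp
    moreover have "{(y # zs) ! i, (y # zs) ! Suc i} \<in> ?l" if "Suc i < length (y # zs)" for i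
      using that by (intro CollectI exI[of _ "Suc i"]) simp
    ultimately show "?r \<subseteq> ?l" by blast
  qed
  then show ?case using 1 by simp
qed auto

lemma card_path_edges: "distinct xs \<Longrightarrow> card (path_edges xs) = length xs - 1"
proof (induction xs rule: path_edges.induct)
  case (1 x y zs)
  have "{x, y} \<notin> path_edges (y # zs)" using path_edges_subset[of "{x,y}" "y # zs"] 1 by auto
  then show ?case using 1 by simp
qed auto

lemma path_edges_card2: "distinct xs \<Longrightarrow> e \<in> path_edges xs \<Longrightarrow> card e = 2"
  by (induction xs rule: path_edges.induct) auto

text \<open>An edge of a path joins two consecutive positions, and three distinct positions cannot
  be pairwise consecutive.\<close>

lemma path_edges_no_triangle:
  assumes "distinct xs" "{u, v} \<in> path_edges xs" "{v, w} \<in> path_edges xs" "{u, w} \<in> path_edges xs"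
    "u \<noteq> v" "v \<noteq> w" "u \<noteq> w"
  shows False
proof -
  have key: "\<exists>i j. x = xs ! i \<and> y = xs ! j \<and> (j = Suc i \<or> i = Suc j) \<and> i < length xs \<and> j < length xs"
    if "{x, y} \<in> path_edges xs" for x y
  proof -
    from that obtain i where "{x, y} = {xs ! i, xs ! Suc i}" "Suc i < length xs"
      unfolding path_edges_nth by blast
    then show ?thesis unfolding doubleton_eq_iff by (metis Suc_lessD)
  qed
  obtain i j where ij: "u = xs ! i" "v = xs ! j" "j = Suc i \<or> i = Suc j" "i < length xs" "j < length xs"
    using key assms by metis
  obtain j' k where jk: "v = xs ! j'" "w = xs ! k" "k = Suc j' \<or> j' = Suc k" "j' < length xs" "k < length xs"
    using key assms by metis
  obtain i' k' where ik: "u = xs ! i'" "w = xs ! k'" "k' = Suc i' \<or> i' = Suc k'" "i' < length xs" "k' < length xs"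
    using key assms by metis
  have "j' = j" "i' = i" "k' = k" using assms(1) ij jk ik nth_eq_iff_index_eq by metis+
  then show False using ij jk ik by auto
qed

lemma cycle_edges_split:
  "cycle_edges (a # xs @ b # ys) = path_edges (a # xs @ [b]) \<union> path_edges (b # ys @ [a])"
  using path_edges_append[of "a # xs" b "ys @ [a]"] by (simp add: cycle_edges_def)

lemma finite_cycle_edges [simp]: "finite (cycle_edges c)"
  by (simp add: cycle_edges_def)

lemma cycle_edges_rotate1: "cycle_edges (rotate1 c) = cycle_edges c"
proof (cases c)
  case (Cons a c')
  show ?thesis
  proof (cases c')
    case (Cons b ys)
    then show ?thesis
      using cycle_edges_split[of a "[]" b ys] cycle_edges_split[of b ys a "[]"] \<open>c = a # c'\<close>
      by (simp add: Un_commute)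
  qed (use Cons in simp)
qed simp

lemma cycle_edges_rotate: "cycle_edges (rotate n c) = cycle_edges c"
  by (induction n) (simp_all add: cycle_edges_rotate1)

lemma is_cycle_rotate: "is_cycle E (rotate n c) = is_cycle E c"
  by (simp add: is_cycle_def cycle_edges_rotate)

text \<open>This prepares a cycle for cutting: once \<open>a\<close> heads the list,
  \<open>xs\<close> and \<open>ys\<close> are the interiors of the two arcs between \<open>a\<close>
  and \<open>b\<close>.\<close>

lemma rotate_to_front:
  assumes "a \<in> set c" "b \<in> set c" "a \<noteq> b"
  obtains n xs ys where "rotate n c = a # xs @ b # ys"
proof -
  obtain us vs where c: "c = us @ a # vs" using assms(1) by (meson split_list)
  have r: "rotate (length us) c = a # vs @ us" unfolding c by (simp add: rotate_append)
  have "b \<in> set (vs @ us)" using assms c by auto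
  then obtain xs ys where "vs @ us = xs @ b # ys" by (meson split_list)
  then show thesis using that r by metis
qed

lemma Union_cycle_edges: "3 \<le> length c \<Longrightarrow> \<Union> (cycle_edges c) = set c"
  unfolding cycle_edges_def by (subst Union_path_edges) (auto intro!: hd_in_set)

text \<open>Without its first edge \<open>{a, b}\<close> the cycle is a path from \<open>b\<close>
  to \<open>a\<close>. With at least three vertices, \<open>a\<close> and \<open>b\<close> are not
  consecutive on that path, so the removed edge does not recur.\<close>

lemma card_cycle_edges:
  assumes "distinct c" "3 \<le> length c"
  shows "card (cycle_edges c) = length c"
proof -
  obtain a b ys where c: "c = a # b # ys" "ys \<noteq> []"
    using assms by (cases c; cases "tl c"; cases "tl (tl c)") auto
  have "path_edges (b # ys @ [a]) \<inter> path_edges [a, b] = {}"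
  proof -
    have "{a, b} \<notin> path_edges (b # ys @ [a])"
    proof
      assume "{a, b} \<in> path_edges (b # ys @ [a])"
      then obtain i where i: "{a, b} = {(b # ys @ [a]) ! i, (b # ys @ [a]) ! Suc i}"
          "Suc i < length (b # ys @ [a])" unfolding path_edges_nth by blast
      have d: "distinct (b # ys @ [a])" using assms c by auto
      have "b = (b # ys @ [a]) ! 0" "a = (b # ys @ [a]) ! (Suc (length ys))" by (simp_all add: nth_append)
      then have "(i = 0 \<and> Suc i = Suc (length ys)) \<or> (Suc i = 0 \<and> i = Suc (length ys))"
        using i d unfolding doubleton_eq_iff
        by (metis (no_types, lifting) Suc_lessD length_Cons length_append_singleton lessI nth_eq_iff_index_eq zero_less_Suc)
      then show False using c by auto
    qed
    then show ?thesis by simp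
  qed
  then have "card (cycle_edges c) = card (path_edges (b # ys @ [a])) + card (path_edges [a, b])"
    unfolding c using cycle_edges_split[of a "[]" b ys]
    by (simp add: card_Un_disjoint Un_commute)
  also have "\<dots> = length c" using assms c by (subst card_path_edges) auto
  finally show ?thesis .
qed

section \<open>Plane graphs\<close>

definition simple_graph :: "'a set \<Rightarrow> 'a set set \<Rightarrow> bool" where
  "simple_graph V E \<longleftrightarrow> finite V \<and> (\<forall>e \<in> E. e \<subseteq> V \<and> card e = 2)"

text \<open>The counterpart of \<open>plane_drawing\<close> for graphs whose edges are two-element
  sets, which removes the two orientations of an edge.\<close>

definition plane_embedding ::
    "'a set \<Rightarrow> 'a set set \<Rightarrow> ('a \<Rightarrow> complex) \<Rightarrow> ('a set \<Rightarrow> real \<Rightarrow> complex) \<Rightarrow> bool" where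
  "plane_embedding V E p g \<longleftrightarrow>
     inj_on p V \<and>
     (\<forall>e \<in> E. arc (g e) \<and> {pathstart (g e), pathfinish (g e)} = p ` e \<and>
        path_image (g e) \<inter> p ` V = p ` e) \<and>
     (\<forall>e \<in> E. \<forall>e' \<in> E. e \<noteq> e' \<longrightarrow> path_image (g e) \<inter> path_image (g e') \<subseteq> p ` (e \<inter> e'))"

definition edges_image :: "('a set \<Rightarrow> real \<Rightarrow> complex) \<Rightarrow> 'a set set \<Rightarrow> complex set" where
  "edges_image g F = (\<Union>e \<in> F. path_image (g e))"

definition drawn_in ::
    "'a set \<Rightarrow> 'a set set \<Rightarrow> ('a \<Rightarrow> complex) \<Rightarrow> ('a set \<Rightarrow> real \<Rightarrow> complex) \<Rightarrow> complex set \<Rightarrow> bool" where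
  "drawn_in V E p g S \<longleftrightarrow> p ` V \<subseteq> S \<and> edges_image g E \<subseteq> S"

definition closed_disc :: "('a set \<Rightarrow> real \<Rightarrow> complex) \<Rightarrow> 'a list \<Rightarrow> complex set" where
  "closed_disc g c = edges_image g (cycle_edges c) \<union> inside (edges_image g (cycle_edges c))"

section \<open>Elementary facts about drawings and arcs\<close>

lemma simple_graph_finite:
  assumes "simple_graph V E"
  shows "finite V" "finite E"
proof -
  show "finite V" using assms by (simp add: simple_graph_def)
  then show "finite E" using assms finite_subset[of E "Pow V"] by (auto simp: simple_graph_def)
qed

lemma simple_graph_subset:
  "simple_graph V E \<Longrightarrow> V' \<subseteq> V \<Longrightarrow> E' \<subseteq> E \<Longrightarrow> (\<And>e. e \<in> E' \<Longrightarrow> e \<subseteq> V') \<Longrightarrow> simple_graph V' E'"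
  unfolding simple_graph_def by (meson finite_subset subsetD)

lemma plane_embedding_subset:
  assumes emb: "plane_embedding V E p g" and "V' \<subseteq> V" "E' \<subseteq> E" "\<And>e. e \<in> E' \<Longrightarrow> e \<subseteq> V'"
  shows "plane_embedding V' E' p g"
  unfolding plane_embedding_def
proof (intro conjI ballI impI)
  note * = emb[unfolded plane_embedding_def]
  show "inj_on p V'" using inj_on_subset[OF conjunct1[OF *] assms(2)] .
  fix e assume e: "e \<in> E'"
  then have eE: "e \<in> E" using assms(3) by (rule subsetD[rotated])
  note e' = bspec[OF conjunct1[OF conjunct2[OF *]] eE]
  show "arc (g e)" "{pathstart (g e), pathfinish (g e)} = p ` e" using e' by simp_all
  have "path_image (g e) \<inter> p ` V = p ` e" using e' by simp
  moreover have "p ` e \<subseteq> p ` V'" "p ` V' \<subseteq> p ` V"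
    using assms(2) assms(4)[OF e] by (simp_all add: image_mono)
  ultimately show "path_image (g e) \<inter> p ` V' = p ` e" by (simp add: set_eq_iff subset_iff) metis
  fix e2 assume "e2 \<in> E'" "e \<noteq> e2"
  then show "path_image (g e) \<inter> path_image (g e2) \<subseteq> p ` (e \<inter> e2)"
    using * eE assms(3) by (meson subsetD)
qed

lemma edges_image_Un: "edges_image g (A \<union> B) = edges_image g A \<union> edges_image g B"
  by (auto simp: edges_image_def)

lemma edges_image_mono: "A \<subseteq> B \<Longrightarrow> edges_image g A \<subseteq> edges_image g B"
  by (auto simp: edges_image_def)

text \<open>The arc without its ends is dense in the arc: \<open>\<gamma>\<close> is continuous on
  the closure of the open unit interval.\<close>

lemma arc_subset_closed:
  fixes \<gamma> :: "real \<Rightarrow> complex"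
  assumes "arc \<gamma>" "closed S" "path_image \<gamma> - {pathstart \<gamma>, pathfinish \<gamma>} \<subseteq> S"
  shows "path_image \<gamma> \<subseteq> S"
proof -
  have cont: "continuous_on (closure {0<..<1::real}) \<gamma>"
    using arc_imp_path[OF assms(1)] by (simp add: path_def)
  have "\<gamma> ` {0<..<1} \<subseteq> S"
  proof
    fix z assume "z \<in> \<gamma> ` {0<..<1}"
    then obtain t where t: "0 < t" "t < 1" "z = \<gamma> t" by auto
    have "inj_on \<gamma> {0..1}" using assms(1) by (simp add: arc_def)
    then have "\<gamma> t \<noteq> \<gamma> 0" "\<gamma> t \<noteq> \<gamma> 1" using t by (auto dest!: inj_onD)
    then have "z \<notin> {pathstart \<gamma>, pathfinish \<gamma>}" using t by (simp add: pathstart_def pathfinish_def)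
    moreover have "z \<in> path_image \<gamma>" using t by (simp add: path_image_def)
    ultimately show "z \<in> S" using assms(3) by blast
  qed
  then have "\<gamma> ` closure {0<..<1} \<subseteq> S"
    using image_closure_subset[OF cont assms(2)] by simp
  then show ?thesis by (simp add: path_image_def)
qed

lemma infinite_arc_image:
  fixes \<gamma> :: "real \<Rightarrow> complex"
  assumes "arc \<gamma>"
  shows "infinite (path_image \<gamma>)"
proof
  assume "finite (path_image \<gamma>)"
  then have "finite {0..1::real}" using assms finite_imageD unfolding path_image_def arc_def by blast
  then show False by (simp add: infinite_Icc)
qed

locale plane_graph =
  fixes V :: "'a set" and E :: "'a set set" and p :: "'a \<Rightarrow> complex"
    and g :: "'a set \<Rightarrow> real \<Rightarrow> complex"
  assumes graph: "simple_graph V E" and embedding: "plane_embedding V E p g"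
begin

lemmas finite_VE = simple_graph_finite[OF graph]

lemma edge_subset: "e \<in> E \<Longrightarrow> e \<subseteq> V"
  and edge_card: "e \<in> E \<Longrightarrow> card e = 2"
  using graph by (auto simp: simple_graph_def)

lemma inj_p: "inj_on p V" using embedding by (simp add: plane_embedding_def)

lemma arc_g: "e \<in> E \<Longrightarrow> arc (g e)"
  and ends_g: "e \<in> E \<Longrightarrow> {pathstart (g e), pathfinish (g e)} = p ` e"
  and vertices_g: "e \<in> E \<Longrightarrow> path_image (g e) \<inter> p ` V = p ` e"
  and edges_meet: "e \<in> E \<Longrightarrow> e' \<in> E \<Longrightarrow> e \<noteq> e' \<Longrightarrow> path_image (g e) \<inter> path_image (g e') \<subseteq> p ` (e \<inter> e')"
  using embedding by (auto simp: plane_embedding_def)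

lemma finite_edge: "e \<in> E \<Longrightarrow> finite e"
  using edge_card by (metis card.infinite zero_neq_numeral)

lemma edges_image_vertices: "F \<subseteq> E \<Longrightarrow> v \<in> V \<Longrightarrow> p v \<in> edges_image g F \<longleftrightarrow> v \<in> \<Union> F"
proof
  assume F: "F \<subseteq> E" and v: "v \<in> V" and "p v \<in> edges_image g F"
  then obtain e where e: "e \<in> F" "p v \<in> path_image (g e)" by (auto simp: edges_image_def)
  then have "p v \<in> p ` e" using vertices_g F v by blast
  then have "v \<in> e" using e F v edge_subset inj_p by (metis inj_on_image_mem_iff subsetD)
  then show "v \<in> \<Union> F" using e by blast
next
  assume F: "F \<subseteq> E" and v: "v \<in> V" and "v \<in> \<Union> F"
  then obtain e where e: "e \<in> F" "v \<in> e" by blast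
  then have "p v \<in> path_image (g e)" using vertices_g F by blast
  then show "p v \<in> edges_image g F" using e by (auto simp: edges_image_def)
qed

lemma edge_Int_edges_image: "e \<in> E \<Longrightarrow> F \<subseteq> E \<Longrightarrow> e \<notin> F \<Longrightarrow> path_image (g e) \<inter> edges_image g F \<subseteq> p ` (e \<inter> \<Union> F)"
  using edges_meet by (fastforce simp: edges_image_def)

lemma edges_image_Int: "A \<subseteq> E \<Longrightarrow> B \<subseteq> E \<Longrightarrow> A \<inter> B = {} \<Longrightarrow>
    edges_image g A \<inter> edges_image g B \<subseteq> p ` (\<Union> A \<inter> \<Union> B)"
  using edge_Int_edges_image[of _ B] unfolding edges_image_def[of g A] by fast

lemma compact_edges_image: "F \<subseteq> E \<Longrightarrow> compact (edges_image g F)"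
  unfolding edges_image_def using finite_VE(2) arc_g
  by (intro compact_UN) (auto intro: finite_subset compact_arc_image)

text \<open>An edge outside \<open>F\<close> meets the drawing of \<open>F\<close> in at most its
  two end points, whereas its own arc is infinite.\<close>

lemma edge_in_edges_image:
  assumes "e \<in> E" "F \<subseteq> E" "path_image (g e) \<subseteq> edges_image g F"
  shows "e \<in> F"
proof (rule ccontr)
  assume "e \<notin> F"
  then have "path_image (g e) \<subseteq> p ` e" using edge_Int_edges_image[OF assms(1,2)] assms(3) by blast
  then show False using infinite_arc_image arc_g finite_edge assms(1) by (meson finite_imageI finite_subset)
qed

lemma edge_arc:
  assumes "{x, y} \<in> E"
  obtains \<gamma> where "arc \<gamma>" "pathstart \<gamma> = p x" "pathfinish \<gamma> = p y" "path_image \<gamma> = path_image (g {x, y})"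
proof -
  have "{pathstart (g {x, y}), pathfinish (g {x, y})} = {p x, p y}" using ends_g[OF assms] by simp
  then consider "pathstart (g {x, y}) = p x \<and> pathfinish (g {x, y}) = p y"
    | "pathstart (g {x, y}) = p y \<and> pathfinish (g {x, y}) = p x"
    by (auto simp: doubleton_eq_iff)
  then show thesis
  proof cases
    case 1 then show ?thesis using that[of "g {x, y}"] arc_g[OF assms] by auto
  next
    case 2 then show ?thesis using that[of "reversepath (g {x, y})"] arc_g[OF assms] by (auto simp: arc_reversepath)
  qed
qed

text \<open>The arcs of the edges are joined one by one. The first edge meets the remaining path
  only in \<open>p y\<close>, because \<open>x\<close> does not occur again; this is what keeps the
  join injective.\<close>

lemma path_arc:
  assumes "distinct xs" "2 \<le> length xs" "path_edges xs \<subseteq> E"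
  shows "\<exists>\<gamma>. arc \<gamma> \<and> pathstart \<gamma> = p (hd xs) \<and> pathfinish \<gamma> = p (last xs) \<and>
           path_image \<gamma> = edges_image g (path_edges xs)"
  using assms
proof (induction xs rule: path_edges.induct)
  case (1 x y zs)
  have e: "{x, y} \<in> E" using 1 by simp
  obtain \<gamma> where \<gamma>: "arc \<gamma>" "pathstart \<gamma> = p x" "pathfinish \<gamma> = p y" "path_image \<gamma> = path_image (g {x, y})"
    using edge_arc[OF e] .
  show ?case
  proof (cases "zs = []")
    case True
    then show ?thesis using \<gamma> by (intro exI[of _ \<gamma>]) (simp add: edges_image_def)
  next
    case False
    then have "2 \<le> length (y # zs)" by (cases zs) auto
    then obtain \<delta> where \<delta>: "arc \<delta>" "pathstart \<delta> = p y" "pathfinish \<delta> = p (last (y # zs))"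
        "path_image \<delta> = edges_image g (path_edges (y # zs))" using 1 by auto
    have "{x, y} \<notin> path_edges (y # zs)" using path_edges_subset[of "{x, y}" "y # zs"] 1 by auto
    then have "path_image \<gamma> \<inter> path_image \<delta> \<subseteq> p ` ({x, y} \<inter> \<Union> (path_edges (y # zs)))"
      using edge_Int_edges_image[OF e, of "path_edges (y # zs)"] 1(4) \<gamma> \<delta> by simp
    also have "\<dots> \<subseteq> {p y}" using path_edges_subset[of _ "y # zs"] 1(2) by auto
    finally have "arc (\<gamma> +++ \<delta>)" using \<gamma> \<delta> by (intro arc_join) auto
    moreover have "path_image (\<gamma> +++ \<delta>) = edges_image g (path_edges (x # y # zs))"
      using \<gamma> \<delta> by (simp add: path_image_join edges_image_def)
    ultimately show ?thesis using \<gamma> \<delta> by (intro exI[of _ "\<gamma> +++ \<delta>"]) simp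
  qed
qed auto

lemma cycle_vertices: "is_cycle E c \<Longrightarrow> set c \<subseteq> V"
  using Union_cycle_edges[of c] edge_subset unfolding is_cycle_def by blast

text \<open>A cycle consists of an edge and a path with the same two ends. Their arcs meet in these
  ends only, so the join is a simple closed curve and the Jordan curve theorem applies.\<close>

lemma cycle_curve:
  assumes "is_cycle E c"
  obtains \<gamma> where "simple_path \<gamma>" "pathfinish \<gamma> = pathstart \<gamma>" "path_image \<gamma> = edges_image g (cycle_edges c)"
proof -
  obtain a b ys where c: "c = a # b # ys" "ys \<noteq> []"
    using assms unfolding is_cycle_def by (cases c; cases "tl c"; cases "tl (tl c)") auto
  have ce: "cycle_edges c = path_edges [a, b] \<union> path_edges (b # ys @ [a])"
    unfolding c using cycle_edges_split[of a "[]" b ys] by simp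
  have d: "distinct c" "cycle_edges c \<subseteq> E" using assms by (auto simp: is_cycle_def)
  obtain \<gamma> where \<gamma>: "arc \<gamma>" "pathstart \<gamma> = p a" "pathfinish \<gamma> = p b" "path_image \<gamma> = edges_image g (path_edges [a, b])"
    using path_arc[of "[a, b]"] d c ce by auto
  have "\<exists>\<delta>. arc \<delta> \<and> pathstart \<delta> = p (hd (b # ys @ [a])) \<and> pathfinish \<delta> = p (last (b # ys @ [a])) \<and>
           path_image \<delta> = edges_image g (path_edges (b # ys @ [a]))"
    by (rule path_arc) (use d c ce in auto)
  then obtain \<delta> where \<delta>: "arc \<delta>" "pathstart \<delta> = p b" "pathfinish \<delta> = p a"
      "path_image \<delta> = edges_image g (path_edges (b # ys @ [a]))" by auto
  have "card (path_edges [a, b] \<union> path_edges (b # ys @ [a])) = Suc (card (path_edges (b # ys @ [a])))"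
    using card_cycle_edges[of c] assms card_path_edges[of "b # ys @ [a]"] c d unfolding ce[symmetric] is_cycle_def
    by auto
  then have disj: "path_edges [a, b] \<inter> path_edges (b # ys @ [a]) = {}"
    by (auto simp: insert_absorb)
  have "path_image \<gamma> \<inter> path_image \<delta> \<subseteq> p ` (\<Union> (path_edges [a, b]) \<inter> \<Union> (path_edges (b # ys @ [a])))"
    unfolding \<gamma> \<delta> by (rule edges_image_Int) (use d ce disj in auto)
  also have "\<dots> \<subseteq> {p a, p b}" by auto
  finally have "simple_path (\<gamma> +++ \<delta>)" using \<gamma> \<delta> by (intro simple_path_join_loop) auto
  moreover have "path_image (\<gamma> +++ \<delta>) = edges_image g (cycle_edges c)"
    using \<gamma> \<delta> unfolding ce edges_image_Un by (simp add: path_image_join)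
  ultimately show thesis using that[of "\<gamma> +++ \<delta>"] \<gamma> \<delta> by simp
qed

lemma edge_minus_ends_connected:
  assumes "e \<in> E"
  shows "connected (path_image (g e) - p ` e)"
  unfolding ends_g[OF assms, symmetric]
  by (rule connected_simple_path_endless[OF arc_imp_simple_path[OF arc_g[OF assms]]])

lemma edge_minus_ends_nonempty:
  assumes "e \<in> E"
  shows "path_image (g e) - p ` e \<noteq> {}"
proof
  assume "path_image (g e) - p ` e = {}"
  then have "path_image (g e) \<subseteq> p ` e" by simp
  then show False
    using infinite_arc_image[OF arc_g[OF assms]] finite_subset[OF _ finite_imageI[OF finite_edge[OF assms]]]
    by metis
qed

lemma edge_subset_closed:
  assumes "e \<in> E" "closed S" "path_image (g e) - p ` e \<subseteq> S"
  shows "path_image (g e) \<subseteq> S"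
  by (rule arc_subset_closed[OF arc_g[OF assms(1)] assms(2)])
    (use assms(3) in \<open>simp only: ends_g[OF assms(1)]\<close>)

text \<open>An edge without its ends is connected, so it cannot lie partly in each of two disjoint
  open sets. Every edge is assigned to one side of a cut in this way.\<close>

lemma edge_one_side:
  assumes "e \<in> E" "open A" "open B" "A \<inter> B = {}" "path_image (g e) - p ` e \<subseteq> A \<union> B"
  shows "path_image (g e) - p ` e \<subseteq> A \<or> path_image (g e) - p ` e \<subseteq> B"
  using connectedD[OF edge_minus_ends_connected[OF assms(1)] assms(2,3)] assms(4,5) by blast

lemma closed_closed_disc: "cycle_edges c \<subseteq> E \<Longrightarrow> closed (closed_disc g c)"
  unfolding closed_disc_def union_with_inside
  using compact_edges_image compact_imp_closed open_outside by blast

lemma open_inside_edges: "F \<subseteq> E \<Longrightarrow> open (inside (edges_image g F))"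
  using compact_edges_image compact_imp_closed open_inside by blast

end

section \<open>Cutting a plane graph along a cycle or a chord path\<close>

text \<open>The map \<open>f\<close> takes infinity to \<open>0\<close> and \<open>z0\<close> to
  infinity. Hence the image of the outside together with \<open>0\<close> is a bounded open set
  \<open>A\<close>, the image of the inside without \<open>z0\<close> is an open set
  \<open>B\<close>, and the two are disjoint and cover the complement of the image of
  \<open>C\<close>. A component that meets \<open>A\<close> therefore stays in \<open>A\<close> and
  is bounded.\<close>

lemma inversion_outside_subset_inside:
  fixes C :: "complex set"
  assumes "compact C" and z0: "z0 \<in> inside C"
  defines "f \<equiv> \<lambda>z. 1 / (z - z0)"
  shows "f ` outside C \<subseteq> inside (f ` C)"
proof
  define A where "A = insert 0 (f ` outside C)"
  define B where "B = f ` (inside C - {z0})"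
  have cC: "closed C" using assms(1) by (rule compact_imp_closed)
  \<comment> \<open>Away from \<open>z0\<close> the map \<open>f\<close> has the inverse
    \<open>z0 + 1 / w\<close>, so images under \<open>f\<close> are preimages under a continuous
    map; this makes \<open>f\<close> open there.\<close>
  have img: "f ` U = {w \<in> - {0}. z0 + 1 / w \<in> U}" if "z0 \<notin> U" for U
  proof
    show "f ` U \<subseteq> {w \<in> - {0}. z0 + 1 / w \<in> U}"
      using that by (auto simp: f_def)
    show "{w \<in> - {0}. z0 + 1 / w \<in> U} \<subseteq> f ` U"
    proof
      fix w assume "w \<in> {w \<in> - {0}. z0 + 1 / w \<in> U}"
      then show "w \<in> f ` U" by (intro image_eqI[of _ _ "z0 + 1 / w"]) (auto simp: f_def)
    qed
  qed
  have op: "open (f ` U)" if "open U" "z0 \<notin> U" for U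
  proof -
    have "continuous_on (- {0}) (\<lambda>w. z0 + 1 / w)" by (intro continuous_intros) auto
    then have "open ((\<lambda>w. z0 + 1 / w) -` U \<inter> - {0})"
      using that(1) by (simp add: continuous_on_open_vimage open_Compl)
    moreover have "(\<lambda>w. z0 + 1 / w) -` U \<inter> - {0} = f ` U"
      unfolding img[OF that(2)] by auto
    ultimately show ?thesis by simp
  qed
  have z0C: "z0 \<notin> C" "z0 \<notin> outside C" using z0 inside_Int_outside[of C] inside_no_overlap[of C] by blast+
  \<comment> \<open>Since \<open>1 / 0 = 0\<close>, the map \<open>f\<close> sends \<open>z0\<close>
    to \<open>0\<close>, a value that it takes nowhere else; so it is injective on the whole
    plane.\<close>
  have inj: "inj f" by (auto simp: inj_def f_def divide_simps split: if_splits)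
  have bdd: "bounded (C \<union> inside C)"
    using assms(1) by (simp add: bounded_inside compact_imp_bounded)
  then obtain M where M: "M > 0" "\<And>z. z \<in> C \<union> inside C \<Longrightarrow> norm (z - z0) \<le> M"
    using bounded_pos[of "(\<lambda>z. z - z0) ` (C \<union> inside C)"] bounded_translation_minus[OF bdd, of z0] by auto
  \<comment> \<open>Points near \<open>0\<close> are images of points far from \<open>z0\<close>,
    which lie beyond the bounded set \<open>C \<union> inside C\<close>. So adding \<open>0\<close>
    to the image of the outside gives an open set.\<close>
  have sub: "ball 0 (1 / M) \<subseteq> A"
  proof
    fix w :: complex assume w: "w \<in> ball 0 (1 / M)"
    show "w \<in> A"
    proof (cases "w = 0")
      case False
      have "norm (1 / w) > M" using w False M(1) by (simp add: norm_divide field_simps)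
      then have "z0 + 1 / w \<notin> C \<union> inside C" using M(2)[of "z0 + 1 / w"] by auto
      then have "z0 + 1 / w \<in> outside C" using inside_Un_outside[of C] by blast
      then show ?thesis using False img[OF z0C(2)] by (auto simp: A_def)
    qed (simp add: A_def)
  qed
  have "A = f ` outside C \<union> ball 0 (1 / M)" using sub M(1) by (auto simp: A_def)
  then have oA: "open A" using op[OF open_outside[OF cC] z0C(2)] by auto
  have oB: "open B" unfolding B_def by (rule op) (use cC open_inside in auto)
  have AB: "A \<inter> B = {}"
  proof -
    have "f ` outside C \<inter> B = f ` (outside C \<inter> (inside C - {z0}))"
      by (simp add: B_def image_Int[OF inj])
    also have "\<dots> = {}" using inside_Int_outside[of C] by blast
    finally show ?thesis by (auto simp: A_def) (auto simp: B_def f_def)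
  qed
  have cover: "- f ` C \<subseteq> A \<union> B"
  proof
    fix w assume w: "w \<in> - f ` C"
    show "w \<in> A \<union> B"
    proof (cases "w = 0")
      case False
      then have "w = f (z0 + 1 / w)" by (simp add: f_def)
      then have "z0 + 1 / w \<notin> C" using w by (metis ComplD imageI)
      then have "z0 + 1 / w \<in> inside C - {z0} \<or> z0 + 1 / w \<in> outside C"
        using inside_Un_outside[of C] False by (metis Compl_iff DiffI UnE add_cancel_right_right divide_eq_0_iff one_neq_zero singletonD)
      then show ?thesis using \<open>w = f (z0 + 1 / w)\<close> unfolding A_def B_def by blast
    qed (simp add: A_def)
  qed
  \<comment> \<open>A ball around \<open>z0\<close> lies inside \<open>C\<close>; outer points keep
    this distance from \<open>z0\<close>, which bounds their images by \<open>1 / e\<close>.\<close>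
  obtain e where e: "e > 0" "ball z0 e \<subseteq> inside C"
    using z0 open_inside[OF cC] by (meson open_contains_ball)
  have bA: "bounded A"
  proof (rule boundedI)
    fix w assume "w \<in> A"
    then consider "w = 0" | z where "z \<in> outside C" "w = f z" by (auto simp: A_def)
    then show "norm w \<le> 1 / e"
    proof cases
      case 2
      then have "z \<notin> ball z0 e" using e inside_Int_outside[of C] by blast
      then have "norm (z - z0) \<ge> e" by (simp add: dist_norm norm_minus_commute)
      then show ?thesis using 2 e(1) by (simp add: f_def norm_divide frac_le)
    qed (use e in simp)
  qed
  fix w assume w: "w \<in> f ` outside C"
  then have wA: "w \<in> A" by (simp add: A_def)
  obtain z where z: "z \<in> outside C" "w = f z" using w by blast
  have "z \<notin> C" using z(1) outside_no_overlap[of C] by blast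
  then have wC: "w \<notin> f ` C" unfolding z(2) inj_image_mem_iff[OF inj] .
  define K where "K = connected_component_set (- f ` C) w"
  have "connected K" "K \<subseteq> - f ` C" "w \<in> K"
    using wC by (auto simp: K_def connected_component_subset)
  then have "K \<subseteq> A" using connectedD[OF \<open>connected K\<close> oA oB] AB cover wA by blast
  then have "bounded K" using bA bounded_subset by blast
  then show "w \<in> inside (f ` C)" using wC by (simp add: inside_def K_def)
qed

context plane_graph
begin

section \<open>Subgraphs drawn in a region and the two ways of cutting\<close>

lemma in_edges_imageI: "e \<in> F \<Longrightarrow> path_image (g e) \<subseteq> edges_image g F"
  by (auto simp: edges_image_def)

lemma drawn_in_edge: "drawn_in V E p g S \<Longrightarrow> e \<in> E \<Longrightarrow> path_image (g e) \<subseteq> S"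
  by (auto simp: drawn_in_def edges_image_def)

lemma sub_plane_graph:
  assumes "V' \<subseteq> V" "E' \<subseteq> E" "\<And>e. e \<in> E' \<Longrightarrow> e \<subseteq> V'"
  shows "plane_graph V' E' p g"
  using simple_graph_subset[OF graph assms] plane_embedding_subset[OF embedding assms]
  by (rule plane_graph.intro)

lemma restrict_to_closed:
  fixes S :: "complex set"
  defines "V' \<equiv> {v \<in> V. p v \<in> S}" and "E' \<equiv> {e \<in> E. path_image (g e) \<subseteq> S}"
  shows "plane_graph V' E' p g" "drawn_in V' E' p g S"
proof -
  show "plane_graph V' E' p g"
  proof (rule sub_plane_graph)
    fix e assume e: "e \<in> E'"
    then have "p ` e \<subseteq> S" using vertices_g[of e] by (auto simp: E'_def)
    then show "e \<subseteq> V'" using edge_subset[of e] e by (auto simp: V'_def E'_def)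
  qed (auto simp: V'_def E'_def)
  show "drawn_in V' E' p g S" by (auto simp: drawn_in_def V'_def E'_def edges_image_def)
qed

text \<open>The cycle consists of two paths from \<open>a\<close> to \<open>b\<close>, and the chord
  path \<open>P\<close> is a third one, so the three arcs form a theta curve. It divides the inside
  of \<open>c\<close> into the insides of \<open>c1\<close> and \<open>c2\<close> and the interior
  of \<open>P\<close>. Every edge off the theta curve avoids it and lies on one side by
  connectedness.\<close>

lemma split_disc:
  fixes a b :: 'a and xs ys ks :: "'a list"
  defines "c \<equiv> a # xs @ b # ys" and "P \<equiv> a # ks @ [b]"
    and "c1 \<equiv> a # xs @ b # rev ks" and "c2 \<equiv> a # ks @ b # ys"
  assumes c: "is_cycle E c" and drawn: "drawn_in V E p g (closed_disc g c)"
    and P: "path_edges P \<subseteq> E" "distinct ks" "set ks \<inter> set c = {}" "path_edges P \<inter> cycle_edges c = {}"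
  obtains V1 E1 V2 E2 where
    "plane_graph V1 E1 p g" "drawn_in V1 E1 p g (closed_disc g c1)" "is_cycle E1 c1"
    "plane_graph V2 E2 p g" "drawn_in V2 E2 p g (closed_disc g c2)" "is_cycle E2 c2"
    "V1 \<union> V2 = V" "V1 \<inter> V2 = set P" "E1 \<union> E2 = E" "E1 \<inter> E2 = path_edges P"
proof -
  define Q1 where "Q1 = a # xs @ [b]"
  \<comment> \<open>The list \<open>ys\<close> is reversed so that all three paths run from
    \<open>a\<close> to \<open>b\<close>.\<close>
  define Q2 where "Q2 = a # rev ys @ [b]"
  have eQ2: "path_edges (b # ys @ [a]) = path_edges Q2"
    using path_edges_rev[of "b # ys @ [a]"] by (simp add: Q2_def)
  have eP: "path_edges (b # rev ks @ [a]) = path_edges P"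
    using path_edges_rev[of P] by (simp add: P_def)
  have ce: "cycle_edges c = path_edges Q1 \<union> path_edges Q2"
    unfolding c_def cycle_edges_split Q1_def eQ2[unfolded Q2_def] Q2_def ..
  have ce1: "cycle_edges c1 = path_edges Q1 \<union> path_edges P"
    unfolding c1_def cycle_edges_split Q1_def eP ..
  have ce2: "cycle_edges c2 = path_edges P \<union> path_edges Q2"
    unfolding c2_def cycle_edges_split P_def eQ2 ..
  have dc: "distinct c" "3 \<le> length c" "cycle_edges c \<subseteq> E" using c by (auto simp: is_cycle_def)
  have dist: "distinct Q1" "distinct Q2" "distinct P"
    using dc P by (auto simp: Q1_def Q2_def P_def c_def)
  have ab: "a \<noteq> b" using dc by (auto simp: c_def)
  have sets: "set Q1 \<inter> set Q2 = {a, b}" "set Q1 \<inter> set P = {a, b}" "set Q2 \<inter> set P = {a, b}"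
    using dc P(3) by (auto simp: Q1_def Q2_def P_def c_def)
  have Q1E: "path_edges Q1 \<subseteq> E" and Q2E: "path_edges Q2 \<subseteq> E" using dc ce by auto
  \<comment> \<open>Counting shows that the two halves of the cycle share no edge: their numbers of
    edges add up to the length of \<open>c\<close>.\<close>
  have "length c = length Q1 + length Q2 - 2" by (simp add: c_def Q1_def Q2_def)
  moreover have "length Q1 \<ge> 2" "length Q2 \<ge> 2" by (simp_all add: Q1_def Q2_def)
  ultimately have "card (path_edges Q1 \<union> path_edges Q2) = card (path_edges Q1) + card (path_edges Q2)"
    using card_cycle_edges[OF dc(1,2)] dist by (simp add: ce card_path_edges)
  then have Q12: "path_edges Q1 \<inter> path_edges Q2 = {}"
    using card_Un_Int[of "path_edges Q1" "path_edges Q2"] by simp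
  have Q1P: "path_edges Q1 \<inter> path_edges P = {}" and Q2P: "path_edges Q2 \<inter> path_edges P = {}"
    using P(4) ce by auto
  define S1 where "S1 = edges_image g (path_edges Q1)"
  define S2 where "S2 = edges_image g (path_edges Q2)"
  define S where "S = edges_image g (path_edges P)"
  have len: "2 \<le> length Q1" "2 \<le> length Q2" "2 \<le> length P" by (simp_all add: Q1_def Q2_def P_def)
  obtain \<gamma>1 where \<gamma>1: "arc \<gamma>1" "pathstart \<gamma>1 = p a" "pathfinish \<gamma>1 = p b" "path_image \<gamma>1 = S1"
    using path_arc[OF dist(1) len(1) Q1E] unfolding S1_def by (auto simp: Q1_def)
  obtain \<gamma>2 where \<gamma>2: "arc \<gamma>2" "pathstart \<gamma>2 = p a" "pathfinish \<gamma>2 = p b" "path_image \<gamma>2 = S2"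
    using path_arc[OF dist(2) len(2) Q2E] unfolding S2_def by (auto simp: Q2_def)
  obtain \<gamma> where \<gamma>: "arc \<gamma>" "pathstart \<gamma> = p a" "pathfinish \<gamma> = p b" "path_image \<gamma> = S"
    using path_arc[OF dist(3) len(3) P(1)] unfolding S_def by (auto simp: P_def)
  have meet: "edges_image g (path_edges X) \<inter> edges_image g (path_edges Y) = {p a, p b}"
    if "path_edges X \<subseteq> E" "path_edges Y \<subseteq> E" "path_edges X \<inter> path_edges Y = {}"
      "set X \<inter> set Y = {a, b}" "2 \<le> length X" "2 \<le> length Y" for X Y
  proof
    show "edges_image g (path_edges X) \<inter> edges_image g (path_edges Y) \<subseteq> {p a, p b}"
      using edges_image_Int[OF that(1-3)] that(4-6) by (simp add: Union_path_edges)
    have aX: "a \<in> \<Union> (path_edges X)" "b \<in> \<Union> (path_edges X)" "a \<in> \<Union> (path_edges Y)" "b \<in> \<Union> (path_edges Y)"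
      using that(4-6) by (auto simp: Union_path_edges)
    moreover have "a \<in> V" "b \<in> V" using aX that(1) edge_subset by blast+
    ultimately show "{p a, p b} \<subseteq> edges_image g (path_edges X) \<inter> edges_image g (path_edges Y)"
      using edges_image_vertices that(1,2) by simp
  qed
  have S12: "S1 \<inter> S2 = {p a, p b}" and S1S: "S1 \<inter> S = {p a, p b}" and S2S: "S2 \<inter> S = {p a, p b}"
    using meet[OF Q1E Q2E Q12 sets(1) len(1,2)] meet[OF Q1E P(1) Q1P sets(2) len(1,3)]
      meet[OF Q2E P(1) Q2P sets(3) len(2,3)] by (simp_all add: S1_def S2_def S_def)
  have Cimg: "edges_image g (cycle_edges c) = S1 \<union> S2"
    and C1img: "edges_image g (cycle_edges c1) = S1 \<union> S"
    and C2img: "edges_image g (cycle_edges c2) = S2 \<union> S"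
    by (auto simp: ce ce1 ce2 edges_image_Un S1_def S2_def S_def)
  have abV: "a \<in> V" "b \<in> V" using cycle_vertices[OF c] by (auto simp: c_def)
  then have pab: "p a \<noteq> p b" using ab inj_p by (auto dest: inj_onD)
  have off: "(path_image (g e) - p ` e) \<inter> edges_image g F = {}" if "e \<in> E" "F \<subseteq> E" "e \<notin> F" for e F
    using edge_Int_edges_image[OF that] by blast
  \<comment> \<open>The theta-curve lemma requires the third arc to enter the inside. Any edge of
    \<open>P\<close> does so: it is drawn in the disc and, apart from its ends, avoids the
    cycle.\<close>
  obtain e0 where e0: "e0 \<in> path_edges P" using len(3) by (metis Union_path_edges Union_empty set_empty P_def list.discI equals0I)
  have e0E: "e0 \<in> E" using e0 P by auto
  have "path_image (g e0) - p ` e0 \<subseteq> inside (S1 \<union> S2)"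
    using off[OF e0E dc(3)] e0 P(4) drawn_in_edge[OF drawn e0E] by (auto simp: closed_disc_def Cimg)
  then have ne: "S \<inter> inside (S1 \<union> S2) \<noteq> {}"
    using edge_minus_ends_nonempty[OF e0E] in_edges_imageI[OF e0] by (auto simp: S_def)
  obtain I12: "inside (S1 \<union> S) \<inter> inside (S2 \<union> S) = {}"
    and IU: "inside (S1 \<union> S) \<union> inside (S2 \<union> S) \<union> (S - {p a, p b}) = inside (S1 \<union> S2)"
    using split_inside_simple_closed_curve[of \<gamma>1 "p a" "p b" \<gamma>2 \<gamma>] \<gamma>1 \<gamma>2 \<gamma> S12 S1S S2S pab ne
    by (auto simp: arc_imp_simple_path)
  have no: "inside T \<inter> T = {}" for T :: "complex set" by simp
  have D1: "closed_disc g c1 = S1 \<union> S \<union> inside (S1 \<union> S)"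
    and D2: "closed_disc g c2 = S2 \<union> S \<union> inside (S2 \<union> S)"
    and D: "closed_disc g c = S1 \<union> S2 \<union> inside (S1 \<union> S2)"
    by (simp_all add: closed_disc_def Cimg C1img C2img)
  have DU: "closed_disc g c = closed_disc g c1 \<union> closed_disc g c2"
  proof -
    have "S \<subseteq> closed_disc g c" using IU S1S unfolding D by blast
    then show ?thesis using IU unfolding D D1 D2 by blast
  qed
  have DI: "closed_disc g c1 \<inter> closed_disc g c2 \<subseteq> S"
  proof -
    have "inside (S1 \<union> S) \<inter> S2 = {}" "inside (S2 \<union> S) \<inter> S1 = {}"
      using IU no[of "S1 \<union> S2"] by blast+
    moreover have "S1 \<inter> S2 \<subseteq> S" using S12 S1S by blast
    ultimately show ?thesis using I12 no[of "S1 \<union> S"] no[of "S2 \<union> S"] unfolding D1 D2 by blast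
  qed
  define V1 where "V1 = {v \<in> V. p v \<in> closed_disc g c1}"
  define E1 where "E1 = {e \<in> E. path_image (g e) \<subseteq> closed_disc g c1}"
  define V2 where "V2 = {v \<in> V. p v \<in> closed_disc g c2}"
  define E2 where "E2 = {e \<in> E. path_image (g e) \<subseteq> closed_disc g c2}"
  have c1E: "cycle_edges c1 \<subseteq> E" and c2E: "cycle_edges c2 \<subseteq> E" using ce1 ce2 Q1E Q2E P by auto
  have "cycle_edges c1 \<subseteq> E1"
    using c1E in_edges_imageI[of _ "cycle_edges c1"] by (auto simp: E1_def closed_disc_def)
  moreover have "distinct c1" using dc P by (auto simp: c1_def c_def)
  \<comment> \<open>If both lists were empty, the edge \<open>{a, b}\<close> would belong to
    \<open>P\<close> and to the cycle.\<close>
  moreover have "xs \<noteq> [] \<or> ks \<noteq> []"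
    using P(4) by (auto simp: ce Q1_def P_def)
  then have "3 \<le> length c1" by (cases xs; cases ks) (auto simp: c1_def)
  ultimately have cyc1: "is_cycle E1 c1" by (simp add: is_cycle_def)
  have "cycle_edges c2 \<subseteq> E2"
    using c2E in_edges_imageI[of _ "cycle_edges c2"] by (auto simp: E2_def closed_disc_def)
  moreover have "distinct c2" using dc P by (auto simp: c2_def c_def)
  moreover have "ys \<noteq> [] \<or> ks \<noteq> []"
    using P(4) by (auto simp: ce Q2_def P_def)
  then have "3 \<le> length c2" by (cases ys; cases ks) (auto simp: c2_def)
  ultimately have cyc2: "is_cycle E2 c2" by (simp add: is_cycle_def)
  have VU: "V1 \<union> V2 = V"
    using drawn DU by (auto simp: V1_def V2_def drawn_in_def)
  have PV: "set P \<subseteq> V" using Union_path_edges[OF len(3)] P(1) edge_subset by blast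
  have S_disc: "S \<subseteq> closed_disc g c1 \<inter> closed_disc g c2" using D1 D2 by blast
  have VI: "V1 \<inter> V2 = set P"
  proof -
    have "v \<in> set P \<longleftrightarrow> p v \<in> S" if "v \<in> V" for v
      using edges_image_vertices[OF P(1) that] Union_path_edges[OF len(3)] by (simp add: S_def)
    then show ?thesis using PV DI S_disc by (auto simp: V1_def V2_def)
  qed
  have EI: "E1 \<inter> E2 = path_edges P"
  proof
    show "E1 \<inter> E2 \<subseteq> path_edges P"
    proof
      fix e assume "e \<in> E1 \<inter> E2"
      then have "e \<in> E" "path_image (g e) \<subseteq> closed_disc g c1 \<inter> closed_disc g c2"
        by (auto simp only: E1_def E2_def Int_iff mem_Collect_eq Int_subset_iff)
      then have "e \<in> E" "path_image (g e) \<subseteq> S" using DI by (auto dest: subset_trans)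
      then show "e \<in> path_edges P" using edge_in_edges_image P(1) by (simp add: S_def)
    qed
    show "path_edges P \<subseteq> E1 \<inter> E2"
    proof
      fix e assume e: "e \<in> path_edges P"
      then have "path_image (g e) \<subseteq> S" using in_edges_imageI by (simp add: S_def)
      then show "e \<in> E1 \<inter> E2" using e P(1) S_disc by (auto simp: E1_def E2_def)
    qed
  qed
  have EU: "E1 \<union> E2 = E"
  proof
    show "E1 \<union> E2 \<subseteq> E" by (auto simp: E1_def E2_def)
    show "E \<subseteq> E1 \<union> E2"
    proof
      fix e assume e: "e \<in> E"
      show "e \<in> E1 \<union> E2"
      proof (cases "e \<in> cycle_edges c \<union> path_edges P")
        case True
        then have "e \<in> cycle_edges c1 \<union> cycle_edges c2" using ce ce1 ce2 by blast
        then show ?thesis using \<open>cycle_edges c1 \<subseteq> E1\<close> \<open>cycle_edges c2 \<subseteq> E2\<close> by blast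
      next
        case False
        then have "(path_image (g e) - p ` e) \<inter> (S1 \<union> S2) = {}" "(path_image (g e) - p ` e) \<inter> S = {}"
          using off[OF e dc(3)] off[OF e P(1)] by (auto simp: Cimg S_def)
        moreover have "path_image (g e) - p ` e \<subseteq> S1 \<union> S2 \<union> inside (S1 \<union> S2)"
          using drawn_in_edge[OF drawn e] D by blast
        ultimately have sub: "path_image (g e) - p ` e \<subseteq> inside (S1 \<union> S) \<union> inside (S2 \<union> S)"
          using IU by blast
        have "open (inside (S1 \<union> S))" "open (inside (S2 \<union> S))"
          using open_inside_edges[OF c1E] open_inside_edges[OF c2E] by (simp_all add: C1img C2img)
        then consider "path_image (g e) - p ` e \<subseteq> closed_disc g c1" | "path_image (g e) - p ` e \<subseteq> closed_disc g c2"
          using edge_one_side[OF e _ _ I12 sub] D1 D2 by blast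
        then show ?thesis
          using edge_subset_closed[OF e closed_closed_disc[OF c1E]] edge_subset_closed[OF e closed_closed_disc[OF c2E]] e
          by cases (auto simp: E1_def E2_def)
      qed
    qed
  qed
  show thesis
  proof (rule that)
    show "plane_graph V1 E1 p g" "drawn_in V1 E1 p g (closed_disc g c1)"
      "plane_graph V2 E2 p g" "drawn_in V2 E2 p g (closed_disc g c2)"
      unfolding V1_def E1_def V2_def E2_def by (rule restrict_to_closed)+
  qed fact+
qed

lemma plane_graph_transform:
  assumes "drawn_in V E p g S" "inj_on f S" "continuous_on S f"
  shows "plane_graph V E (f \<circ> p) (\<lambda>e. f \<circ> g e)"
proof (intro plane_graph.intro)
  show "simple_graph V E" by (rule graph)
  have pS: "p ` V \<subseteq> S" using assms(1) by (simp add: drawn_in_def)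
  show "plane_embedding V E (f \<circ> p) (\<lambda>e. f \<circ> g e)"
    unfolding plane_embedding_def
  proof (intro conjI ballI impI)
    show "inj_on (f \<circ> p) V" using inj_p inj_on_subset[OF assms(2) pS] by (rule comp_inj_on)
    fix e assume e: "e \<in> E"
    have eS: "path_image (g e) \<subseteq> S" using drawn_in_edge[OF assms(1) e] .
    show "arc (f \<circ> g e)"
      unfolding arc_def
    proof
      show "path (f \<circ> g e)"
        using arc_imp_path[OF arc_g[OF e]] continuous_on_subset[OF assms(3) eS] by (rule path_continuous_image)
      show "inj_on (f \<circ> g e) {0..1}"
        using arc_g[OF e] inj_on_subset[OF assms(2) eS] unfolding arc_def path_image_def by (blast intro: comp_inj_on)
    qed
    have "{pathstart (f \<circ> g e), pathfinish (f \<circ> g e)} = f ` {pathstart (g e), pathfinish (g e)}"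
      by (simp add: pathstart_compose pathfinish_compose)
    also have "\<dots> = (f \<circ> p) ` e" by (simp only: ends_g[OF e] image_comp)
    finally show "{pathstart (f \<circ> g e), pathfinish (f \<circ> g e)} = (f \<circ> p) ` e" .
    have "path_image (f \<circ> g e) \<inter> (f \<circ> p) ` V = f ` (path_image (g e) \<inter> p ` V)"
      unfolding path_image_compose image_comp[symmetric] by (rule inj_on_image_Int[OF assms(2) eS pS, symmetric])
    also have "\<dots> = (f \<circ> p) ` e" by (simp only: vertices_g[OF e] image_comp)
    finally show "path_image (f \<circ> g e) \<inter> (f \<circ> p) ` V = (f \<circ> p) ` e" .
    fix e' assume e': "e' \<in> E" "e \<noteq> e'"
    have "path_image (f \<circ> g e) \<inter> path_image (f \<circ> g e') = f ` (path_image (g e) \<inter> path_image (g e'))"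
      unfolding path_image_compose
      by (rule inj_on_image_Int[OF assms(2) eS drawn_in_edge[OF assms(1) e'(1)], symmetric])
    also have "\<dots> \<subseteq> (f \<circ> p) ` (e \<inter> e')"
      unfolding image_comp[symmetric] by (rule image_mono[OF edges_meet[OF e e']])
    finally show "path_image (f \<circ> g e) \<inter> path_image (f \<circ> g e') \<subseteq> (f \<circ> p) ` (e \<inter> e')" .
  qed
qed

text \<open>The inner part keeps its drawing. The outer part is redrawn by an inversion centred
  inside the curve, which turns the unbounded region into a disc, so that both parts are discs
  bounded by \<open>c\<close>.\<close>

lemma split_inside_outside:
  assumes c: "is_cycle E c"
  obtains V1 E1 V2 E2 p' g' where
    "plane_graph V1 E1 p g" "drawn_in V1 E1 p g (closed_disc g c)" "is_cycle E1 c"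
    "plane_graph V2 E2 p' g'" "drawn_in V2 E2 p' g' (closed_disc g' c)" "is_cycle E2 c"
    "V1 \<union> V2 = V" "V1 \<inter> V2 = set c" "E1 \<union> E2 = E" "E1 \<inter> E2 = cycle_edges c"
proof -
  define C where "C = edges_image g (cycle_edges c)"
  have ce: "distinct c" "3 \<le> length c" "cycle_edges c \<subseteq> E" using c by (auto simp: is_cycle_def)
  have compC: "compact C" unfolding C_def by (rule compact_edges_image[OF ce(3)])
  then have cC: "closed C" by (rule compact_imp_closed)
  obtain \<gamma> where "simple_path \<gamma>" "pathfinish \<gamma> = pathstart \<gamma>" "path_image \<gamma> = C"
    using cycle_curve[OF c] unfolding C_def .
  then obtain z0 where z0: "z0 \<in> inside C" using Jordan_inside_outside[of \<gamma>] by blast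
  define f where "f = (\<lambda>z. 1 / (z - z0))"
  define S where "S = - inside C"
  have disc: "closed_disc g c = C \<union> inside C" by (simp add: closed_disc_def C_def)
  have C_Int: "C \<inter> inside C = {}" using inside_no_overlap by blast
  define V1 where "V1 = {v \<in> V. p v \<in> closed_disc g c}"
  define E1 where "E1 = {e \<in> E. path_image (g e) \<subseteq> closed_disc g c}"
  define V2 where "V2 = {v \<in> V. p v \<in> S}"
  define E2 where "E2 = {e \<in> E. path_image (g e) \<subseteq> S}"
  have G2: "plane_graph V2 E2 p g" "drawn_in V2 E2 p g S"
    unfolding V2_def E2_def by (rule restrict_to_closed)+
  have inC: "path_image (g e) \<subseteq> C" if "e \<in> cycle_edges c" for e
    using in_edges_imageI[OF that] by (simp add: C_def)
  have sub: "C \<subseteq> closed_disc g c" "C \<subseteq> S" using disc C_Int by (auto simp: S_def)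
  have cE: "cycle_edges c \<subseteq> E1" "cycle_edges c \<subseteq> E2"
  proof -
    have "e \<in> E1 \<and> e \<in> E2" if e: "e \<in> cycle_edges c" for e
      using subset_trans[OF inC[OF e] sub(1)] subset_trans[OF inC[OF e] sub(2)] subsetD[OF ce(3) e]
      by (simp add: E1_def E2_def)
    then show "cycle_edges c \<subseteq> E1" "cycle_edges c \<subseteq> E2" by auto
  qed
  have cyc: "is_cycle E1 c" "is_cycle E2 c" using cE ce by (simp_all add: is_cycle_def)
  define p' where "p' = f \<circ> p"
  define g' where "g' = (\<lambda>e. f \<circ> g e)"
  have inj: "inj_on f S" by (auto simp: inj_on_def f_def divide_simps split: if_splits)
  have cont: "continuous_on S f" unfolding f_def using z0 by (intro continuous_intros) (auto simp: S_def)
  have G2': "plane_graph V2 E2 p' g'"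
    unfolding p'_def g'_def by (rule plane_graph.plane_graph_transform[OF G2 inj cont])
  have img: "edges_image g' F = f ` edges_image g F" for F
    by (auto simp: edges_image_def g'_def path_image_compose)
  have "f ` S \<subseteq> closed_disc g' c"
  proof -
    have "S = C \<union> outside C" using union_with_outside[of C] by (simp add: S_def)
    moreover have "closed_disc g' c = f ` C \<union> inside (f ` C)" by (simp add: closed_disc_def img C_def)
    moreover have "f ` outside C \<subseteq> inside (f ` C)"
      unfolding f_def by (rule inversion_outside_subset_inside[OF compC z0])
    ultimately show ?thesis by auto
  qed
  moreover have "p' ` V2 \<subseteq> f ` S" "edges_image g' E2 \<subseteq> f ` S"
    using G2(2) unfolding drawn_in_def img p'_def image_comp[symmetric] by (simp_all only: image_mono)
  ultimately have d2: "drawn_in V2 E2 p' g' (closed_disc g' c)"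
    unfolding drawn_in_def using subset_trans by metis
  have VU: "V1 \<union> V2 = V" by (auto simp: V1_def V2_def S_def disc)
  have VI: "V1 \<inter> V2 = set c"
  proof -
    have "v \<in> set c \<longleftrightarrow> p v \<in> C" if "v \<in> V" for v
      using edges_image_vertices[OF ce(3) that] Union_cycle_edges[OF ce(2)] by (simp add: C_def)
    then show ?thesis using cycle_vertices[OF c] C_Int by (auto simp: V1_def V2_def S_def disc)
  qed
  have EI: "E1 \<inter> E2 = cycle_edges c"
  proof
    show "E1 \<inter> E2 \<subseteq> cycle_edges c"
    proof
      fix e assume e: "e \<in> E1 \<inter> E2"
      then have "e \<in> E" "path_image (g e) \<subseteq> C"
        unfolding E1_def E2_def disc S_def by auto
      then show "e \<in> cycle_edges c" using edge_in_edges_image[OF _ ce(3)] by (simp add: C_def)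
    qed
  qed (use cE in blast)
  have EU: "E1 \<union> E2 = E"
  proof
    show "E1 \<union> E2 \<subseteq> E" by (auto simp: E1_def E2_def)
    show "E \<subseteq> E1 \<union> E2"
    proof
      fix e assume e: "e \<in> E"
      show "e \<in> E1 \<union> E2"
      proof (cases "e \<in> cycle_edges c")
        case False
        then have "(path_image (g e) - p ` e) \<inter> C = {}"
          using edge_Int_edges_image[OF e ce(3)] unfolding C_def by blast
        then have "path_image (g e) - p ` e \<subseteq> inside C \<union> outside C" by auto
        then consider "path_image (g e) - p ` e \<subseteq> closed_disc g c" | "path_image (g e) - p ` e \<subseteq> S"
          using edge_one_side[OF e open_inside[OF cC] open_outside[OF cC]] inside_Int_outside[of C]
          unfolding disc S_def by blast
        moreover have "closed S" using open_inside[OF cC] by (simp add: S_def closed_Compl)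
        ultimately show ?thesis
          using edge_subset_closed[OF e closed_closed_disc[OF ce(3)]] edge_subset_closed[OF e, of S] e
          by cases (auto simp: E1_def E2_def)
      qed (use cE in blast)
    qed
  qed
  have G1: "plane_graph V1 E1 p g" "drawn_in V1 E1 p g (closed_disc g c)"
    unfolding V1_def E1_def by (rule restrict_to_closed)+
  show thesis by (rule that[OF G1 cyc(1) G2' d2 cyc(2) VU VI EU EI])
qed

end

section \<open>Sparsity of plane graphs without 4- and 5-cycles\<close>

definition triangles :: "'a set set \<Rightarrow> 'a set set" where
  "triangles E = {t. card t = 3 \<and> (\<forall>x \<in> t. \<forall>y \<in> t. x \<noteq> y \<longrightarrow> {x, y} \<in> E)}"

text \<open>This combination arises from Euler's formula when every face is a triangle or has length
  at least 6. A single vertex has excess \<open>- 6\<close>, which is the upper bound proved for all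
  nonempty plane graphs without 4- and 5-cycles.\<close>

definition excess :: "'a set \<Rightarrow> 'a set set \<Rightarrow> int" where
  "excess V E = 4 * int (card E) - 6 * int (card V) - 3 * int (card (triangles E))"

definition no_4_5_cycle :: "'a set set \<Rightarrow> bool" where
  "no_4_5_cycle E \<longleftrightarrow> (\<forall>c. is_cycle E c \<longrightarrow> length c \<noteq> 4 \<and> length c \<noteq> 5)"

section \<open>Counting under unions, and the existence of paths and cycles\<close>

lemma triangles_mono: "E \<subseteq> E' \<Longrightarrow> triangles E \<subseteq> triangles E'"
  unfolding triangles_def by blast

lemma triangles_Int: "triangles (E \<inter> E') = triangles E \<inter> triangles E'"
  unfolding triangles_def by blast

lemma triangle_edges:
  assumes "t \<in> triangles E"
  obtains x y z where "t = {x, y, z}" "x \<noteq> y" "y \<noteq> z" "x \<noteq> z" "{x, y} \<in> E" "{y, z} \<in> E" "{x, z} \<in> E"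
proof -
  have "card t = 3" using assms by (simp add: triangles_def)
  then obtain x y z where "t = {x, y, z}" "x \<noteq> y" "y \<noteq> z" "x \<noteq> z" by (auto simp: card_3_iff)
  then show thesis using that assms by (simp add: triangles_def)
qed

lemma finite_triangles:
  assumes "finite E" "\<And>e. e \<in> E \<Longrightarrow> finite e"
  shows "finite (triangles E)"
proof (rule finite_subset)
  show "triangles E \<subseteq> Pow (\<Union> E)" by (auto elim!: triangle_edges)
  show "finite (Pow (\<Union> E))" using assms by simp
qed

lemma no_4_5_cycle_subset: "no_4_5_cycle E \<Longrightarrow> E' \<subseteq> E \<Longrightarrow> no_4_5_cycle E'"
  unfolding no_4_5_cycle_def is_cycle_def by (meson subset_trans)

lemma triangles_path_edges: "distinct xs \<Longrightarrow> triangles (path_edges xs) = {}"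
  by (auto elim!: triangle_edges dest: path_edges_no_triangle)

text \<open>A triangle that misses a vertex \<open>a\<close> of the cycle would lie in the path left
  after deleting \<open>a\<close>, but a path contains no triangle. So the only candidate is the
  whole vertex set of the cycle.\<close>

lemma card_triangles_cycle:
  assumes "distinct c" "3 \<le> length c"
  shows "card (triangles (cycle_edges c)) \<le> 1"
proof -
  have sub: "t \<subseteq> set c" if "t \<in> triangles (cycle_edges c)" for t
    using that Union_cycle_edges[OF assms(2)] by (auto elim!: triangle_edges)
  have "t = set c" if t: "t \<in> triangles (cycle_edges c)" for t
  proof (rule ccontr)
    assume "t \<noteq> set c"
    then obtain a where a: "a \<in> set c" "a \<notin> t" using sub[OF t] by blast
    then obtain us vs where c: "c = us @ a # vs" by (meson split_list)
    have r: "rotate (length us) c = a # vs @ us" unfolding c by (simp add: rotate_append)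
    obtain x y z where t: "t = {x, y, z}" and d: "x \<noteq> y" "y \<noteq> z" "x \<noteq> z"
      and e: "{x, y} \<in> cycle_edges c" "{y, z} \<in> cycle_edges c" "{x, z} \<in> cycle_edges c"
      using t by (elim triangle_edges)
    obtain b ws where vu: "vs @ us = b # ws" using assms c by (cases "vs @ us") auto
    have "cycle_edges c = cycle_edges (a # b # ws)"
      using cycle_edges_rotate[of "length us" c] r vu by simp
    also have "\<dots> = insert {a, b} (path_edges ((b # ws) @ [a]))" by (simp add: cycle_edges_def)
    also have "path_edges ((b # ws) @ [a]) = insert {last (b # ws), a} (path_edges (b # ws))"
      using path_edges_snoc2[of "butlast (b # ws)" "last (b # ws)" a]
      by (metis append_butlast_last_id append.assoc append_Cons append_Nil list.distinct(1))
    finally have ce: "f \<in> path_edges (b # ws)" if "f \<in> cycle_edges c" "a \<notin> f" for f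
      using that by auto
    have "distinct (b # ws)" using assms(1) c vu[symmetric] by auto
    then show False
      using path_edges_no_triangle[of "b # ws" x y z] ce[OF e(1)] ce[OF e(2)] ce[OF e(3)] a d t by simp
  qed
  then have "triangles (cycle_edges c) \<subseteq> {set c}" by blast
  then show ?thesis using card_mono[of "{set c}"] by fastforce
qed

text \<open>Vertices and edges obey inclusion and exclusion exactly. New triangles may appear in the
  union, and they only lower the excess, whence the inequality.\<close>

lemma excess_Un:
  assumes "finite V1" "finite V2" "finite E1" "finite E2" "\<And>e. e \<in> E1 \<union> E2 \<Longrightarrow> finite e"
  shows "excess (V1 \<union> V2) (E1 \<union> E2) \<le> excess V1 E1 + excess V2 E2
     - 4 * int (card (E1 \<inter> E2)) + 6 * int (card (V1 \<inter> V2)) + 3 * int (card (triangles (E1 \<inter> E2)))"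
proof -
  have fin: "finite (triangles E1)" "finite (triangles E2)" "finite (triangles (E1 \<union> E2))"
    using assms by (auto intro!: finite_triangles)
  have "triangles E1 \<union> triangles E2 \<subseteq> triangles (E1 \<union> E2)"
    using triangles_mono[of E1 "E1 \<union> E2"] triangles_mono[of E2 "E1 \<union> E2"] by blast
  then have "card (triangles E1 \<union> triangles E2) \<le> card (triangles (E1 \<union> E2))"
    using fin(3) by (rule card_mono[rotated])
  moreover have "card (triangles E1) + card (triangles E2)
      = card (triangles E1 \<union> triangles E2) + card (triangles (E1 \<inter> E2))"
    unfolding triangles_Int by (rule card_Un_Int[OF fin(1,2)])
  moreover have "card V1 + card V2 = card (V1 \<union> V2) + card (V1 \<inter> V2)"
    "card E1 + card E2 = card (E1 \<union> E2) + card (E1 \<inter> E2)"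
    using assms by (auto intro: card_Un_Int)
  ultimately show ?thesis unfolding excess_def by linarith
qed

text \<open>A walk is shortened while it is extended: if the next vertex already lies on the path,
  the path is cut there.\<close>

lemma distinct_path_in_component:
  assumes "(u, v) \<in> {(x, y). {x, y} \<in> E \<and> x \<notin> C \<and> y \<notin> C}\<^sup>*" "u \<notin> C"
  shows "\<exists>xs. xs \<noteq> [] \<and> hd xs = u \<and> last xs = v \<and> distinct xs \<and> path_edges xs \<subseteq> E \<and> set xs \<inter> C = {}"
  using assms
proof (induction rule: rtrancl_induct)
  case base
  then show ?case by (intro exI[of _ "[u]"]) simp
next
  case (step y z)
  then obtain xs where xs: "xs \<noteq> []" "hd xs = u" "last xs = y" "distinct xs" "path_edges xs \<subseteq> E"
    "set xs \<inter> C = {}" by blast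
  show ?case
  proof (cases "z \<in> set xs")
    case True
    then obtain us vs where "xs = us @ z # vs" by (meson split_list)
    then show ?thesis using xs path_edges_append[of us z vs]
      by (intro exI[of _ "us @ [z]"]) (cases us; auto)
  next
    case False
    have "xs @ [z] = butlast xs @ [y, z]" "xs = butlast xs @ [y]" using xs by auto
    then have "path_edges (xs @ [z]) = insert {y, z} (path_edges xs)"
      using path_edges_snoc2[of "butlast xs" y z] by metis
    then show ?thesis using xs step False by (intro exI[of _ "xs @ [z]"]) auto
  qed
qed

text \<open>The first vertex of a longest path has all its neighbors on the path. With two
  neighbors, one of them is not the second vertex of the path, and the edge to it closes a cycle of
  length at least 3.\<close>

lemma exists_cycle:
  assumes "finite V" "V \<noteq> {}" and sub: "\<And>e. e \<in> E \<Longrightarrow> e \<subseteq> V"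
    and deg: "\<And>v. v \<in> V \<Longrightarrow> \<exists>x y. x \<noteq> y \<and> x \<noteq> v \<and> y \<noteq> v \<and> {v, x} \<in> E \<and> {v, y} \<in> E"
  shows "\<exists>c. is_cycle E c"
proof -
  define L where "L = {xs. distinct xs \<and> set xs \<subseteq> V \<and> xs \<noteq> [] \<and> path_edges xs \<subseteq> E}"
  obtain v where "v \<in> V" using assms by blast
  then have "[v] \<in> L" by (simp add: L_def)
  moreover have "length ys < Suc (card V)" if "ys \<in> L" for ys
    using that card_mono[OF assms(1), of "set ys"] distinct_card[of ys] by (simp add: L_def)
  ultimately obtain xs where xs: "xs \<in> L" "\<And>ys. ys \<in> L \<Longrightarrow> length ys \<le> length xs"
    using ex_has_greatest_nat[of "\<lambda>ys. ys \<in> L" "[v]" length "Suc (card V)"] by blast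
  obtain x zs where x: "xs = x # zs" using xs(1) by (cases xs) (auto simp: L_def)
  have "x \<in> V" using xs x by (simp add: L_def)
  then obtain w1 w2 where w: "w1 \<noteq> w2" "w1 \<noteq> x" "w2 \<noteq> x" "{x, w1} \<in> E" "{x, w2} \<in> E"
    using deg by blast
  have in_zs: "u \<in> set zs" if u: "u \<noteq> x" "{x, u} \<in> E" for u
  proof (rule ccontr)
    assume "u \<notin> set zs"
    moreover have "u \<in> V" using sub[OF u(2)] by simp
    ultimately have "u # xs \<in> L" using xs(1) u x by (auto simp: L_def insert_commute)
    then show False using xs(2) by fastforce
  qed
  obtain y zs' where zs: "zs = y # zs'" using in_zs[OF w(2,4)] by (cases zs) auto
  obtain u where u: "u \<noteq> y" "u \<noteq> x" "{x, u} \<in> E" using w by metis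
  then have "u \<in> set zs'" using in_zs zs by fastforce
  then obtain us vs where zs': "zs' = us @ u # vs" by (meson split_list)
  define c where "c = x # y # us @ [u]"
  have "path_edges c \<subseteq> path_edges xs"
    unfolding c_def x zs zs' using path_edges_append[of "x # y # us" u vs] by auto
  moreover have "cycle_edges c = path_edges c \<union> {{u, x}}"
    using path_edges_append[of "x # y # us" u "[x]"] by (simp add: cycle_edges_def c_def)
  ultimately have "cycle_edges c \<subseteq> E" using xs(1) u by (auto simp: L_def insert_commute)
  moreover have "distinct c" using xs(1) by (auto simp: c_def x zs zs' L_def)
  ultimately show ?thesis by (intro exI[of _ c]) (simp add: is_cycle_def c_def)
qed

text \<open>An empty \<open>ks\<close> gives an ordinary chord; the last condition then prevents it
  from being an edge of the cycle itself.\<close>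

definition chord_path :: "'a set set \<Rightarrow> 'a list \<Rightarrow> 'a \<Rightarrow> 'a list \<Rightarrow> 'a \<Rightarrow> bool" where
  "chord_path E c a ks b \<longleftrightarrow> a \<noteq> b \<and> a \<in> set c \<and> b \<in> set c \<and> distinct ks \<and> set ks \<inter> set c = {} \<and>
     path_edges (a # ks @ [b]) \<subseteq> E \<and> path_edges (a # ks @ [b]) \<inter> cycle_edges c = {}"

text \<open>Without chords the graph is just the cycle. A triangle has excess
  \<open>12 - 18 - 3 = - 9\<close>, which is the bound. Otherwise the length \<open>l\<close> is at
  least 6, and the excess is at most \<open>- 2 l\<close>, hence at most
  \<open>- l - 6\<close>.\<close>

lemma (in plane_graph) excess_cycle:
  assumes c: "is_cycle E c" and no_chord: "\<nexists>a ks b. chord_path E c a ks b"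
    and "no_4_5_cycle E" "V = set c"
  shows "excess V E \<le> - int (length c) - 6"
proof -
  have ce: "distinct c" "3 \<le> length c" "cycle_edges c \<subseteq> E" using c by (auto simp: is_cycle_def)
  have "E \<subseteq> cycle_edges c"
  proof
    fix e assume e: "e \<in> E"
    then obtain u v where uv: "e = {u, v}" "u \<noteq> v" using edge_card by (meson card_2_iff)
    then have "u \<in> set c" "v \<in> set c" using edge_subset[OF e] assms by auto
    then show "e \<in> cycle_edges c"
      using no_chord[simplified, rule_format, of u "[]" v] e uv by (simp add: chord_path_def)
  qed
  then have "E = cycle_edges c" using ce by blast
  then have card: "card E = length c" "card V = length c"
    using card_cycle_edges[OF ce(1,2)] assms distinct_card[OF ce(1)] by auto
  show ?thesis
  proof (cases "length c = 3")
    case True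
    then obtain x y z where xyz: "c = [x, y, z]"
      by (metis length_0_conv length_Suc_conv numeral_3_eq_3)
    then have "{{x, y}, {y, z}, {z, x}} \<subseteq> E" "card (set c) = 3"
      using ce distinct_card[OF ce(1)] by (auto simp: cycle_edges_def)
    then have "set c \<in> triangles E" by (auto simp: triangles_def xyz insert_commute)
    moreover have "finite (triangles E)" using finite_VE finite_edge by (intro finite_triangles)
    ultimately have "card (triangles E) \<ge> 1"
      by (metis One_nat_def Suc_leI card_gt_0_iff empty_iff)
    then show ?thesis using card True by (simp add: excess_def)
  next
    case False
    moreover have "length c \<noteq> 4" "length c \<noteq> 5" using c assms(3) by (auto simp: no_4_5_cycle_def)
    ultimately have "length c \<ge> 6" using ce(2) by linarith
    then show ?thesis using card by (simp add: excess_def)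
  qed
qed


text \<open>This is the induction hypothesis of \<open>plane_graph_sparse\<close>, packaged as a
  predicate so that discs can be treated in a lemma of their own.\<close>

definition sparse_below :: "'a itself \<Rightarrow> nat \<Rightarrow> bool" where
  "sparse_below TYPE('a) n \<longleftrightarrow> (\<forall>(V :: 'a set) E p g. plane_graph V E p g \<longrightarrow> no_4_5_cycle E \<longrightarrow> V \<noteq> {} \<longrightarrow>
     card V < n \<longrightarrow> excess V E \<le> - 6)"

text \<open>Here \<open>K\<close> is the component of \<open>v0\<close> in the graph without the
  cycle. Two different neighbors of \<open>K\<close> on the cycle would be joined by a path through
  \<open>K\<close>, which is a chord path; so \<open>K\<close> is attached at no more than one
  vertex.\<close>

lemma (in plane_graph) detachable_component:
  assumes c: "is_cycle E c" and no_chord: "\<nexists>a ks b. chord_path E c a ks b" and v0: "v0 \<in> V - set c"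
  obtains K A where "v0 \<in> K" "K \<subseteq> V - set c" "A \<subseteq> set c" "card A \<le> 1"
    "\<forall>e \<in> E. e \<inter> K \<noteq> {} \<longrightarrow> e \<subseteq> K \<union> A"
proof -
  define R where "R = {(x, y). {x, y} \<in> E \<and> x \<notin> set c \<and> y \<notin> set c}"
  define K where "K = {w. (v0, w) \<in> R\<^sup>*}"
  define A where "A = {a \<in> set c. \<exists>k \<in> K. {k, a} \<in> E}"
  have v0K: "v0 \<in> K" by (simp add: K_def)
  have KV: "K \<subseteq> V - set c"
  proof
    fix w assume "w \<in> K"
    then have "(v0, w) \<in> R\<^sup>*" by (simp add: K_def)
    then show "w \<in> V - set c"
    proof (cases rule: rtranclE)
      case (step y)
      then have "{y, w} \<in> E" "w \<notin> set c" by (auto simp: R_def)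
      then show ?thesis using edge_subset by blast
    qed (use v0 in simp)
  qed
  have symR: "sym (R\<^sup>*)" by (rule sym_rtrancl) (auto simp: R_def sym_def insert_commute)
  have A1: "a = b" if a: "a \<in> A" and b: "b \<in> A" for a b
  proof (rule ccontr)
    assume ab: "a \<noteq> b"
    obtain k k' where k: "k \<in> K" "{k, a} \<in> E" "k' \<in> K" "{k', b} \<in> E" using a b by (auto simp: A_def)
    have "(k, v0) \<in> R\<^sup>*" "(v0, k') \<in> R\<^sup>*" using k symD[OF symR] by (auto simp: K_def)
    then have "(k, k') \<in> R\<^sup>*" by (rule rtrancl_trans)
    then obtain ks where ks: "ks \<noteq> []" "hd ks = k" "last ks = k'" "distinct ks" "path_edges ks \<subseteq> E"
        "set ks \<inter> set c = {}"
      using distinct_path_in_component[of k k' E "set c"] KV k(1) unfolding R_def by blast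
    define P where "P = a # ks @ [b]"
    have "ks = k # tl ks" "ks = butlast ks @ [k']" using ks by auto
    then have "path_edges P = insert {a, k} (path_edges (ks @ [b]))"
      unfolding P_def by (metis append_Cons path_edges.simps(1))
    moreover have "path_edges (ks @ [b]) = insert {k', b} (path_edges ks)"
      using path_edges_snoc2[of "butlast ks" k' b] \<open>ks = butlast ks @ [k']\<close> by (metis append.assoc append_Cons append_Nil)
    ultimately have pP: "path_edges P = insert {a, k} (insert {k', b} (path_edges ks))" by simp
    have "path_edges P \<subseteq> E" using pP k ks by (auto simp: insert_commute)
    moreover have "path_edges P \<inter> cycle_edges c = {}"
    proof -
      have in_c: "e \<subseteq> set c" if "e \<in> cycle_edges c" for e
        using that Union_cycle_edges[of c] c by (auto simp: is_cycle_def)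
      have "e \<notin> cycle_edges c" if "e \<in> path_edges P" for e
      proof -
        \<comment> \<open>Every edge of \<open>P\<close> has an end off the cycle, so it is no edge
          of the cycle.\<close>
        have "e \<inter> set ks \<noteq> {}"
        proof (cases "e \<in> path_edges ks")
          case True
          then show ?thesis using path_edges_subset[OF True] path_edges_card2[OF ks(4) True]
            by (metis Int_absorb2 card.empty zero_neq_numeral)
        next
          case False
          then have "e = {a, k} \<or> e = {k', b}" using that pP by auto
          then show ?thesis using hd_in_set[OF ks(1)] last_in_set[OF ks(1)] ks by auto
        qed
        then show ?thesis using in_c ks(6) by blast
      qed
      then show ?thesis by blast
    qed
    ultimately have "chord_path E c a ks b"
      using a b ab ks by (simp add: chord_path_def P_def A_def)
    then show False using no_chord by blast
  qed
  have "card A \<le> 1"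
  proof (cases "A = {}")
    case False
    then obtain a where "a \<in> A" by blast
    then have "A = {a}" using A1 by blast
    then show ?thesis by simp
  qed simp
  moreover have "e \<subseteq> K \<union> A" if e: "e \<in> E" "e \<inter> K \<noteq> {}" for e
  proof -
    obtain k where k: "k \<in> e" "k \<in> K" using e by blast
    obtain w where w: "e = {k, w}" using k(1) edge_card[OF e(1)]
      by (metis card_2_iff doubleton_eq_iff insertE singletonD)
    show ?thesis
    proof (cases "w \<in> set c")
      case True
      then show ?thesis using w k e by (auto simp: A_def)
    next
      case False
      then have "(k, w) \<in> R" using w k(2) e KV by (auto simp: R_def)
      then show ?thesis using w k(2) by (auto simp: K_def intro: rtrancl_into_rtrancl)
    qed
  qed
  ultimately show thesis using that[OF v0K KV, of A] by (auto simp: A_def)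
qed

text \<open>If a chord path with \<open>k\<close> inner vertices exists, the two smaller cycles have
  total length \<open>l + 2 (k + 1)\<close>, and the bounds add up exactly:
  \<open>- l - 2 (k + 1) - 12 - 4 (k + 1) + 6 (k + 2) = - l - 6\<close>. Otherwise the graph is the
  cycle, or a component attached at no more than one vertex is split off; its excess of at most
  \<open>- 6\<close> pays for the shared vertex.\<close>

lemma excess_disc:
  assumes "plane_graph V E p g" "is_cycle E c" "drawn_in V E p g (closed_disc g c)"
    and "no_4_5_cycle E" "sparse_below TYPE('a) n" "card (V :: 'a set) \<le> n"
  shows "excess V E \<le> - int (length c) - 6"
  using assms
proof (induction "card V + card E" arbitrary: V E c rule: less_induct)
  case less
  interpret plane_graph V E p g by (rule less.prems(1))
  have ce: "distinct c" "3 \<le> length c" "cycle_edges c \<subseteq> E" using less.prems(2) by (auto simp: is_cycle_def)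
  show ?case
  proof (cases "\<exists>a ks b. chord_path E c a ks b")
    case True
    then obtain a ks b where chord: "chord_path E c a ks b" by blast
    define P where "P = a # ks @ [b]"
    obtain m xs ys where rot: "rotate m c = a # xs @ b # ys"
      using chord rotate_to_front[of a c b] unfolding chord_path_def by blast
    define c' where "c' = a # xs @ b # ys"
    have c': "is_cycle E c'" "cycle_edges c' = cycle_edges c" "closed_disc g c' = closed_disc g c"
        "set c' = set c" "length c' = length c"
      using less.prems(2) is_cycle_rotate[of E m c] cycle_edges_rotate[of m c] rot
        set_rotate[of m c] length_rotate[of m c] unfolding c'_def by (simp_all add: closed_disc_def)
    define c1 where "c1 = a # xs @ b # rev ks"
    define c2 where "c2 = a # ks @ b # ys"
    have dP: "distinct P" using chord by (auto simp: chord_path_def P_def)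
    obtain V1 E1 V2 E2 where
      G1: "plane_graph V1 E1 p g" "drawn_in V1 E1 p g (closed_disc g c1)" "is_cycle E1 c1" and
      G2: "plane_graph V2 E2 p g" "drawn_in V2 E2 p g (closed_disc g c2)" "is_cycle E2 c2" and
      VE: "V1 \<union> V2 = V" "V1 \<inter> V2 = set P" "E1 \<union> E2 = E" "E1 \<inter> E2 = path_edges P"
      using split_disc[of a xs b ys ks] c' less.prems(3) chord
      unfolding c'_def[symmetric] c1_def[symmetric] c2_def[symmetric] P_def[symmetric] chord_path_def
      by metis
    have fin: "finite V1" "finite V2" "finite E1" "finite E2"
      using G1(1) G2(1) by (auto intro: plane_graph.finite_VE)
    have cardP: "card (path_edges P) = Suc (length ks)" "card (set P) = Suc (Suc (length ks))"
      using card_path_edges[OF dP] distinct_card[OF dP] by (simp_all add: P_def)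
    \<comment> \<open>Each disc has an edge outside \<open>P\<close>, so the other disc has fewer
      edges than the whole graph, and the induction measure drops.\<close>
    have "length c1 \<le> card E1"
      using G1(3) card_cycle_edges[of c1] card_mono[OF fin(3)] unfolding is_cycle_def by metis
    then have s1: "card (E1 \<inter> E2) < card E1" using cardP VE(4) by (simp add: c1_def)
    have "length c2 \<le> card E2"
      using G2(3) card_cycle_edges[of c2] card_mono[OF fin(4)] unfolding is_cycle_def by metis
    then have s2: "card (E1 \<inter> E2) < card E2" using cardP VE(4) by (simp add: c2_def)
    have cE: "card E1 + card E2 = card E + card (E1 \<inter> E2)" using card_Un_Int[OF fin(3,4)] VE by simp
    have cV: "card V1 \<le> card V" "card V2 \<le> card V" using VE(1) finite_VE(1) by (auto intro: card_mono)
    have no: "no_4_5_cycle E1" "no_4_5_cycle E2" using less.prems(4) VE(3) no_4_5_cycle_subset by blast+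
    have "excess V1 E1 \<le> - int (length c1) - 6"
      by (rule less.hyps) (use G1 no s2 cE cV less.prems in auto)
    moreover have "excess V2 E2 \<le> - int (length c2) - 6"
      by (rule less.hyps) (use G2 no s1 cE cV less.prems in auto)
    moreover have "excess V E \<le> excess V1 E1 + excess V2 E2
        - 4 * int (card (E1 \<inter> E2)) + 6 * int (card (V1 \<inter> V2)) + 3 * int (card (triangles (E1 \<inter> E2)))"
      using excess_Un[OF fin] VE finite_edge by metis
    moreover have "length c1 + length c2 = length c + 2 * Suc (length ks)"
      using c'(5) by (simp add: c1_def c2_def c'_def)
    ultimately show ?thesis unfolding VE triangles_path_edges[OF dP] cardP by simp
  next
    case no_chord: False
    show ?thesis
    proof (cases "V = set c")
      case True
      then show ?thesis using excess_cycle[OF less.prems(2) no_chord less.prems(4)] by simp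
    next
      case False
      then obtain v0 where v0: "v0 \<in> V - set c" using cycle_vertices[OF less.prems(2)] by blast
      obtain K A where K: "v0 \<in> K" "K \<subseteq> V - set c" and A: "A \<subseteq> set c" "card A \<le> 1"
        and KA: "\<forall>e \<in> E. e \<inter> K \<noteq> {} \<longrightarrow> e \<subseteq> K \<union> A"
        using detachable_component[OF less.prems(2) no_chord v0] .
      define V1 where "V1 = K \<union> A"
      define E1 where "E1 = {e \<in> E. e \<inter> K \<noteq> {}}"
      define V2 where "V2 = V - K"
      define E2 where "E2 = {e \<in> E. e \<inter> K = {}}"
      have cV: "set c \<subseteq> V" by (rule cycle_vertices[OF less.prems(2)])
      have VE: "V1 \<union> V2 = V" "V1 \<inter> V2 = A" "E1 \<union> E2 = E" "E1 \<inter> E2 = {}"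
        using K A cV by (auto simp: V1_def V2_def E1_def E2_def)
      have G1: "plane_graph V1 E1 p g"
        by (rule sub_plane_graph) (use VE KA in \<open>auto simp: V1_def E1_def\<close>)
      have e2: "e \<subseteq> V2" if "e \<in> E2" for e using that edge_subset by (auto simp: V2_def E2_def)
      have G2: "plane_graph V2 E2 p g"
        by (rule sub_plane_graph) (use VE e2 in auto)
      have fin: "finite V1" "finite V2" "finite E1" "finite E2"
        using G1 G2 by (auto intro: plane_graph.finite_VE)
      have no: "no_4_5_cycle E1" "no_4_5_cycle E2" using less.prems(4) VE(3) no_4_5_cycle_subset by blast+
      \<comment> \<open>The cycle has a vertex outside \<open>V1\<close>, so the detached part is
        smaller than the whole graph and \<open>sparse_below\<close> applies to it.\<close>
      have "card (set c) > card A" using A ce distinct_card[OF ce(1)] by simp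
      then have "\<not> set c \<subseteq> A" using A(1) by (metis card_mono finite_set finite_subset leD)
      then obtain x where "x \<in> set c" "x \<notin> A" by blast
      then have "x \<in> V" "x \<notin> V1" using cV K by (auto simp: V1_def)
      then have "V1 \<subset> V" using VE(1) by blast
      then have "card V1 < n" using psubset_card_mono[OF finite_VE(1), of V1] less.prems(6) by linarith
      then have ex1: "excess V1 E1 \<le> - 6"
        using less.prems(5) G1 no(1) K(1) unfolding sparse_below_def V1_def by blast
      have "V2 \<subset> V" using K by (auto simp: V2_def)
      then have V2: "card V2 < card V" by (rule psubset_card_mono[OF finite_VE(1)])
      have "cycle_edges c \<subseteq> E2"
        using ce Union_cycle_edges[OF ce(2)] K by (auto simp: E2_def)
      then have c2: "is_cycle E2 c" using ce by (simp add: is_cycle_def)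
      have d2: "drawn_in V2 E2 p g (closed_disc g c)"
        using less.prems(3) VE edges_image_mono[of E2 E g] unfolding drawn_in_def by blast
      have "card E2 \<le> card E" using VE(3) finite_VE(2) by (auto intro: card_mono)
      then have "excess V2 E2 \<le> - int (length c) - 6"
        using less.hyps[OF _ G2 c2 d2 no(2) less.prems(5)] V2 less.prems(6) by simp
      moreover have "excess V E \<le> excess V1 E1 + excess V2 E2
          - 4 * int (card (E1 \<inter> E2)) + 6 * int (card (V1 \<inter> V2)) + 3 * int (card (triangles (E1 \<inter> E2)))"
        using excess_Un[OF fin] VE finite_edge by metis
      moreover have "triangles {} = ({} :: 'a set set)" using triangles_path_edges[of "[]"] by simp
      ultimately show ?thesis using ex1 A(2) unfolding VE by simp
    qed
  qed
qed

text \<open>Deleting a vertex of degree at most 1 lowers the vertex term by 6 and the edge term by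
  at most 4. If no such vertex exists, there is a cycle of some length \<open>l\<close>; its two
  sides are discs, and the excess is at most
  \<open>2 (- l - 6) - 4 l + 6 l + 3 = - 9\<close>.\<close>

theorem plane_graph_sparse:
  assumes "plane_graph (V :: 'a set) E p g" "no_4_5_cycle E" "V \<noteq> {}"
  shows "4 * int (card E) \<le> 6 * int (card V) + 3 * int (card (triangles E)) - 6"
proof -
  have "excess V E \<le> - 6"
    using assms
  proof (induction "card V" arbitrary: V E p g rule: less_induct)
    case less
    interpret plane_graph V E p g by (rule less.prems(1))
    have sparse: "sparse_below TYPE('a) (card V)"
      using less.hyps unfolding sparse_below_def by blast
    have fint: "finite (triangles E)" using finite_VE finite_edge by (intro finite_triangles)
    show ?case
    proof (cases "\<exists>v \<in> V. card {e \<in> E. v \<in> e} \<le> 1")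
      case True
      then obtain v where v: "v \<in> V" "card {e \<in> E. v \<in> e} \<le> 1" by blast
      define V' where "V' = V - {v}"
      define E' where "E' = {e \<in> E. v \<notin> e}"
      have cV: "card V = Suc (card V')" using card_Suc_Diff1[OF finite_VE(1) v(1)] by (simp add: V'_def)
      have "E = E' \<union> {e \<in> E. v \<in> e}" by (auto simp: E'_def)
      then have cE: "card E \<le> card E' + 1"
        using card_Un_le[of E' "{e \<in> E. v \<in> e}"] v(2) by simp
      have "card (triangles E') \<le> card (triangles E)"
        by (rule card_mono[OF fint triangles_mono]) (auto simp: E'_def)
      moreover have "excess V' E' \<le> - 6" if "V' \<noteq> {}"
      proof (rule less.hyps[OF _ _ _ that])
        show "plane_graph V' E' p g"
          by (rule sub_plane_graph) (use edge_subset in \<open>auto simp: V'_def E'_def\<close>)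
        show "no_4_5_cycle E'" by (rule no_4_5_cycle_subset[OF less.prems(2)]) (auto simp: E'_def)
      qed (simp add: cV)
      moreover have "E = {}" if "V' = {}"
      proof (rule ccontr)
        assume "E \<noteq> {}"
        then obtain e where e: "e \<in> E" by blast
        then have "e \<subseteq> {v}" using edge_subset that by (auto simp: V'_def)
        then have "card e \<le> 1" using card_mono[of "{v}" e] by simp
        then show False using edge_card[OF e] by simp
      qed
      ultimately show ?thesis using cV cE by (cases "V' = {}") (auto simp: excess_def)
    next
      case False
      have "\<exists>c. is_cycle E c"
      proof (rule exists_cycle[OF finite_VE(1) less.prems(3) edge_subset])
        fix v assume "v \<in> V"
        then have "2 \<le> card {e \<in> E. v \<in> e}" using False by force
        then obtain e f where ef: "e \<in> E" "f \<in> E" "v \<in> e" "v \<in> f" "e \<noteq> f"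
          by (auto simp: numeral_2_eq_2 card_le_Suc_iff)
        obtain x where x: "e = {v, x}" "x \<noteq> v" using edge_card[OF ef(1)] ef(3)
          by (metis card_2_iff doubleton_eq_iff insertE singletonD)
        obtain y where y: "f = {v, y}" "y \<noteq> v" using edge_card[OF ef(2)] ef(4)
          by (metis card_2_iff doubleton_eq_iff insertE singletonD)
        show "\<exists>x y. x \<noteq> y \<and> x \<noteq> v \<and> y \<noteq> v \<and> {v, x} \<in> E \<and> {v, y} \<in> E"
          using ef x y by blast
      qed
      then obtain c where c: "is_cycle E c" by blast
      then have ce: "distinct c" "3 \<le> length c" by (auto simp: is_cycle_def)
      obtain V1 E1 V2 E2 p' g' where
        G1: "plane_graph V1 E1 p g" "drawn_in V1 E1 p g (closed_disc g c)" "is_cycle E1 c" and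
        G2: "plane_graph V2 E2 p' g'" "drawn_in V2 E2 p' g' (closed_disc g' c)" "is_cycle E2 c" and
        VE: "V1 \<union> V2 = V" "V1 \<inter> V2 = set c" "E1 \<union> E2 = E" "E1 \<inter> E2 = cycle_edges c"
        using split_inside_outside[OF c] .
      have fin: "finite V1" "finite V2" "finite E1" "finite E2"
        using G1(1) G2(1) by (auto intro: plane_graph.finite_VE)
      have cV: "card V1 \<le> card V" "card V2 \<le> card V" using VE(1) finite_VE(1) by (auto intro: card_mono)
      have no: "no_4_5_cycle E1" "no_4_5_cycle E2" using less.prems(2) VE(3) no_4_5_cycle_subset by blast+
      have "excess V1 E1 \<le> - int (length c) - 6"
        by (rule excess_disc[OF G1(1,3,2) no(1) sparse cV(1)])
      moreover have "excess V2 E2 \<le> - int (length c) - 6"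
        by (rule excess_disc[OF G2(1,3,2) no(2) sparse cV(2)])
      moreover have "excess V E \<le> excess V1 E1 + excess V2 E2
          - 4 * int (card (E1 \<inter> E2)) + 6 * int (card (V1 \<inter> V2)) + 3 * int (card (triangles (E1 \<inter> E2)))"
        using excess_Un[OF fin] VE finite_edge by metis
      ultimately show ?thesis
        using card_triangles_cycle[OF ce] card_cycle_edges[OF ce] distinct_card[OF ce(1)] unfolding VE by linarith
    qed
  qed
  then show ?thesis by (simp add: excess_def)
qed

section \<open>Numerical estimates for the discharging\<close>

text \<open>The charge sent along an edge in no core triangle, from an end with \<open>k\<close>
  core neighbors to one with \<open>j\<close>. The charge \<open>2 k - 6\<close> of the sender,
  divided evenly among its \<open>k\<close> edges, is \<open>2 - 6 / k\<close>.\<close>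

definition flow :: "nat \<Rightarrow> nat \<Rightarrow> real" where
  "flow k j = (if 4 \<le> k then 2 - 6 / k else if k = 3 \<and> j = 2 then 1 / 5 else 0)"

lemma flow_ge: "4 \<le> m \<Longrightarrow> m \<le> k \<Longrightarrow> 2 - 6 / real m \<le> flow k j"
  by (simp add: flow_def frac_le)

lemma flow_nonneg: "0 \<le> flow k j"
  by (simp add: flow_def field_simps)

lemma flow_3_le: "flow 3 j \<le> 1 / 5"
  by (simp add: flow_def)

lemma flow_small: "k \<le> 2 \<Longrightarrow> flow k j = 0"
  by (simp add: flow_def)

text \<open>This settles a vertex with two core neighbors and no core triangle, whose own charge is
  \<open>- 2\<close>. A small gain \<open>\<rho>\<close> forces a neighbor of large degree.\<close>

lemma flow_sum_two:
  fixes D k1 k2 \<rho> a :: nat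
  assumes "k1 \<le> D" "k2 \<le> D" "32 \<le> D" "D + 3 \<le> k1 + k2 + \<rho>" "a \<le> \<rho>" "a \<le> 2"
  shows "2 \<le> real \<rho> - real a / 2 + (flow k1 2 + flow k2 2)"
  using assms(1,2,4)
proof (induction k2 k1 rule: linorder_wlog)
  case (le k2 k1)
  consider "3 \<le> \<rho>" | "1 \<le> \<rho>" "\<rho> \<le> 2" | "\<rho> = 0" by linarith
  then show ?case
  proof cases
    case 1
    then show ?thesis using assms(6) flow_nonneg[of k1 2] flow_nonneg[of k2 2] by linarith
  next
    case 2
    then have "17 \<le> k1" using le assms(3) by linarith
    then have "2 - 6 / real 17 \<le> flow k1 2" by (intro flow_ge) auto
    moreover have "1 / 2 \<le> real \<rho> - real a / 2" using 2 assms(5) by linarith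
    ultimately show ?thesis using flow_nonneg[of k2 2] by simp
  next
    case 3
    then have "18 \<le> k1" "3 \<le> k2" using le assms(3) by linarith+
    then have k1: "2 - 6 / real 18 \<le> flow k1 2" by (intro flow_ge) auto
    show ?thesis
    proof (cases "k2 = 3")
      case True
      \<comment> \<open>This case explains the value \<open>1 / 5\<close>: the large neighbor falls
        short of 2 by at most \<open>6 / 32\<close>, and the neighbor of degree 3 makes up for
        it.\<close>
      then have "32 \<le> k1" using le 3 assms(3) by linarith
      then have "2 - 6 / real 32 \<le> flow k1 2" by (intro flow_ge) auto
      then show ?thesis using True 3 assms(5) by (simp add: flow_def)
    next
      case False
      then have "2 - 6 / real 4 \<le> flow k2 2" using \<open>3 \<le> k2\<close> by (intro flow_ge) auto
      then show ?thesis using k1 3 assms(5) by simp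
    qed
  qed
next
  case (sym k2 k1)
  then show ?case by (simp add: add.commute)
qed

text \<open>A vertex with three core neighbors has charge 0 and sends at most \<open>3 / 5\<close>.
  Either \<open>\<rho>\<close> is at least 2 and covers this, or some neighbor has degree at least
  12 and sends \<open>3 / 2\<close>.\<close>

lemma flow_three:
  fixes D k1 k2 k3 \<rho> a :: nat
  assumes "32 \<le> D" "D + 3 \<le> k1 + k2 + k3 + \<rho>" "a \<le> \<rho>"
  shows "0 \<le> real \<rho> - real a / 2 + (flow k1 3 + flow k2 3 + flow k3 3 - flow 3 k1 - flow 3 k2 - flow 3 k3)"
proof -
  note pos = flow_nonneg[of k1 3] flow_nonneg[of k2 3] flow_nonneg[of k3 3]
  note le = flow_3_le[of k1] flow_3_le[of k2] flow_3_le[of k3]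
  show ?thesis
  proof (cases "2 \<le> \<rho>")
    case True
    then have "1 \<le> real \<rho> - real a / 2" using assms(3) by linarith
    then show ?thesis using pos le by linarith
  next
    case False
    then have "12 \<le> k1 \<or> 12 \<le> k2 \<or> 12 \<le> k3" using assms by linarith
    then have "2 - 6 / real 12 \<le> flow k1 3 \<or> 2 - 6 / real 12 \<le> flow k2 3 \<or> 2 - 6 / real 12 \<le> flow k3 3"
      using flow_ge[of 12] by auto
    moreover have "0 \<le> real \<rho> - real a / 2" using assms(3) by linarith
    ultimately show ?thesis using pos le by auto
  qed
qed

text \<open>
  Here \<open>x\<close> is the charge that a vertex \<open>v\<close> of a triangle of \<open>S\<close> pays to it, where \<open>v\<close> has \<open>k\<close> neighbors
  in \<open>S\<close>, the other two vertices of the triangle have \<open>s\<close> in total, and \<open>n\<close> square neighbors of \<open>v\<close> are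
  reached through removed vertices; \<open>j\<close> stands for the degree of the third neighbor of \<open>v\<close> in \<open>S\<close>, and
  \<open>a\<close> for the number of triangles at \<open>v\<close> with a removed vertex.
\<close>
definition triangle_share :: "nat \<Rightarrow> nat \<Rightarrow> nat \<Rightarrow> nat \<Rightarrow> real \<Rightarrow> bool" where
  "triangle_share D k s n x \<longleftrightarrow> 2 \<le> k \<and> k \<le> D \<and>
     (4 \<le> k \<longrightarrow> x = 4 - 12 / k) \<and>
     (k = 3 \<longrightarrow> (\<exists>a j. x = real n - real a / 2 + flow j 3 - flow 3 j \<and> a \<le> 1 \<and> a \<le> n \<and> D + 5 \<le> s + j + n)) \<and>
     (k = 2 \<longrightarrow> x = real n - 2 \<and> D + 5 \<le> s + n)"

lemma triangle_share_ge: "triangle_share D k s n x \<Longrightarrow> 4 \<le> m \<Longrightarrow> m \<le> k \<Longrightarrow> 4 - 12 / real m \<le> x"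
  by (simp add: triangle_share_def frac_le)

lemma triangle_share_ge_neg:
  assumes "triangle_share D k s n x" "3 \<le> k"
  shows "- 1 / 5 \<le> x"
proof (cases "k = 3")
  case True
  then obtain a j where x: "x = real n - real a / 2 + flow j 3 - flow 3 j" "a \<le> n"
    using assms(1) by (auto simp: triangle_share_def)
  then show ?thesis using flow_nonneg[of j 3] flow_3_le[of j] by linarith
next
  case False
  then show ?thesis using triangle_share_ge[OF assms(1), of 4] assms(2) by simp
qed

text \<open>If the two other vertices of the triangle have total degree at most 28, then two square
  neighbors come through removed vertices, or the third neighbor has degree at least 8 and sends
  \<open>5 / 4\<close>.\<close>

lemma triangle_share_3:
  assumes "triangle_share D 3 s n x" "32 \<le> D" "s \<le> 28"
  shows "5 / 4 \<le> x"
proof -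
  obtain a j where x: "x = real n - real a / 2 + flow j 3 - flow 3 j" "a \<le> 1" "a \<le> n" "D + 5 \<le> s + j + n"
    using assms(1) by (auto simp: triangle_share_def)
  show ?thesis
  proof (cases "2 \<le> n")
    case True
    then show ?thesis using x flow_nonneg[of j 3] flow_3_le[of j] by linarith
  next
    case False
    then have j: "8 \<le> j" using x(4) assms by linarith
    then have "2 - 6 / real 8 \<le> flow j 3" by (intro flow_ge) auto
    moreover have "flow 3 j = 0" using j by (simp add: flow_def)
    ultimately show ?thesis using x by simp
  qed
qed

text \<open>The vertex of degree 2 may be in debt by as much as 2. The smaller \<open>n\<close> is,
  the larger \<open>k1 + k2\<close> must be, so the debt is paid by the larger of the two other
  vertices, together with the smaller one when \<open>n\<close> is at most 1.\<close>

lemma triangle_share_2_ge: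
  assumes "triangle_share D 2 (k1 + k2) n x" "triangle_share D k1 s1 n1 x1" "triangle_share D k2 s2 n2 x2"
    and "32 \<le> D" "k2 \<le> k1" "3 \<le> k2"
  shows "3 \<le> x + x1 + x2"
proof -
  have x: "x = real n - 2" "D + 5 \<le> k1 + k2 + n" using assms(1) by (auto simp: triangle_share_def)
  have neg: "- 1 / 5 \<le> x1" "- 1 / 5 \<le> x2"
    using triangle_share_ge_neg assms by (metis le_trans)+
  have kD: "k1 \<le> D" using assms(2) by (simp add: triangle_share_def)
  consider "6 \<le> n" | "3 \<le> n" "n \<le> 5" | "n = 2" | "n = 1" | "n = 0" by linarith
  then show ?thesis
  proof cases
    case 1
    then show ?thesis using x(1) neg by simp
  next
    case 2
    then have "16 \<le> k1" using x assms by linarith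
    then show ?thesis using triangle_share_ge[OF assms(2), of 16] x(1) 2 neg by simp
  next
    case 3
    then have "18 \<le> k1" using x assms by linarith
    then show ?thesis using triangle_share_ge[OF assms(2), of 18] x(1) 3 neg by simp
  next
    case 4
    then have "18 \<le> k1" "4 \<le> k2" using x assms kD by linarith+
    then show ?thesis
      using triangle_share_ge[OF assms(2), of 18] triangle_share_ge[OF assms(3), of 4] x(1) 4 by simp
  next
    case 5
    show ?thesis
    proof (cases "6 \<le> k2")
      case True
      then have "19 \<le> k1" using x assms 5 by linarith
      then show ?thesis
        using triangle_share_ge[OF assms(2), of 19] triangle_share_ge[OF assms(3), of 6] True x(1) 5 by simp
    next
      case False
      \<comment> \<open>Here \<open>k1 + k2\<close> is at least \<open>D + 5\<close>:
        \<open>k1 \<le> D\<close> yields \<open>5 \<le> k2\<close>, and \<open>k2 \<le> 5\<close>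
        yields \<open>32 \<le> k1\<close>.\<close>
      then have "32 \<le> k1" "5 \<le> k2" using x assms kD 5 by linarith+
      then show ?thesis
        using triangle_share_ge[OF assms(2), of 32] triangle_share_ge[OF assms(3), of 5] x(1) 5 by simp
    qed
  qed
qed

text \<open>As \<open>k2\<close> is at most \<open>D\<close>, each vertex of degree 2 has
  \<open>n\<close> at least 3 and pays at least 1. If \<open>k2\<close> is small, \<open>n\<close>
  is so large that the third vertex may be in debt.\<close>

lemma triangle_share_2_2_ge:
  assumes "triangle_share D 2 (k2 + 2) n x" "triangle_share D 2 (k2 + 2) n' x'" "triangle_share D k2 4 n2 x2"
    and "32 \<le> D"
  shows "3 \<le> x + x' + x2"
proof -
  have x: "x = real n - 2" "D + 3 \<le> k2 + n" "x' = real n' - 2" "D + 3 \<le> k2 + n'" and k2: "2 \<le> k2" "k2 \<le> D"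
    using assms(1-3) by (auto simp: triangle_share_def)
  then have ge: "3 \<le> n" "3 \<le> n'" by linarith+
  consider "4 \<le> k2" | "k2 = 3" | "k2 = 2" using k2 by linarith
  then show ?thesis
  proof cases
    case 1
    then show ?thesis using triangle_share_ge[OF assms(3), of 4] x ge by simp
  next
    case 2
    then show ?thesis using triangle_share_ge_neg[OF assms(3)] x assms(4) by simp
  next
    case 3
    then have "- 2 \<le> x2" using assms(3) by (simp add: triangle_share_def)
    then show ?thesis using x assms(4) 3 by simp
  qed
qed

lemma triangle_share_sum_sorted:
  assumes "triangle_share D k1 (k2 + k3) n1 x1" "triangle_share D k2 (k1 + k3) n2 x2"
    "triangle_share D k3 (k1 + k2) n3 x3" and "32 \<le> D" "k3 \<le> k2" "k2 \<le> k1"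
  shows "3 \<le> x1 + x2 + x3"
proof -
  have ge2: "2 \<le> k3" using assms(3) by (simp add: triangle_share_def)
  note neg = triangle_share_ge_neg[OF assms(1)] triangle_share_ge_neg[OF assms(2)] triangle_share_ge_neg[OF assms(3)]
  consider "k2 = 2" "k3 = 2" | "3 \<le> k2" "k3 = 2" | "k1 = 3" "k2 = 3" "k3 = 3" | "4 \<le> k1" "k2 = 3" "k3 = 3"
    | "4 \<le> k2" "k3 = 3" | "4 \<le> k3" using ge2 assms(5,6) by linarith
  then show ?thesis
  proof cases
    case 1
    then show ?thesis
      using triangle_share_2_2_ge[of D k1 n2 x2 n3 x3 n1 x1] assms by (simp add: add.commute add.left_commute)
  next
    case 2
    then show ?thesis using triangle_share_2_ge[of D k1 k2 n3 x3] assms by fastforce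
  next
    case 3
    then have "5 / 4 \<le> x1" "5 / 4 \<le> x2" "5 / 4 \<le> x3"
      using triangle_share_3[of D 6 n1 x1] triangle_share_3[of D 6 n2 x2] triangle_share_3[of D 6 n3 x3] assms
      by simp_all
    then show ?thesis by simp
  next
    case 4
    show ?thesis
    \<comment> \<open>With degree 20 the large vertex pays \<open>17 / 5\<close>, exactly enough for
      3 and two debts of \<open>1 / 5\<close>.\<close>
    proof (cases "20 \<le> k1")
      case True
      then show ?thesis using triangle_share_ge[OF assms(1), of 20] neg 4 by simp
    next
      case False
      then have "5 / 4 \<le> x2" "5 / 4 \<le> x3"
        using triangle_share_3[of D "k1 + 3" n2 x2] triangle_share_3[of D "k1 + 3" n3 x3] assms 4 by auto
      then show ?thesis using triangle_share_ge[OF assms(1), of 4] 4 by simp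
    qed
  next
    case 5
    then have k2: "1 \<le> x2" "1 \<le> x1"
      using triangle_share_ge[OF assms(2), of 4] triangle_share_ge[OF assms(1), of 4] assms(6) by simp_all
    show ?thesis
    \<comment> \<open>Below 15 the two larger degrees sum to at most 28, the range of
      \<open>triangle_share_3\<close>.\<close>
    proof (cases "15 \<le> k1")
      case True
      then show ?thesis using triangle_share_ge[OF assms(1), of 15] neg 5 k2 by simp
    next
      case False
      then have "5 / 4 \<le> x3" using triangle_share_3[of D "k1 + k2" n3 x3] assms 5 by auto
      then show ?thesis using k2 by simp
    qed
  next
    case 6
    then have "1 \<le> x1" "1 \<le> x2" "1 \<le> x3"
      using triangle_share_ge[OF assms(1), of 4] triangle_share_ge[OF assms(2), of 4]
        triangle_share_ge[OF assms(3), of 4] assms(5,6) by simp_all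
    then show ?thesis by simp
  qed
qed

lemma triangle_share_sum:
  assumes "triangle_share D k1 (k2 + k3) n1 x1" "triangle_share D k2 (k1 + k3) n2 x2"
    "triangle_share D k3 (k1 + k2) n3 x3" and "32 \<le> D"
  shows "3 \<le> x1 + x2 + x3"
proof -
  consider "k3 \<le> k2" "k2 \<le> k1" | "k2 \<le> k3" "k3 \<le> k1" | "k3 \<le> k1" "k1 \<le> k2"
    | "k1 \<le> k3" "k3 \<le> k2" | "k1 \<le> k2" "k2 \<le> k3" | "k2 \<le> k1" "k1 \<le> k3" by linarith
  then show ?thesis
    using assms triangle_share_sum_sorted[of D k1 k2 k3 n1 x1 n2 x2 n3 x3]
      triangle_share_sum_sorted[of D k1 k3 k2 n1 x1 n3 x3 n2 x2]
      triangle_share_sum_sorted[of D k2 k1 k3 n2 x2 n1 x1 n3 x3]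
      triangle_share_sum_sorted[of D k2 k3 k1 n2 x2 n3 x3 n1 x1]
      triangle_share_sum_sorted[of D k3 k1 k2 n3 x3 n1 x1 n2 x2]
      triangle_share_sum_sorted[of D k3 k2 k1 n3 x3 n2 x2 n1 x1]
    by cases (simp_all add: add.commute)
qed

section \<open>The core left by greedy removal\<close>

definition nbrs :: "'a set set \<Rightarrow> 'a \<Rightarrow> 'a set" where
  "nbrs E v = {w. {v, w} \<in> E}"

text \<open>The neighborhood of \<open>v\<close> in the square.\<close>

definition nbrs2 :: "'a set set \<Rightarrow> 'a \<Rightarrow> 'a set" where
  "nbrs2 E v = {w. w \<noteq> v \<and> (w \<in> nbrs E v \<or> (\<exists>x \<in> nbrs E v. w \<in> nbrs E x))}"

text \<open>Planarity enters only as the sparsity bound for all subgraphs, and \<open>D\<close> is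
  an upper bound for the degrees rather than their maximum. In this form the assumptions survive the
  deletion of an edge.\<close>

locale sparse_graph =
  fixes V :: "'a set" and E :: "'a set set" and D :: nat
  assumes graph: "simple_graph V E"
    and degree_le: "\<And>v. v \<in> V \<Longrightarrow> card (nbrs E v) \<le> D"
    and D_ge: "32 \<le> D"
    and no_cycles: "no_4_5_cycle E"
    and sparse: "\<And>V' E'. V' \<subseteq> V \<Longrightarrow> E' \<subseteq> E \<Longrightarrow> (\<And>e. e \<in> E' \<Longrightarrow> e \<subseteq> V') \<Longrightarrow> V' \<noteq> {} \<Longrightarrow>
      4 * int (card E') \<le> 6 * int (card V') + 3 * int (card (triangles E')) - 6"
begin

lemma finite_V: "finite V" and finite_E: "finite E"
  using simple_graph_finite[OF graph] by auto

lemma edge_subset: "e \<in> E \<Longrightarrow> e \<subseteq> V" and edge_card: "e \<in> E \<Longrightarrow> card e = 2"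
  using graph by (auto simp: simple_graph_def)

lemma finite_edge: "e \<in> E \<Longrightarrow> finite e"
  using edge_subset finite_V finite_subset by metis

lemma nbrs_sym: "w \<in> nbrs E v \<longleftrightarrow> v \<in> nbrs E w"
  by (simp add: nbrs_def insert_commute)

lemma nbrs_irrefl: "v \<notin> nbrs E v"
  using edge_card[of "{v}"] by (auto simp: nbrs_def)

lemma nbrs_subset: "nbrs E v \<subseteq> V"
  using edge_subset by (auto simp: nbrs_def)

lemma finite_nbrs [simp]: "finite (nbrs E v)"
  using nbrs_subset finite_V finite_subset by metis

lemma edge_pair: "e \<in> E \<Longrightarrow> v \<in> e \<Longrightarrow> \<exists>w. e = {v, w} \<and> w \<in> nbrs E v"
  using edge_card[of e] by (auto simp: card_2_iff nbrs_def insert_commute)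

lemma edges_at: "{e \<in> E. v \<in> e} = (\<lambda>w. {v, w}) ` nbrs E v"
  using edge_pair by (fastforce simp: nbrs_def)

lemma inj_edges_at: "inj_on (\<lambda>w. {v, w}) X"
  by (auto simp: inj_on_def doubleton_eq_iff)

text \<open>Two common neighbors would close a 4-cycle. In particular, an edge lies in at most one
  triangle.\<close>

lemma common_nbr_unique:
  assumes "x \<noteq> y" "u \<in> nbrs E x" "u \<in> nbrs E y" "w \<in> nbrs E x" "w \<in> nbrs E y"
  shows "u = w"
proof (rule ccontr)
  assume "u \<noteq> w"
  moreover have "x \<noteq> u" "x \<noteq> w" "y \<noteq> u" "y \<noteq> w" using nbrs_irrefl assms by metis+
  moreover have "{x, u} \<in> E" "{u, y} \<in> E" "{y, w} \<in> E" "{w, x} \<in> E"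
    using assms by (auto simp: nbrs_def insert_commute)
  ultimately have "is_cycle E [x, u, y, w]"
    using assms(1) by (auto simp: is_cycle_def cycle_edges_def)
  then show False using no_cycles by (auto simp: no_4_5_cycle_def)
qed

end

text \<open>The configuration to be refuted: \<open>S\<close> is the core on which the removal is
  stuck, and \<open>core\<close> says that no vertex of \<open>S\<close> qualifies for
  removal.\<close>

locale independent_removal = sparse_graph +
  fixes S :: "'a set"
  assumes S_subset: "S \<subseteq> V" and S_nonempty: "S \<noteq> {}"
    and independent: "\<And>e. e \<in> E \<Longrightarrow> e \<inter> S \<noteq> {}"
    and removed_degree: "\<And>r. r \<in> V - S \<Longrightarrow> card (nbrs E r) \<in> {0, 2, 3}"
    and core: "\<And>v. v \<in> S \<Longrightarrow> 4 \<le> card (nbrs E v \<inter> S) \<or> D + 3 \<le> card (nbrs2 E v \<inter> S)"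
begin

lemma finite_S: "finite S"
  using S_subset finite_V finite_subset by metis

definition "core_edges = {e \<in> E. e \<subseteq> S}"

definition "in_triangle r \<longleftrightarrow> (\<exists>x \<in> nbrs E r. \<exists>y \<in> nbrs E r. {x, y} \<in> E)"

text \<open>
  A removed vertex of degree \<open>2\<close> in a triangle has no effect on the square of the remaining graph;
  it is deleted before the sparsity bound is applied.
\<close>
definition "useful = {r \<in> V - S. card (nbrs E r) = 3 \<or> card (nbrs E r) = 2 \<and> \<not> in_triangle r}"

definition "core_nbrs v = nbrs E v \<inter> S"

definition "useful_nbrs_of v = nbrs E v \<inter> useful"

definition "new_via v r = nbrs E r - {v} - nbrs E v"

definition "tri_useful v = {r \<in> useful_nbrs_of v. nbrs E r \<inter> nbrs E v \<noteq> {}}"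

definition "tri_core v = {w \<in> core_nbrs v. \<exists>x \<in> core_nbrs v. {w, x} \<in> E}"

text \<open>A vertex reached through several removed vertices is counted each time, so this bounds
  the number of new square neighbors from above.\<close>

definition "useful_gain v = (\<Sum>r \<in> useful_nbrs_of v. card (new_via v r))"

text \<open>
  A removed vertex of degree \<open>3\<close> outside triangles has charge \<open>4 * 3 - 6 = 6\<close>, which covers the two new
  square neighbors of each of its neighbors. In a triangle it keeps only \<open>3\<close>: the two neighbors in the
  triangle receive \<open>1 / 2\<close> each, half of the one square neighbor that each gains, and the third one \<open>2\<close>.
\<close>
definition "bonus v = real (useful_gain v) - real (card (tri_useful v)) / 2"

section \<open>Square neighbors around a single core vertex\<close>

lemma core_nbrs_in_S: "core_nbrs v \<subseteq> S" and core_nbrs_subset: "core_nbrs v \<subseteq> nbrs E v"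
  by (auto simp: core_nbrs_def)

lemma finite_core_nbrs [simp]: "finite (core_nbrs v)" and finite_useful_nbrs_of [simp]: "finite (useful_nbrs_of v)"
  by (auto simp: core_nbrs_def useful_nbrs_of_def)

lemma finite_useful [simp]: "finite useful"
  using finite_V by (auto simp: useful_def)

lemma core_nbrs_sym: "v \<in> S \<Longrightarrow> w \<in> core_nbrs v \<Longrightarrow> v \<in> core_nbrs w"
  using nbrs_sym by (auto simp: core_nbrs_def)

lemma core_nbrs_irrefl: "v \<notin> core_nbrs v"
  using nbrs_irrefl by (auto simp: core_nbrs_def)

lemma nbrs_removed: "r \<notin> S \<Longrightarrow> nbrs E r \<subseteq> S"
  using independent by (fastforce simp: nbrs_def)

lemma useful_not_S: "r \<in> useful \<Longrightarrow> r \<notin> S" and useful_V: "r \<in> useful \<Longrightarrow> r \<in> V"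
  by (auto simp: useful_def)

lemma useful_nbrs: "r \<in> useful \<Longrightarrow> nbrs E r \<subseteq> S"
  using nbrs_removed useful_not_S by blast

lemma useful_card_nbrs: "r \<in> useful \<Longrightarrow> card (nbrs E r) \<le> 3"
  by (auto simp: useful_def)

lemma card_core_nbrs_le: "v \<in> S \<Longrightarrow> card (core_nbrs v) \<le> D"
  using degree_le[of v] card_mono[OF finite_nbrs core_nbrs_subset, of v] S_subset by (meson le_trans subsetD)

lemma edge_nbrs: "{v, w} \<in> E \<longleftrightarrow> w \<in> nbrs E v"
  by (simp add: nbrs_def)

lemma tri_useful_common_nbr:
  assumes "v \<in> S" "r \<in> tri_useful v"
  obtains w where "w \<in> nbrs E r" "w \<in> nbrs E v" "w \<in> S" "card (nbrs E r) = 3"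
proof -
  have r: "r \<in> useful" "r \<in> nbrs E v" using assms by (auto simp: tri_useful_def useful_nbrs_of_def)
  obtain w where w: "w \<in> nbrs E r" "w \<in> nbrs E v" using assms by (auto simp: tri_useful_def)
  have "v \<in> nbrs E r" using r nbrs_sym by metis
  then have "in_triangle r" using w unfolding in_triangle_def edge_nbrs by blast
  then have "card (nbrs E r) = 3" using r by (auto simp: useful_def)
  then show thesis using that w useful_nbrs[OF r(1)] by blast
qed

text \<open>A useful vertex in a triangle has degree 3. Its third neighbor is not adjacent to
  \<open>v\<close>, as otherwise it and \<open>w\<close> would be two common neighbors of
  \<open>r\<close> and \<open>v\<close>. So each such \<open>r\<close> adds at least 1 to the gain,
  and the bonus is nonnegative.\<close>

lemma card_tri_useful_le: "v \<in> S \<Longrightarrow> card (tri_useful v) \<le> useful_gain v"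
proof -
  assume v: "v \<in> S"
  have fin: "finite (tri_useful v)" by (simp add: tri_useful_def)
  have ge1: "1 \<le> card (new_via v r)" if r: "r \<in> tri_useful v" for r
  proof -
    obtain w where w: "w \<in> nbrs E r" "w \<in> nbrs E v" "card (nbrs E r) = 3"
      using tri_useful_common_nbr[OF v r] by blast
    have "\<not> nbrs E r \<subseteq> {v, w}"
      using card_mono[of "{v, w}" "nbrs E r"] w(3) card_insert_le_m1[of 2 "{w}" v] by fastforce
    then obtain z where z: "z \<in> nbrs E r" "z \<noteq> v" "z \<noteq> w" by blast
    have "r \<noteq> v" using r nbrs_irrefl by (auto simp: tri_useful_def useful_nbrs_of_def)
    then have "z \<notin> nbrs E v" using common_nbr_unique[of r v z w] z w by blast
    then have "z \<in> new_via v r" using z by (simp add: new_via_def)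
    then show ?thesis by (metis One_nat_def Suc_leI card_gt_0_iff empty_iff finite_Diff finite_nbrs new_via_def)
  qed
  have "card (tri_useful v) = (\<Sum>r \<in> tri_useful v. 1)" by simp
  also have "\<dots> \<le> (\<Sum>r \<in> tri_useful v. card (new_via v r))" using ge1 by (rule sum_mono)
  also have "\<dots> \<le> useful_gain v"
    unfolding useful_gain_def by (rule sum_mono2) (auto simp: tri_useful_def)
  finally show ?thesis .
qed

text \<open>Each triangle formed by \<open>v\<close> and a removed vertex uses up an edge from
  \<open>v\<close> to a core neighbor. These edges are distinct and lie in no core triangle, since
  an edge lies in at most one triangle.\<close>

lemma card_tri_useful_core: "v \<in> S \<Longrightarrow> card (tri_useful v) + card (tri_core v) \<le> card (core_nbrs v)"
proof -
  assume v: "v \<in> S"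
  define A where "A = {w \<in> core_nbrs v. \<exists>r \<in> tri_useful v. w \<in> nbrs E r}"
  have "card (tri_useful v) \<le> card A"
  proof (rule card_le_if_inj_on_rel[where r = "\<lambda>r w. w \<in> nbrs E r"])
    show "finite A" by (simp add: A_def)
    fix r assume r: "r \<in> tri_useful v"
    then obtain w where "w \<in> nbrs E r" "w \<in> nbrs E v" "w \<in> S" using tri_useful_common_nbr[OF v r] by blast
    then show "\<exists>w. w \<in> A \<and> w \<in> nbrs E r" using r by (auto simp: A_def core_nbrs_def)
  next
    fix r1 r2 w assume r: "r1 \<in> tri_useful v" "r2 \<in> tri_useful v" "w \<in> A" "w \<in> nbrs E r1" "w \<in> nbrs E r2"
    then have "w \<noteq> v" using core_nbrs_irrefl by (auto simp: A_def)
    then show "r1 = r2" using common_nbr_unique[of w v r1 r2] r nbrs_sym by (auto simp: tri_useful_def useful_nbrs_of_def)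
  qed
  moreover have "A \<inter> tri_core v = {}"
  proof (rule ccontr)
    assume "A \<inter> tri_core v \<noteq> {}"
    then obtain w r x where w: "w \<in> core_nbrs v" "r \<in> tri_useful v" "w \<in> nbrs E r" "x \<in> core_nbrs v" "x \<in> nbrs E w"
      by (auto simp: A_def tri_core_def edge_nbrs)
    then have "w \<noteq> v" using core_nbrs_irrefl by auto
    then have "r = x" using common_nbr_unique[of w v r x] w nbrs_sym by (auto simp: tri_useful_def useful_nbrs_of_def core_nbrs_def)
    then show False using w useful_not_S by (auto simp: tri_useful_def useful_nbrs_of_def core_nbrs_def)
  qed
  moreover have "A \<union> tri_core v \<subseteq> core_nbrs v" by (auto simp: A_def tri_core_def)
  ultimately show ?thesis
    using card_Un_disjoint[of A "tri_core v"] card_mono[of "core_nbrs v" "A \<union> tri_core v"]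
    by (simp add: A_def tri_core_def)
qed

lemma bonus_nonneg: "v \<in> S \<Longrightarrow> 0 \<le> bonus v"
  using card_tri_useful_le[of v] by (simp add: bonus_def)

text \<open>The \<open>D + 3\<close> square neighbors are counted by how they are reached: directly,
  through a core neighbor, or through a useful vertex. A core neighbor \<open>w\<close> in a core
  triangle with \<open>v\<close> reaches one vertex fewer, because the third vertex is already a
  neighbor of \<open>v\<close>; this yields the term \<open>card (tri_core v)\<close>.\<close>

lemma low_vertex:
  assumes v: "v \<in> S" and "card (core_nbrs v) \<le> 3"
  shows "D + 3 + card (tri_core v) \<le> (\<Sum>w \<in> core_nbrs v. card (core_nbrs w)) + useful_gain v"
proof -
  define X where "X w = core_nbrs w - {v} - nbrs E v" for w
  have "nbrs2 E v \<inter> S \<subseteq> core_nbrs v \<union> (\<Union>w \<in> core_nbrs v. X w) \<union> (\<Union>r \<in> useful_nbrs_of v. new_via v r)"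
  proof
    fix u assume u: "u \<in> nbrs2 E v \<inter> S"
    show "u \<in> core_nbrs v \<union> (\<Union>w \<in> core_nbrs v. X w) \<union> (\<Union>r \<in> useful_nbrs_of v. new_via v r)"
    proof (cases "u \<in> nbrs E v")
      case True
      then show ?thesis using u by (simp add: core_nbrs_def)
    next
      case False
      then obtain x where x: "x \<in> nbrs E v" "u \<in> nbrs E x" and "u \<noteq> v" using u by (auto simp: nbrs2_def)
      show ?thesis
      proof (cases "x \<in> S")
        case True
        then have "u \<in> X x" using x u False \<open>u \<noteq> v\<close> by (auto simp: X_def core_nbrs_def)
        then show ?thesis using True x by (auto simp: core_nbrs_def)
      next
        case xS: False
        \<comment> \<open>Otherwise \<open>x\<close> would have exactly the neighbors
          \<open>u\<close> and \<open>v\<close> and lie in a triangle, so \<open>u\<close> would be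
          adjacent to \<open>v\<close>.\<close>
        have "x \<in> useful"
        proof (rule ccontr)
          assume "x \<notin> useful"
          moreover have "x \<in> V - S" using x nbrs_subset xS by blast
          moreover have "v \<in> nbrs E x" using x(1) nbrs_sym by metis
          then have "card (nbrs E x) \<noteq> 0" using finite_nbrs[of x] by (metis card_0_eq empty_iff)
          ultimately have "card (nbrs E x) = 2" "in_triangle x" using removed_degree[of x] by (auto simp: useful_def)
          moreover have "nbrs E x = {u, v}"
            using card_seteq[of "nbrs E x" "{u, v}"] x(2) \<open>v \<in> nbrs E x\<close> calculation(1) \<open>u \<noteq> v\<close> by simp
          moreover have "{u} \<notin> E" "{v} \<notin> E" using edge_card by fastforce+
          ultimately have "{u, v} \<in> E" by (auto simp: in_triangle_def insert_commute)
          then show False using False by (simp add: nbrs_def insert_commute)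
        qed
        then have "x \<in> useful_nbrs_of v" "u \<in> new_via v x" using x False \<open>u \<noteq> v\<close> by (auto simp: useful_nbrs_of_def new_via_def)
        then show ?thesis by blast
      qed
    qed
  qed
  moreover have "finite (core_nbrs v \<union> (\<Union>w \<in> core_nbrs v. X w) \<union> (\<Union>r \<in> useful_nbrs_of v. new_via v r))"
    by (auto simp: X_def new_via_def)
  ultimately have "card (nbrs2 E v \<inter> S) \<le> card (core_nbrs v \<union> (\<Union>w \<in> core_nbrs v. X w) \<union> (\<Union>r \<in> useful_nbrs_of v. new_via v r))"
    by (rule card_mono[rotated])
  also have "\<dots> \<le> card (core_nbrs v) + card (\<Union>w \<in> core_nbrs v. X w) + card (\<Union>r \<in> useful_nbrs_of v. new_via v r)"
    by (meson add_le_mono card_Un_le le_refl le_trans)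
  also have "card (\<Union>w \<in> core_nbrs v. X w) \<le> (\<Sum>w \<in> core_nbrs v. card (X w))" by (rule card_UN_le) simp
  also have "card (\<Union>r \<in> useful_nbrs_of v. new_via v r) \<le> useful_gain v"
    unfolding useful_gain_def by (rule card_UN_le) simp
  finally have le: "card (nbrs2 E v \<inter> S) \<le> card (core_nbrs v) + (\<Sum>w \<in> core_nbrs v. card (X w)) + useful_gain v"
    by simp
  have X: "card (X w) + 1 + (if w \<in> tri_core v then 1 else 0) \<le> card (core_nbrs w)" if w: "w \<in> core_nbrs v" for w
  proof -
    have vw: "v \<in> core_nbrs w" using core_nbrs_sym[OF v w] .
    show ?thesis
    proof (cases "w \<in> tri_core v")
      case True
      then obtain x where x: "x \<in> core_nbrs v" "x \<in> nbrs E w" by (auto simp: tri_core_def edge_nbrs)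
      have "X w \<subseteq> core_nbrs w - {v, x}" using x by (auto simp: X_def core_nbrs_def)
      then have "card (X w) \<le> card (core_nbrs w - {v, x})" by (intro card_mono) auto
      also have "\<dots> = card (core_nbrs w) - card {v, x}"
        by (rule card_Diff_subset) (use vw x in \<open>auto simp: core_nbrs_def\<close>)
      also have "card {v, x} = 2" using x core_nbrs_irrefl[of v] by (auto simp: card_insert_if)
      finally have "card (X w) \<le> card (core_nbrs w) - 2" .
      moreover have "card {v, x} \<le> card (core_nbrs w)"
        by (rule card_mono) (use vw x in \<open>auto simp: core_nbrs_def\<close>)
      ultimately show ?thesis using True \<open>card {v, x} = 2\<close> by simp
    next
      case False
      have "card (X w) \<le> card (core_nbrs w - {v})" by (intro card_mono) (auto simp: X_def)
      also have "\<dots> = card (core_nbrs w) - 1" using vw by simp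
      finally show ?thesis using False vw card_gt_0_iff[of "core_nbrs w"] by fastforce
    qed
  qed
  \<comment> \<open>The summand 1 counts \<open>w\<close> itself as a neighbor of
    \<open>v\<close>.\<close>
  have "card (core_nbrs v) + (\<Sum>w \<in> core_nbrs v. card (X w)) + card (tri_core v)
      = (\<Sum>w \<in> core_nbrs v. card (X w) + 1 + (if w \<in> tri_core v then 1 else 0))"
  proof -
    have "(\<Sum>w \<in> core_nbrs v. if w \<in> tri_core v then 1 else 0 :: nat) = card (core_nbrs v \<inter> tri_core v)"
      by (simp add: sum.If_cases Int_def)
    also have "core_nbrs v \<inter> tri_core v = tri_core v" by (auto simp: tri_core_def)
    finally show ?thesis by (simp only: sum.distrib) simp
  qed
  also have "\<dots> \<le> (\<Sum>w \<in> core_nbrs v. card (core_nbrs w))" using X by (rule sum_mono)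
  finally show ?thesis using le core[OF v] assms(2) by (simp add: core_nbrs_def)
qed

end

section \<open>The total charge\<close>

text \<open>This settles a vertex with one core neighbor, whose charge is \<open>- 4\<close>. Since
  \<open>k\<close> is at most \<open>D\<close>, the gain is at least 3; below 5 it forces a neighbor
  of degree at least 31.\<close>

lemma flow_one:
  fixes D k \<rho> a :: nat
  assumes "32 \<le> D" "k \<le> D" "D + 3 \<le> k + \<rho>" "a \<le> 1"
  shows "4 \<le> real \<rho> - real a / 2 + flow k 1"
proof (cases "5 \<le> \<rho>")
  case True
  then show ?thesis using flow_nonneg[of k 1] assms by linarith
next
  case False
  then have "31 \<le> k" using assms by linarith
  then have "2 - 6 / real 31 \<le> flow k 1" by (intro flow_ge) auto
  then show ?thesis using assms by simp
qed

context independent_removal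
begin

section \<open>Edges, triangles and charge of the kept graph\<close>

lemma in_triangle_nbrs: "in_triangle r \<longleftrightarrow> (\<exists>x \<in> nbrs E r. \<exists>y \<in> nbrs E r. y \<in> nbrs E x)"
  by (simp add: in_triangle_def edge_nbrs)

lemma finite_core_edges [simp]: "finite core_edges"
  using finite_E by (simp add: core_edges_def)

lemma sum_core_degrees: "(\<Sum>v \<in> S. card (core_nbrs v)) = 2 * card core_edges"
proof -
  have "card (core_nbrs v) = (\<Sum>e \<in> {e \<in> core_edges. v \<in> e}. 1)" if v: "v \<in> S" for v
  proof -
    have "{e \<in> core_edges. v \<in> e} = (\<lambda>w. {v, w}) ` core_nbrs v"
      using edge_pair v by (fastforce simp: core_edges_def core_nbrs_def nbrs_def)
    then show ?thesis by (simp add: card_image[OF inj_edges_at])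
  qed
  then have "(\<Sum>v \<in> S. card (core_nbrs v)) = (\<Sum>v \<in> S. \<Sum>e \<in> {e \<in> core_edges. v \<in> e}. 1)" by simp
  also have "\<dots> = (\<Sum>e \<in> core_edges. \<Sum>v \<in> {v \<in> S. v \<in> e}. 1)"
    by (rule sum.swap_restrict) (auto simp: finite_S)
  also have "\<dots> = (\<Sum>e \<in> core_edges. 2)"
  proof (rule sum.cong)
    fix e assume e: "e \<in> core_edges"
    then have "{v \<in> S. v \<in> e} = e" by (auto simp: core_edges_def)
    then show "(\<Sum>v \<in> {v \<in> S. v \<in> e}. 1) = (2 :: nat)" using e edge_card by (simp add: core_edges_def)
  qed simp
  finally show ?thesis by simp
qed

definition "kept_edges = {e \<in> E. e \<subseteq> S \<union> useful}"

text \<open>All neighbors of a useful vertex lie in \<open>S\<close>, so a kept edge outside the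
  core has exactly one useful end.\<close>

lemma card_kept_edges: "card kept_edges = card core_edges + (\<Sum>r \<in> useful. card (nbrs E r))"
proof -
  have split: "kept_edges = core_edges \<union> (\<Union>r \<in> useful. {e \<in> E. r \<in> e})"
  proof
    show "kept_edges \<subseteq> core_edges \<union> (\<Union>r \<in> useful. {e \<in> E. r \<in> e})"
      by (auto simp: kept_edges_def core_edges_def)
    have "e \<subseteq> S \<union> useful" if e: "e \<in> E" "r \<in> e" "r \<in> useful" for e r
      using edge_pair[OF e(1,2)] useful_nbrs[OF e(3)] e(3) by auto
    then show "core_edges \<union> (\<Union>r \<in> useful. {e \<in> E. r \<in> e}) \<subseteq> kept_edges"
      by (auto simp: kept_edges_def core_edges_def)
  qed
  have "core_edges \<inter> (\<Union>r \<in> useful. {e \<in> E. r \<in> e}) = {}"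
    using useful_not_S by (auto simp: core_edges_def)
  then have "card kept_edges = card core_edges + card (\<Union>r \<in> useful. {e \<in> E. r \<in> e})"
    unfolding split using finite_E by (intro card_Un_disjoint) auto
  also have "card (\<Union>r \<in> useful. {e \<in> E. r \<in> e}) = (\<Sum>r \<in> useful. card {e \<in> E. r \<in> e})"
  proof (rule card_UN_disjoint)
    show "\<forall>r \<in> useful. \<forall>r' \<in> useful. r \<noteq> r' \<longrightarrow> {e \<in> E. r \<in> e} \<inter> {e \<in> E. r' \<in> e} = {}"
    proof (intro ballI impI equals0I)
      fix r r' e assume r: "r \<in> useful" "r' \<in> useful" "r \<noteq> r'" and "e \<in> {e \<in> E. r \<in> e} \<inter> {e \<in> E. r' \<in> e}"
      then obtain w where w: "e = {r, w}" "w \<in> nbrs E r" "r' \<in> e" using edge_pair by blast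
      then have "r' \<in> S" using useful_nbrs[OF r(1)] r(3) by auto
      then show False using useful_not_S[OF r(2)] by blast
    qed
  qed (use finite_E in auto)
  also have "\<dots> = (\<Sum>r \<in> useful. card (nbrs E r))"
    by (simp add: edges_at card_image[OF inj_edges_at])
  finally show ?thesis .
qed

text \<open>A triangle not within \<open>S\<close> contains a useful vertex. As that vertex has at
  most three neighbors, two different triangles at it would share an edge, which is
  excluded.\<close>

lemma card_kept_triangles:
  "card (triangles kept_edges) \<le> card (triangles core_edges) + card {r \<in> useful. in_triangle r}"
proof -
  have sub: "kept_edges \<subseteq> E" by (auto simp: kept_edges_def)
  have fin1: "finite (triangles kept_edges)"
    by (rule finite_triangles[OF finite_subset[OF sub finite_E]]) (use sub finite_edge in blast)
  have fin2: "finite (triangles core_edges)"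
    by (rule finite_triangles[OF finite_core_edges]) (use finite_edge in \<open>simp add: core_edges_def\<close>)
  have tri: "\<exists>x y. t = {r, x, y} \<and> x \<noteq> y \<and> x \<in> nbrs E r \<and> y \<in> nbrs E r \<and> y \<in> nbrs E x"
    if t: "t \<in> triangles kept_edges" "r \<in> t" for t r
  proof -
    obtain x y z where xyz: "t = {x, y, z}" "x \<noteq> y" "y \<noteq> z" "x \<noteq> z"
        "y \<in> nbrs E x" "z \<in> nbrs E y" "z \<in> nbrs E x"
      using t(1) sub by (elim triangle_edges) (auto simp: nbrs_def)
    have sym: "x \<in> nbrs E y" "y \<in> nbrs E z" "x \<in> nbrs E z" using xyz nbrs_sym by metis+
    consider "r = x" | "r = y" | "r = z" using t(2) xyz(1) by blast
    then show ?thesis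
    proof cases
      case 1
      then show ?thesis using xyz by (intro exI[of _ y] exI[of _ z]) simp
    next
      case 2
      then show ?thesis using xyz sym by (intro exI[of _ x] exI[of _ z]) (simp add: insert_commute)
    next
      case 3
      then show ?thesis using xyz sym by (intro exI[of _ x] exI[of _ y]) (simp add: insert_commute)
    qed
  qed
  have "card (triangles kept_edges - triangles core_edges) \<le> card {r \<in> useful. in_triangle r}"
  proof (rule card_le_if_inj_on_rel[where r = "\<lambda>t r. r \<in> t"])
    show "finite {r \<in> useful. in_triangle r}" by simp
    fix t assume t: "t \<in> triangles kept_edges - triangles core_edges"
    have "\<not> t \<subseteq> S" using t unfolding triangles_def core_edges_def kept_edges_def by auto
    then obtain r where r: "r \<in> t" "r \<notin> S" by blast
    obtain x y where xy: "t = {r, x, y}" "x \<noteq> y" "x \<in> nbrs E r" "y \<in> nbrs E r" "y \<in> nbrs E x"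
      using tri[of t r] t r by blast
    have "{r, x} \<in> kept_edges" using t xy nbrs_irrefl[of r] by (auto simp: triangles_def)
    then have "r \<in> useful" using r by (auto simp: kept_edges_def)
    moreover have "in_triangle r" using xy by (auto simp: in_triangle_nbrs)
    ultimately show "\<exists>r. r \<in> {r \<in> useful. in_triangle r} \<and> r \<in> t" using r by blast
  next
    fix t1 t2 r assume t: "t1 \<in> triangles kept_edges - triangles core_edges"
      "t2 \<in> triangles kept_edges - triangles core_edges" "r \<in> {r \<in> useful. in_triangle r}" "r \<in> t1" "r \<in> t2"
    obtain x y where xy: "t1 = {r, x, y}" "x \<noteq> y" "x \<in> nbrs E r" "y \<in> nbrs E r" "y \<in> nbrs E x"
      using tri[of t1 r] t by blast
    obtain z w where zw: "t2 = {r, z, w}" "z \<noteq> w" "z \<in> nbrs E r" "w \<in> nbrs E r" "w \<in> nbrs E z"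
      using tri[of t2 r] t by blast
    have sym: "x \<in> nbrs E y" "z \<in> nbrs E w" using xy zw nbrs_sym by metis+
    have ne: "r \<noteq> x" "r \<noteq> y" using xy nbrs_irrefl by metis+
    have "x = z \<or> x = w \<or> y = z \<or> y = w"
    proof (rule ccontr)
      assume "\<not> ?thesis"
      then have "card {x, y, z, w} = 4" using xy zw by auto
      moreover have "card {x, y, z, w} \<le> card (nbrs E r)" by (rule card_mono) (use xy zw in auto)
      ultimately show False using useful_card_nbrs[of r] t by simp
    qed
    then show "t1 = t2"
      using common_nbr_unique[OF ne(1), of y w] common_nbr_unique[OF ne(1), of y z]
        common_nbr_unique[OF ne(2), of x w] common_nbr_unique[OF ne(2), of x z] xy zw sym
      by (elim disjE) auto
  qed
  moreover have "card (triangles kept_edges)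
      \<le> card (triangles core_edges) + card (triangles kept_edges - triangles core_edges)"
    using fin1 fin2 card_Un_le[of "triangles core_edges" "triangles kept_edges - triangles core_edges"]
      card_mono[of "triangles core_edges \<union> triangles kept_edges" "triangles kept_edges"] by simp
  ultimately show ?thesis by linarith
qed

definition "contribution v r = real (card (new_via v r)) - (if nbrs E r \<inter> nbrs E v \<noteq> {} then 1 / 2 else 0)"

text \<open>The bound is the charge of the removed vertex, reduced by 3 for a triangle at it.
  Equality is reached with \<open>2 = 1 + 1\<close> for degree 2, \<open>6 = 2 + 2 + 2\<close> for
  degree 3 outside triangles, and \<open>3 = 1 / 2 + 1 / 2 + 2\<close> in a triangle.\<close>

lemma sum_contributions:
  assumes r: "r \<in> useful"
  shows "(\<Sum>v \<in> nbrs E r. contribution v r) \<le> 4 * real (card (nbrs E r)) - 6 - (if in_triangle r then 3 else 0)"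
proof -
  have new: "card (new_via v r) \<le> card (nbrs E r) - 1" if "v \<in> nbrs E r" for v
  proof -
    have "card (new_via v r) \<le> card (nbrs E r - {v})" by (rule card_mono) (auto simp: new_via_def)
    then show ?thesis using that by simp
  qed
  have le: "contribution v r \<le> real (card (nbrs E r) - 1)" if "v \<in> nbrs E r" for v
    using new[OF that] by (simp add: contribution_def)
  show ?thesis
  proof (cases "in_triangle r")
    case False
    have "(\<Sum>v \<in> nbrs E r. contribution v r) \<le> real (card (nbrs E r)) * real (card (nbrs E r) - 1)"
      using sum_bounded_above[of "nbrs E r" "\<lambda>v. contribution v r"] le by blast
    moreover have "card (nbrs E r) = 2 \<or> card (nbrs E r) = 3" using r by (auto simp: useful_def)
    ultimately show ?thesis using False by auto
  next
    case True
    then have c3: "card (nbrs E r) = 3" using r by (auto simp: useful_def)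
    obtain x y where xy: "x \<in> nbrs E r" "y \<in> nbrs E r" "y \<in> nbrs E x" using True by (auto simp: in_triangle_nbrs)
    have "x \<noteq> y" using xy(3) nbrs_irrefl by metis
    then have "card (nbrs E r - {x, y}) = 1" using c3 xy by (subst card_Diff_subset) auto
    then obtain z where z: "nbrs E r - {x, y} = {z}" by (rule card_1_singletonE)
    then have N: "nbrs E r = {x, y, z}" and zxy: "z \<noteq> x" "z \<noteq> y" using xy by auto
    have yx: "x \<in> nbrs E y" using xy(3) nbrs_sym by metis
    have "new_via x r \<subseteq> {z}" "new_via y r \<subseteq> {z}" using xy(3) yx by (auto simp: new_via_def N)
    then have "card (new_via x r) \<le> 1" "card (new_via y r) \<le> 1" using card_mono[of "{z}"] by fastforce+
    moreover have "nbrs E r \<inter> nbrs E x \<noteq> {}" "nbrs E r \<inter> nbrs E y \<noteq> {}" using xy yx by auto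
    ultimately have "contribution x r \<le> 1 / 2" "contribution y r \<le> 1 / 2" by (simp_all add: contribution_def)
    moreover have "contribution z r \<le> 2" using le[of z] c3 N by auto
    moreover have "(\<Sum>v \<in> nbrs E r. contribution v r) = contribution x r + contribution y r + contribution z r"
      unfolding N using \<open>x \<noteq> y\<close> zxy by auto
    ultimately show ?thesis using True c3 by simp
  qed
qed

text \<open>The bonuses, summed over removed vertices instead of core vertices, are paid by the
  charges of the useful vertices. What remains is the sparsity bound for the kept graph, whose
  constant \<open>- 6\<close> makes the inequality strict.\<close>

lemma total_charge:
  "(\<Sum>v \<in> S. 2 * real (card (core_nbrs v)) - 6 + bonus v) < 3 * real (card (triangles core_edges))"
proof -
  define B where "B = (\<Sum>r \<in> useful. card (nbrs E r))"
  define T where "T = card {r \<in> useful. in_triangle r}"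
  have "bonus v = (\<Sum>r \<in> {r \<in> useful. r \<in> nbrs E v}. contribution v r)" for v
  proof -
    have "(\<Sum>r \<in> useful_nbrs_of v. if nbrs E r \<inter> nbrs E v \<noteq> {} then 1 / 2 else 0) = real (card (tri_useful v)) / 2"
      by (simp add: sum.If_cases tri_useful_def Int_def)
    moreover have "{r \<in> useful. r \<in> nbrs E v} = useful_nbrs_of v" by (auto simp: useful_nbrs_of_def)
    ultimately show ?thesis by (simp add: bonus_def contribution_def sum_subtractf useful_gain_def)
  qed
  then have "(\<Sum>v \<in> S. bonus v) = (\<Sum>v \<in> S. \<Sum>r \<in> {r \<in> useful. r \<in> nbrs E v}. contribution v r)" by simp
  also have "\<dots> = (\<Sum>r \<in> useful. \<Sum>v \<in> {v \<in> S. r \<in> nbrs E v}. contribution v r)"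
    by (rule sum.swap_restrict) (auto simp: finite_S)
  also have "\<dots> = (\<Sum>r \<in> useful. \<Sum>v \<in> nbrs E r. contribution v r)"
  proof (rule sum.cong)
    fix r assume "r \<in> useful"
    then have "{v \<in> S. r \<in> nbrs E v} = nbrs E r" using useful_nbrs nbrs_sym by blast
    then show "(\<Sum>v \<in> {v \<in> S. r \<in> nbrs E v}. contribution v r) = (\<Sum>v \<in> nbrs E r. contribution v r)" by simp
  qed simp
  also have "\<dots> \<le> (\<Sum>r \<in> useful. 4 * real (card (nbrs E r)) - 6 - (if in_triangle r then 3 else 0))"
    by (rule sum_mono) (rule sum_contributions)
  also have "\<dots> = 4 * real B - 6 * real (card useful)
      - 3 * real (T)"
  proof -
    have "(\<Sum>r \<in> useful. if in_triangle r then 3 else 0) = 3 * real T"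
      by (simp add: sum.If_cases Int_def T_def)
    then show ?thesis by (simp add: sum_subtractf sum_distrib_left B_def)
  qed
  finally have bonus: "(\<Sum>v \<in> S. bonus v) \<le> \<dots>" .
  have "4 * int (card kept_edges) \<le> 6 * int (card (S \<union> useful)) + 3 * int (card (triangles kept_edges)) - 6"
    by (rule sparse) (use S_subset S_nonempty useful_V in \<open>auto simp: kept_edges_def\<close>)
  moreover have "card (S \<union> useful) = card S + card useful"
    using useful_not_S finite_S by (intro card_Un_disjoint) auto
  ultimately have "4 * card kept_edges + 6 \<le> 6 * (card S + card useful) + 3 * card (triangles kept_edges)"
    by simp
  then have "4 * card core_edges + 4 * B + 6
      \<le> 6 * card S + 6 * card useful + 3 * card (triangles core_edges) + 3 * T"
    using card_kept_triangles[folded T_def] card_kept_edges[folded B_def]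
    by simp
  then have "4 * real (card core_edges) + 4 * real B + 6
      \<le> 6 * real (card S) + 6 * real (card useful) + 3 * real (card (triangles core_edges))
        + 3 * real (T)" by linarith
  moreover have "(\<Sum>v \<in> S. 2 * real (card (core_nbrs v)) - 6 + bonus v)
      = 4 * real (card core_edges) - 6 * real (card S) + (\<Sum>v \<in> S. bonus v)"
    using arg_cong[OF sum_core_degrees, of real]
    by (simp add: sum.distrib sum_subtractf sum_distrib_left[symmetric])
  ultimately show ?thesis using bonus by linarith
qed

end

section \<open>Discharging\<close>

context independent_removal
begin

definition "deg v = card (core_nbrs v)"

definition "free_nbrs v = core_nbrs v - tri_core v"

definition "triangles_at v = {t \<in> triangles core_edges. v \<in> t}"

definition "transfer v = (\<Sum>w \<in> free_nbrs v. flow (deg w) (deg v) - flow (deg v) (deg w))"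

text \<open>The amount given to each core triangle at \<open>v\<close>: the shares
  \<open>2 - 6 / deg v\<close> of the two edges at \<open>v\<close> in that triangle, or for a
  vertex of low degree everything that is left.\<close>

definition "payment v = (if 4 \<le> deg v then 4 - 12 / deg v else 2 * real (deg v) - 6 + bonus v + transfer v)"

lemma core_edge_iff: "v \<in> S \<Longrightarrow> {v, w} \<in> core_edges \<longleftrightarrow> w \<in> core_nbrs v"
  using nbrs_subset by (auto simp: core_edges_def core_nbrs_def nbrs_def)

lemma core_triangle:
  assumes "t \<in> triangles core_edges" "v \<in> t"
  obtains x y where "t = {v, x, y}" "v \<in> S" "x \<noteq> y" "x \<in> core_nbrs v" "y \<in> core_nbrs v" "{x, y} \<in> E"
proof -
  obtain x y z where xyz: "t = {x, y, z}" "x \<noteq> y" "y \<noteq> z" "x \<noteq> z"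
      "{x, y} \<in> core_edges" "{y, z} \<in> core_edges" "{x, z} \<in> core_edges"
    using assms(1) by (elim triangle_edges)
  then have S: "x \<in> S" "y \<in> S" "z \<in> S" and E: "{x, y} \<in> E" "{y, z} \<in> E" "{x, z} \<in> E"
    by (auto simp: core_edges_def)
  have E': "{y, x} \<in> E" "{z, y} \<in> E" "{z, x} \<in> E" using E by (simp_all add: insert_commute)
  consider "v = x" | "v = y" | "v = z" using assms(2) xyz(1) by blast
  then show thesis
  proof cases
    case 1
    then show ?thesis using that[of y z] xyz S E by (auto simp: core_nbrs_def nbrs_def)
  next
    case 2
    then show ?thesis using that[of x z] xyz S E E' by (auto simp: core_nbrs_def nbrs_def insert_commute)
  next
    case 3
    then show ?thesis using that[of x y] xyz S E E' by (auto simp: core_nbrs_def nbrs_def insert_commute)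
  qed
qed

lemma finite_core_triangles: "finite (triangles core_edges)"
  by (rule finite_triangles[OF finite_core_edges]) (use finite_edge in \<open>simp add: core_edges_def\<close>)

text \<open>Two triangles at \<open>v\<close> share no other vertex, since an edge lies in at most
  one triangle; so each accounts for two neighbors of its own.\<close>

lemma card_tri_core:
  assumes v: "v \<in> S"
  shows "card (tri_core v) = 2 * card (triangles_at v)"
proof -
  have eq: "tri_core v = (\<Union>t \<in> triangles_at v. t - {v})"
  proof
    show "tri_core v \<subseteq> (\<Union>t \<in> triangles_at v. t - {v})"
    proof
      fix w assume "w \<in> tri_core v"
      then obtain x where x: "w \<in> core_nbrs v" "x \<in> core_nbrs v" "{w, x} \<in> E" by (auto simp: tri_core_def)
      have S: "w \<in> S" "x \<in> S" using x core_nbrs_in_S by auto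
      have "{v, w} \<in> core_edges" "{v, x} \<in> core_edges" "{w, x} \<in> core_edges"
        using x S core_edge_iff[OF v] by (auto simp: core_edges_def)
      moreover have "v \<noteq> w" "v \<noteq> x" "w \<noteq> x" using x core_nbrs_irrefl nbrs_irrefl by (auto simp: nbrs_def)
      ultimately have "{v, w, x} \<in> triangles_at v"
        by (auto simp: triangles_at_def triangles_def insert_commute)
      then show "w \<in> (\<Union>t \<in> triangles_at v. t - {v})" using \<open>v \<noteq> w\<close> by blast
    qed
    show "(\<Union>t \<in> triangles_at v. t - {v}) \<subseteq> tri_core v"
    proof
      fix w assume "w \<in> (\<Union>t \<in> triangles_at v. t - {v})"
      then obtain t where t: "t \<in> triangles core_edges" "v \<in> t" "w \<in> t" "w \<noteq> v"
        by (auto simp: triangles_at_def)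
      obtain x y where "t = {v, x, y}" "x \<in> core_nbrs v" "y \<in> core_nbrs v" "{x, y} \<in> E"
        using core_triangle[OF t(1,2)] by metis
      then show "w \<in> tri_core v" using t by (auto simp: tri_core_def insert_commute)
    qed
  qed
  have "card (\<Union>t \<in> triangles_at v. t - {v}) = (\<Sum>t \<in> triangles_at v. card (t - {v}))"
  proof (rule card_UN_disjoint)
    show "finite (triangles_at v)" using finite_core_triangles by (simp add: triangles_at_def)
    show "\<forall>t \<in> triangles_at v. finite (t - {v})"
      by (auto simp: triangles_at_def triangles_def intro: card_ge_0_finite)
    show "\<forall>t1 \<in> triangles_at v. \<forall>t2 \<in> triangles_at v. t1 \<noteq> t2 \<longrightarrow> (t1 - {v}) \<inter> (t2 - {v}) = {}"
    proof (intro ballI impI equals0I)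
      fix t1 t2 w assume t: "t1 \<in> triangles_at v" "t2 \<in> triangles_at v" "t1 \<noteq> t2" "w \<in> (t1 - {v}) \<inter> (t2 - {v})"
      have third: "\<exists>x. t = {v, w, x} \<and> x \<in> nbrs E v \<and> x \<in> nbrs E w"
        if t: "t \<in> triangles_at v" "w \<in> t" "w \<noteq> v" for t
      proof -
        obtain x y where "t = {v, x, y}" "x \<in> core_nbrs v" "y \<in> core_nbrs v" "{x, y} \<in> E"
          using core_triangle[of t v] t(1) unfolding triangles_at_def mem_Collect_eq by metis
        then show ?thesis using t by (auto simp: core_nbrs_def nbrs_def insert_commute)
      qed
      obtain x where x: "t1 = {v, w, x}" "x \<in> nbrs E v" "x \<in> nbrs E w" using third[of t1] t by blast
      obtain y where y: "t2 = {v, w, y}" "y \<in> nbrs E v" "y \<in> nbrs E w" using third[of t2] t by blast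
      have "x = y" using common_nbr_unique[of v w x y] x y t by auto
      then show False using x y t by simp
    qed
  qed
  also have "\<dots> = (\<Sum>t \<in> triangles_at v. 2)"
    by (rule sum.cong) (auto simp: triangles_at_def triangles_def)
  finally show ?thesis by (simp add: eq)
qed

lemma tri_core_subset: "tri_core v \<subseteq> core_nbrs v"
  by (auto simp: tri_core_def)

lemma finite_free [simp]: "finite (free_nbrs v)" and finite_tri_core [simp]: "finite (tri_core v)"
  by (simp_all add: free_nbrs_def tri_core_def)

lemma card_free_nbrs: "v \<in> S \<Longrightarrow> card (free_nbrs v) + 2 * card (triangles_at v) = deg v"
  using card_Diff_subset[OF finite_tri_core tri_core_subset, of v] card_mono[OF finite_core_nbrs tri_core_subset, of v]
  by (simp add: free_nbrs_def card_tri_core deg_def)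

lemma free_nbrs_sym:
  assumes "v \<in> S" "w \<in> free_nbrs v"
  shows "v \<in> free_nbrs w"
proof -
  have w: "w \<in> core_nbrs v" "w \<notin> tri_core v" using assms by (auto simp: free_nbrs_def)
  have "v \<notin> tri_core w"
  proof
    assume "v \<in> tri_core w"
    then obtain x where "x \<in> core_nbrs w" "{v, x} \<in> E" by (auto simp: tri_core_def)
    then have "x \<in> core_nbrs v" "{w, x} \<in> E" by (auto simp: core_nbrs_def nbrs_def)
    then show False using w by (auto simp: tri_core_def)
  qed
  then show ?thesis using core_nbrs_sym[OF assms(1) w(1)] by (simp add: free_nbrs_def)
qed

text \<open>Being a free neighbor is symmetric, so everything sent along a free edge is received at
  its other end.\<close>

lemma sum_transfer: "(\<Sum>v \<in> S. transfer v) = 0"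
proof -
  have set: "free_nbrs v = {w \<in> S. w \<in> free_nbrs v}" for v
    using core_nbrs_in_S by (auto simp: free_nbrs_def)
  have sym: "{v \<in> S. w \<in> free_nbrs v} = free_nbrs w" if "w \<in> S" for w
    using free_nbrs_sym[OF that] free_nbrs_sym set by blast
  have "(\<Sum>v \<in> S. \<Sum>w \<in> free_nbrs v. flow (deg w) (deg v))
      = (\<Sum>v \<in> S. \<Sum>w \<in> {w \<in> S. w \<in> free_nbrs v}. flow (deg w) (deg v))"
    using set by simp
  also have "\<dots> = (\<Sum>w \<in> S. \<Sum>v \<in> {v \<in> S. w \<in> free_nbrs v}. flow (deg w) (deg v))"
    by (rule sum.swap_restrict[OF finite_S finite_S])
  also have "\<dots> = (\<Sum>w \<in> S. \<Sum>v \<in> free_nbrs w. flow (deg w) (deg v))"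
    using sym by (intro sum.cong) simp_all
  finally show ?thesis by (simp add: transfer_def sum_subtractf)
qed

lemma transfer_ge: "- (\<Sum>w \<in> free_nbrs v. flow (deg v) (deg w)) \<le> transfer v"
  using sum_nonneg[of "free_nbrs v" "\<lambda>w. flow (deg w) (deg v)"] flow_nonneg
  by (simp add: transfer_def sum_subtractf)

lemma deg_le: "v \<in> S \<Longrightarrow> deg v \<le> D"
  by (simp add: deg_def card_core_nbrs_le)

lemma low_vertex_deg:
  "v \<in> S \<Longrightarrow> deg v \<le> 3 \<Longrightarrow>
    D + 3 + 2 * card (triangles_at v) \<le> (\<Sum>w \<in> core_nbrs v. deg w) + useful_gain v"
  using low_vertex[of v] by (simp add: deg_def card_tri_core)

lemma tri_useful_deg: "v \<in> S \<Longrightarrow> card (tri_useful v) + 2 * card (triangles_at v) \<le> deg v"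
  using card_tri_useful_core[of v] by (simp add: deg_def card_tri_core)

text \<open>For degree 0, the gain of at least \<open>D + 3\<close> covers the charge
  \<open>- 6\<close>. The degrees 1, 2 and 3 are the numerical lemmas \<open>flow_one\<close>,
  \<open>flow_sum_two\<close> and \<open>flow_three\<close>.\<close>

lemma final_charge_no_triangle:
  assumes v: "v \<in> S" and "deg v \<le> 3" and no: "card (triangles_at v) = 0"
  shows "0 \<le> 2 * real (deg v) - 6 + bonus v + transfer v"
proof -
  define \<rho> where "\<rho> = useful_gain v"
  define a where "a = card (tri_useful v)"
  have b: "bonus v = real \<rho> - real a / 2" by (simp add: bonus_def \<rho>_def a_def)
  have a: "a \<le> \<rho>" "a \<le> deg v"
    using card_tri_useful_le[OF v] tri_useful_deg[OF v] no by (simp_all add: a_def \<rho>_def)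
  have "free_nbrs v = core_nbrs v"
    using card_tri_core[OF v] no by (simp add: free_nbrs_def)
  then have tr: "transfer v = (\<Sum>w \<in> core_nbrs v. flow (deg w) (deg v) - flow (deg v) (deg w))"
    by (simp add: transfer_def)
  have low: "D + 3 \<le> (\<Sum>w \<in> core_nbrs v. deg w) + \<rho>"
    using low_vertex_deg[OF v assms(2)] by (simp add: \<rho>_def)
  have nbr_le: "deg w \<le> D" if "w \<in> core_nbrs v" for w using deg_le that core_nbrs_in_S by blast
  consider "deg v = 0" | "deg v = 1" | "deg v = 2" | "deg v = 3" using assms(2) by linarith
  then show ?thesis
  proof cases
    case 1
    then have "core_nbrs v = {}" by (simp add: deg_def)
    then show ?thesis using low D_ge a 1 by (simp add: tr b)
  next
    case 2
    then obtain x where "core_nbrs v = {x}" unfolding deg_def by (rule card_1_singletonE)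
    then show ?thesis
      using flow_one[of D "deg x" \<rho> a] low D_ge a 2 nbr_le by (simp add: tr b flow_small)
  next
    case 3
    then obtain x y where "core_nbrs v = {x, y}" "x \<noteq> y" unfolding deg_def by (auto simp: card_2_iff)
    then show ?thesis
      using flow_sum_two[of "deg x" D "deg y" \<rho> a] low D_ge a 3 nbr_le by (simp add: tr b flow_small)
  next
    case 4
    then obtain x y z where "core_nbrs v = {x, y, z}" "x \<noteq> y" "y \<noteq> z" "x \<noteq> z"
      unfolding deg_def by (auto simp: card_3_iff)
    then show ?thesis
      using flow_three[of D "deg x" "deg y" "deg z" \<rho> a] low D_ge a 4 by (simp add: tr b)
  qed
qed

text \<open>For degree \<open>d\<close> at least 4, the free edges and the pairs of triangle edges
  together take \<open>d (2 - 6 / d) = 2 d - 6\<close>, exactly the charge of \<open>v\<close>. For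
  smaller degree there is at most one triangle, which receives all that is left.\<close>

lemma payment_le:
  assumes v: "v \<in> S"
  shows "payment v * card (triangles_at v) \<le> 2 * real (deg v) - 6 + bonus v + transfer v"
proof (cases "4 \<le> deg v")
  case True
  have "(\<Sum>w \<in> free_nbrs v. flow (deg v) (deg w)) = card (free_nbrs v) * (2 - 6 / deg v)"
    using True by (simp add: flow_def)
  moreover have "real (card (free_nbrs v)) = real (deg v) - 2 * real (card (triangles_at v))"
    using card_free_nbrs[OF v] by linarith
  ultimately have "- ((real (deg v) - 2 * real (card (triangles_at v))) * (2 - 6 / deg v)) \<le> transfer v"
    using transfer_ge[of v] by simp
  moreover have "2 * real (deg v) - 6 - (real (deg v) - 2 * real (card (triangles_at v))) * (2 - 6 / deg v)
      = payment v * card (triangles_at v)"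
    using True by (simp add: payment_def field_simps)
  ultimately show ?thesis using bonus_nonneg[OF v] by linarith
next
  case False
  then have "card (triangles_at v) \<le> 1" using card_free_nbrs[OF v] by linarith
  then consider "card (triangles_at v) = 0" | "card (triangles_at v) = 1" by linarith
  then show ?thesis
  proof cases
    case 1
    then show ?thesis using final_charge_no_triangle[OF v _ 1] False by simp
  next
    case 2
    then show ?thesis using False by (simp add: payment_def)
  qed
qed

text \<open>The bound \<open>D + 5\<close> is the \<open>D + 3\<close> of \<open>low_vertex\<close>
  plus 2 for the single core triangle at \<open>v\<close>. For degree 3, the third core neighbor is
  the only free one and supplies \<open>j\<close>.\<close>

lemma triangle_share_payment:
  assumes v: "v \<in> S" and xy: "x \<noteq> y" "x \<in> core_nbrs v" "y \<in> core_nbrs v" "{x, y} \<in> E"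
  shows "triangle_share D (deg v) (deg x + deg y) (useful_gain v) (payment v)"
proof -
  define \<rho> where "\<rho> = useful_gain v"
  define a where "a = card (tri_useful v)"
  have b: "bonus v = real \<rho> - real a / 2" by (simp add: bonus_def \<rho>_def a_def)
  have "{x, y} \<subseteq> tri_core v" using xy by (auto simp: tri_core_def insert_commute)
  then have sub: "{x, y} \<subseteq> tri_core v" "{x, y} \<subseteq> core_nbrs v" using tri_core_subset by auto
  have "2 \<le> card (tri_core v)" using card_mono[OF finite_tri_core sub(1)] xy(1) by simp
  then have one: "1 \<le> card (triangles_at v)" using card_tri_core[OF v] by simp
  then have deg2: "2 \<le> deg v" using card_free_nbrs[OF v] by linarith
  have a: "a \<le> \<rho>" "a + 2 \<le> deg v"
    using card_tri_useful_le[OF v] tri_useful_deg[OF v] one by (simp_all add: a_def \<rho>_def)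
  show ?thesis
    unfolding triangle_share_def \<rho>_def[symmetric]
  proof (intro conjI impI)
    show "2 \<le> deg v" by (rule deg2)
    show "deg v \<le> D" by (rule deg_le[OF v])
    show "payment v = 4 - 12 / deg v" if "4 \<le> deg v" using that by (simp add: payment_def)
    show "\<exists>a j. payment v = real \<rho> - real a / 2 + flow j 3 - flow 3 j \<and> a \<le> 1 \<and> a \<le> \<rho> \<and>
        D + 5 \<le> deg x + deg y + j + \<rho>" if d: "deg v = 3"
    proof -
      have "card (triangles_at v) = 1" using card_free_nbrs[OF v] one d by linarith
      then have c: "card (tri_core v) = 2" "card (free_nbrs v) = 1"
        using card_tri_core[OF v] card_free_nbrs[OF v] d by simp_all
      then have T: "tri_core v = {x, y}"
        using card_seteq[OF finite_tri_core sub(1)] xy(1) by simp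
      obtain w where w: "free_nbrs v = {w}" using c(2) by (rule card_1_singletonE)
      have C: "core_nbrs v = {x, y, w}" "w \<noteq> x" "w \<noteq> y"
        using w T sub tri_core_subset[of v] unfolding free_nbrs_def by blast+
      have "D + 5 \<le> deg x + deg y + deg w + \<rho>"
        using low_vertex_deg[OF v] d C xy(1) \<open>card (triangles_at v) = 1\<close> by (simp add: \<rho>_def)
      then show ?thesis using a d
        by (intro exI[of _ a] exI[of _ "deg w"]) (simp add: payment_def transfer_def w b)
    qed
    \<comment> \<open>Both core neighbors lie in the triangle, so \<open>a = 0\<close>, no edge is
      free, and the payment is \<open>2 * 2 - 6 + \<rho>\<close>.\<close>
    assume d: "deg v = 2"
    have "card (triangles_at v) = 1" "card (free_nbrs v) = 0" using card_free_nbrs[OF v] one d by linarith+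
    then have "free_nbrs v = {}" by simp
    moreover have "core_nbrs v = {x, y}"
      using card_seteq[OF finite_core_nbrs sub(2)] xy(1) d by (simp add: deg_def)
    ultimately show "payment v = real \<rho> - 2" "D + 5 \<le> deg x + deg y + \<rho>"
      using low_vertex_deg[OF v] d xy(1) \<open>card (triangles_at v) = 1\<close> a
      by (simp_all add: \<rho>_def payment_def transfer_def b)
  qed
qed

lemma triangle_payment:
  assumes t: "t \<in> triangles core_edges"
  shows "3 \<le> (\<Sum>v \<in> t. payment v)"
proof -
  have "t \<noteq> {}" using t by (auto simp: triangles_def)
  then obtain v where v: "v \<in> t" by blast
  obtain x y where xy: "t = {v, x, y}" "v \<in> S" "x \<noteq> y" "x \<in> core_nbrs v" "y \<in> core_nbrs v" "{x, y} \<in> E"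
    using core_triangle[OF t v] .
  have S: "x \<in> S" "y \<in> S" using xy core_nbrs_in_S by auto
  have ne: "v \<noteq> x" "v \<noteq> y" using xy core_nbrs_irrefl by auto
  have "v \<in> core_nbrs x" "v \<in> core_nbrs y" using core_nbrs_sym xy by auto
  moreover have "y \<in> core_nbrs x" "x \<in> core_nbrs y" "{v, y} \<in> E" "{v, x} \<in> E"
    using xy S by (auto simp: core_nbrs_def nbrs_def insert_commute)
  ultimately have "triangle_share D (deg v) (deg x + deg y) (useful_gain v) (payment v)"
    "triangle_share D (deg x) (deg v + deg y) (useful_gain x) (payment x)"
    "triangle_share D (deg y) (deg v + deg x) (useful_gain y) (payment y)"
    using triangle_share_payment xy S ne by blast+
  then have "3 \<le> payment v + payment x + payment y" by (rule triangle_share_sum[OF _ _ _ D_ge])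
  then show ?thesis using xy ne by simp
qed

text \<open>Every core triangle receives at least 3, while the vertices cannot pay more than the
  total charge, which is less than 3 per core triangle.\<close>

theorem contradiction: False
proof -
  have "3 * real (card (triangles core_edges)) \<le> (\<Sum>t \<in> triangles core_edges. \<Sum>v \<in> t. payment v)"
    using sum_bounded_below[of "triangles core_edges" 3 "\<lambda>t. \<Sum>v \<in> t. payment v"] triangle_payment by simp
  also have "\<dots> = (\<Sum>t \<in> triangles core_edges. \<Sum>v \<in> {v \<in> S. v \<in> t}. payment v)"
  proof (rule sum.cong)
    fix t assume t: "t \<in> triangles core_edges"
    have "v \<in> S" if "v \<in> t" for v using core_triangle[OF t that] by blast
    then have "{v \<in> S. v \<in> t} = t" by blast
    then show "(\<Sum>v \<in> t. payment v) = (\<Sum>v \<in> {v \<in> S. v \<in> t}. payment v)" by simp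
  qed simp
  also have "\<dots> = (\<Sum>v \<in> S. \<Sum>t \<in> {t \<in> triangles core_edges. v \<in> t}. payment v)"
    by (rule sum.swap_restrict[OF finite_core_triangles finite_S])
  also have "\<dots> = (\<Sum>v \<in> S. payment v * card (triangles_at v))"
    by (simp add: triangles_at_def mult.commute)
  also have "\<dots> \<le> (\<Sum>v \<in> S. 2 * real (deg v) - 6 + bonus v + transfer v)"
    by (rule sum_mono) (rule payment_le)
  also have "\<dots> = (\<Sum>v \<in> S. 2 * real (deg v) - 6 + bonus v)"
    using sum_transfer by (simp add: sum.distrib)
  also have "\<dots> < 3 * real (card (triangles core_edges))"
    using total_charge by (simp add: deg_def)
  finally show False by simp
qed

end

section \<open>The ordering\<close>

definition few_nbrs_in :: "'a set set \<Rightarrow> nat \<Rightarrow> 'a \<Rightarrow> 'a set \<Rightarrow> bool" where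
  "few_nbrs_in E D v A \<longleftrightarrow> card (nbrs E v \<inter> A) \<le> 3 \<and> card (nbrs2 E v \<inter> A) \<le> D + 2"

text \<open>The list is the tail of an ordering; \<open>S\<close> stands for the vertices before it,
  whose order is still open.\<close>

definition removal_order :: "'a set set \<Rightarrow> nat \<Rightarrow> 'a set \<Rightarrow> 'a list \<Rightarrow> bool" where
  "removal_order E D S vs \<longleftrightarrow> distinct vs \<and> set vs \<inter> S = {} \<and>
     (\<forall>xs v ys. vs = xs @ v # ys \<longrightarrow> few_nbrs_in E D v (S \<union> set xs))"

lemma few_nbrs_in_mono:
  assumes "few_nbrs_in E D v B" "nbrs E' v \<inter> A \<subseteq> nbrs E v \<inter> B" "nbrs2 E' v \<inter> A \<subseteq> nbrs2 E v \<inter> B" "finite B"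
  shows "few_nbrs_in E' D v A"
  using assms card_mono[OF _ assms(2)] card_mono[OF _ assms(3)] unfolding few_nbrs_in_def
  by (meson finite_Int le_trans)

lemma filter_eq_split:
  "filter P vs = xs @ v # ys \<Longrightarrow> \<exists>xs' ys'. vs = xs' @ v # ys' \<and> xs = filter P xs' \<and> P v"
proof (induction vs arbitrary: xs)
  case (Cons a vs)
  show ?case
  proof (cases "P a \<and> xs = []")
    case True
    then show ?thesis using Cons.prems by (intro exI[of _ "[]"] exI[of _ vs]) auto
  next
    case False
    then have "filter P vs = (if P a then tl xs else xs) @ v # ys"
      using Cons.prems by (cases xs) (auto split: if_splits)
    from Cons.IH[OF this] obtain xs' ys' where
      "vs = xs' @ v # ys'" "(if P a then tl xs else xs) = filter P xs'" "P v" by blast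
    then have "a # vs = (a # xs') @ v # ys' \<and> xs = filter P (a # xs') \<and> P v"
      using Cons.prems False by (cases xs) (auto split: if_splits)
    then show ?thesis by blast
  qed
qed simp

context sparse_graph
begin

lemma sparse_graph_delete_edge: "sparse_graph V (E - {e}) D"
proof
  show "simple_graph V (E - {e})" using graph by (simp add: simple_graph_def)
  show "no_4_5_cycle (E - {e})" using no_cycles by (rule no_4_5_cycle_subset) blast
  fix v assume "v \<in> V"
  have "card (nbrs (E - {e}) v) \<le> card (nbrs E v)"
    by (rule card_mono[OF finite_nbrs]) (auto simp: nbrs_def)
  then show "card (nbrs (E - {e}) v) \<le> D" using degree_le[OF \<open>v \<in> V\<close>] by linarith
next
  fix V' E' assume "V' \<subseteq> V" "E' \<subseteq> E - {e}" "\<And>e. e \<in> E' \<Longrightarrow> e \<subseteq> V'" "V' \<noteq> {}"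
  then show "4 * int (card E') \<le> 6 * int (card V') + 3 * int (card (triangles E')) - 6"
    using sparse[of V' E'] by blast
qed (rule D_ge)

text \<open>The vertices of \<open>S\<close> take their order from the graph without
  \<open>e\<close>. The assumptions \<open>keep\<close> say that deleting \<open>e\<close> destroys
  no adjacency within \<open>S\<close>, either in the graph or in its square, so the bounds remain
  valid.\<close>

lemma glue_order:
  assumes S: "S \<subseteq> V" and ys: "removal_order E D S ys" "set ys = V - S"
    and xs: "removal_order (E - {e}) D {} xs" "set xs = V"
    and keep: "\<And>v. v \<in> S \<Longrightarrow> nbrs E v \<inter> S \<subseteq> nbrs (E - {e}) v"
      "\<And>v. v \<in> S \<Longrightarrow> nbrs2 E v \<inter> S \<subseteq> nbrs2 (E - {e}) v"
  shows "\<exists>vs. removal_order E D {} vs \<and> set vs = V"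
proof (intro exI conjI)
  define us where "us = filter (\<lambda>v. v \<in> S) xs"
  have us: "set us = S" using S xs by (auto simp: us_def)
  show "set (us @ ys) = V" using us ys S by auto
  show "removal_order E D {} (us @ ys)"
    unfolding removal_order_def
  proof (intro conjI allI impI)
    show "distinct (us @ ys)" using xs ys us by (auto simp: removal_order_def us_def)
    fix as v bs assume eq: "us @ ys = as @ v # bs"
    then consider cs where "us = as @ v # cs" | cs where "as = us @ cs" "ys = cs @ v # bs"
      by (auto simp: append_eq_append_conv2 Cons_eq_append_conv append_eq_Cons_conv)
    then show "few_nbrs_in E D v ({} \<union> set as)"
    proof cases
      case 1
      obtain xs1 xs2 where x: "xs = xs1 @ v # xs2" "as = filter (\<lambda>v. v \<in> S) xs1" "v \<in> S"
        using filter_eq_split[of "\<lambda>v. v \<in> S" xs as v cs] 1 unfolding us_def by metis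
      have "few_nbrs_in (E - {e}) D v ({} \<union> set xs1)" using xs x(1) unfolding removal_order_def by blast
      moreover have "set as \<subseteq> set xs1" "set as \<subseteq> S" using x by auto
      ultimately show ?thesis using keep[OF x(3)] by (elim few_nbrs_in_mono) auto
    next
      case 2
      then have "few_nbrs_in E D v (S \<union> set cs)" using ys unfolding removal_order_def by blast
      then show ?thesis using 2 us by simp
    qed
  qed simp
qed

text \<open>Take \<open>S\<close> of least size: a vertex of \<open>S\<close> that qualifies for
  removal could be put in front of \<open>ys\<close>.\<close>

lemma maximal_removal:
  obtains S ys where "S \<subseteq> V" "removal_order E D S ys" "set ys = V - S"
    "\<And>v. v \<in> S \<Longrightarrow> \<not> few_nbrs_in E D v (S - {v})"
proof -
  define Q where "Q S \<longleftrightarrow> S \<subseteq> V \<and> (\<exists>ys. removal_order E D S ys \<and> set ys = V - S)" for S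
  have "Q V" by (auto simp: Q_def removal_order_def)
  then obtain S where S: "Q S" "\<And>S'. Q S' \<Longrightarrow> card S \<le> card S'"
    using ex_has_least_nat[of Q V card] by blast
  then obtain ys where ys: "S \<subseteq> V" "removal_order E D S ys" "set ys = V - S" by (auto simp: Q_def)
  have "\<not> few_nbrs_in E D v (S - {v})" if v: "v \<in> S" for v
  proof
    assume few: "few_nbrs_in E D v (S - {v})"
    have "removal_order E D (S - {v}) (v # ys)"
      unfolding removal_order_def
    proof (intro conjI allI impI)
      show "distinct (v # ys)" "set (v # ys) \<inter> (S - {v}) = {}" using ys v by (auto simp: removal_order_def)
      fix xs w zs assume eq: "v # ys = xs @ w # zs"
      show "few_nbrs_in E D w (S - {v} \<union> set xs)"
      proof (cases xs)
        case Nil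
        then show ?thesis using few eq by simp
      next
        case (Cons x xs')
        then have "few_nbrs_in E D w (S \<union> set xs')" using ys(2) eq unfolding removal_order_def by auto
        moreover have "S - {v} \<union> set xs = S \<union> set xs'" using Cons eq v by auto
        ultimately show ?thesis by simp
      qed
    qed
    moreover have "set (v # ys) = V - (S - {v})" using ys v by auto
    ultimately have "Q (S - {v})" using ys(1) unfolding Q_def by blast
    then have "card S \<le> card (S - {v})" by (rule S(2))
    moreover have "card (S - {v}) < card S"
      using v finite_subset[OF ys(1) finite_V] by (rule card_Diff1_less[rotated])
    ultimately show False by simp
  qed
  then show thesis using that ys by blast
qed

end

lemma sparse_graph_order:
  assumes "sparse_graph V E D"
  shows "\<exists>vs. removal_order E D {} vs \<and> set vs = V"
  using assms
proof (induction "card E" arbitrary: E rule: less_induct)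
  case less
  interpret sparse_graph V E D by (rule less.prems)
  obtain S ys where S: "S \<subseteq> V" "removal_order E D S ys" "set ys = V - S"
    and stuck: "\<And>v. v \<in> S \<Longrightarrow> \<not> few_nbrs_in E D v (S - {v})"
    using maximal_removal by metis
  have smaller: "\<exists>vs. removal_order E D {} vs \<and> set vs = V"
    if e: "e \<in> E" and "\<And>v. v \<in> S \<Longrightarrow> nbrs E v \<inter> S \<subseteq> nbrs (E - {e}) v"
      "\<And>v. v \<in> S \<Longrightarrow> nbrs2 E v \<inter> S \<subseteq> nbrs2 (E - {e}) v" for e
  proof -
    have "card (E - {e}) < card E" using finite_E e by (rule card_Diff1_less)
    then obtain xs where "removal_order (E - {e}) D {} xs" "set xs = V"
      using less.hyps[OF _ sparse_graph_delete_edge] by blast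
    then show ?thesis using glue_order[OF S] that by blast
  qed
  show ?case
  proof (cases "\<exists>e \<in> E. e \<inter> S = {}")
    case True
    then obtain e where e: "e \<in> E" "e \<inter> S = {}" by blast
    \<comment> \<open>Each edge of a path of length at most 2 between vertices of \<open>S\<close>
      has an end in \<open>S\<close>, so no such path uses \<open>e\<close>.\<close>
    have meets: "{x, y} \<noteq> e" if "x \<in> S \<or> y \<in> S" for x y using that e(2) by auto
    have "nbrs E v \<inter> S \<subseteq> nbrs (E - {e}) v" if "v \<in> S" for v
      using meets that by (auto simp: nbrs_def)
    moreover have "nbrs2 E v \<inter> S \<subseteq> nbrs2 (E - {e}) v" if "v \<in> S" for v
      using meets that by (auto simp: nbrs2_def nbrs_def)
    ultimately show ?thesis using smaller[OF e(1)] by blast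
  next
    case indep: False
    have removed: "nbrs E r \<subseteq> S" if "r \<in> V - S" for r
      using indep that by (fastforce simp: nbrs_def)
    show ?thesis
    proof (cases "\<exists>r \<in> V - S. card (nbrs E r) = 1")
      case True
      then obtain r where r: "r \<in> V - S" "card (nbrs E r) = 1" by blast
      obtain w where w: "nbrs E r = {w}" using r(2) by (rule card_1_singletonE)
      then have e: "{r, w} \<in> E" by (auto simp: nbrs_def)
      have nbrs_same: "x \<in> nbrs (E - {{r, w}}) v" if "x \<in> nbrs E v" "v \<in> S" "x \<in> S" for x v
        using that r(1) by (auto simp: nbrs_def)
      then have "nbrs E v \<inter> S \<subseteq> nbrs (E - {{r, w}}) v" if "v \<in> S" for v using that by blast
      moreover have "nbrs2 E v \<inter> S \<subseteq> nbrs2 (E - {{r, w}}) v" if v: "v \<in> S" for v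
      proof
        fix u assume u: "u \<in> nbrs2 E v \<inter> S"
        show "u \<in> nbrs2 (E - {{r, w}}) v"
        proof (cases "u \<in> nbrs E v")
          case True
          then show ?thesis using u v nbrs_same by (auto simp: nbrs2_def)
        next
          case False
          then obtain x where x: "x \<in> nbrs E v" "u \<in> nbrs E x" "u \<noteq> v" using u by (auto simp: nbrs2_def)
          \<comment> \<open>A leaf is not the middle of a path of length 2: both \<open>u\<close>
            and \<open>v\<close> would equal its only neighbor \<open>w\<close>.\<close>
          have "x \<noteq> r" using x w nbrs_sym[of x v] by auto
          then have "x \<in> nbrs (E - {{r, w}}) v" "u \<in> nbrs (E - {{r, w}}) x"
            using x u v r(1) by (auto simp: nbrs_def doubleton_eq_iff)
          then show ?thesis using x(3) by (auto simp: nbrs2_def)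
        qed
      qed
      ultimately show ?thesis using smaller[OF e] by blast
    next
      case no_leaf: False
      show ?thesis
      proof (cases "S = {}")
        case True
        then show ?thesis using S by auto
      next
        case False
        have "independent_removal V E D S"
        proof
          show "S \<subseteq> V" "S \<noteq> {}" by fact+
          show "e \<inter> S \<noteq> {}" if "e \<in> E" for e using indep that by blast
          fix v assume v: "v \<in> S"
          have "v \<notin> nbrs E v" "v \<notin> nbrs2 E v" using nbrs_irrefl by (auto simp: nbrs2_def)
          then have "nbrs E v \<inter> (S - {v}) = nbrs E v \<inter> S" "nbrs2 E v \<inter> (S - {v}) = nbrs2 E v \<inter> S" by auto
          then show "4 \<le> card (nbrs E v \<inter> S) \<or> D + 3 \<le> card (nbrs2 E v \<inter> S)"
            using stuck[OF v] by (auto simp: few_nbrs_in_def)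
        next
          fix r assume r: "r \<in> V - S"
          then obtain as bs where "ys = as @ r # bs" using S(3) by (metis split_list)
          then have "few_nbrs_in E D r (S \<union> set as)" using S(2) unfolding removal_order_def by blast
          \<comment> \<open>All neighbors of \<open>r\<close> lie in \<open>S\<close> and hence
            precede it, so the removal condition bounds its full degree.\<close>
          moreover have "nbrs E r \<inter> (S \<union> set as) = nbrs E r" using removed[OF r] by blast
          ultimately have "card (nbrs E r) \<le> 3" by (simp add: few_nbrs_in_def)
          moreover have "card (nbrs E r) \<noteq> 1" using no_leaf r by blast
          ultimately have "card (nbrs E r) = 0 \<or> card (nbrs E r) = 2 \<or> card (nbrs E r) = 3" by linarith
          then show "card (nbrs E r) \<in> {0, 2, 3}" by blast
        qed
        then show ?thesis using independent_removal.contradiction by blast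
      qed
    qed
  qed
qed

section \<open>From symmetric digraphs to graphs given by edge sets\<close>

definition edge_sets :: "'a pair_pre_digraph \<Rightarrow> 'a set set" where
  "edge_sets G = {{u, v} | u v. (u, v) \<in> parcs G}"

context pair_graph
begin

lemma arc_sym: "(u, v) \<in> parcs G \<longleftrightarrow> (v, u) \<in> parcs G"
  using pair_sym_arcs unfolding symmetric_def by (auto dest: symD)

lemma edge_sets_iff: "{u, v} \<in> edge_sets G \<longleftrightarrow> (u, v) \<in> parcs G"
  using arc_sym by (auto simp: edge_sets_def doubleton_eq_iff)

lemma nbrs_edge_sets: "nbrs (edge_sets G) v = {w. (v, w) \<in> parcs G}"
  by (simp add: nbrs_def edge_sets_iff)

lemma simple_graph_edge_sets: "simple_graph (pverts G) (edge_sets G)"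
  unfolding simple_graph_def
proof (intro conjI ballI)
  show "finite (pverts G)" by (rule pair_finite_verts)
  fix e assume "e \<in> edge_sets G"
  then obtain u v where uv: "e = {u, v}" "(u, v) \<in> parcs G" by (auto simp: edge_sets_def)
  then have "u \<noteq> v" using pair_no_loops by fastforce
  then show "card e = 2" using uv by simp
  show "e \<subseteq> pverts G" using uv in_arcsD1 in_arcsD2 by auto
qed

lemma plane_graph_edge_sets:
  assumes "plane_drawing G p g"
  shows "plane_graph (pverts G) (edge_sets G) p g"
proof
  show "simple_graph (pverts G) (edge_sets G)" by (rule simple_graph_edge_sets)
  have d: "Path_Connected.arc (g {u, v}) \<and> {pathstart (g {u, v}), pathfinish (g {u, v})} = {p u, p v} \<and>
        path_image (g {u, v}) \<inter> p ` pverts G = {p u, p v}" if "(u, v) \<in> parcs G" for u v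
    using assms that unfolding plane_drawing_def by blast
  have m: "path_image (g {u, v}) \<inter> path_image (g {x, y}) \<subseteq> p ` ({u, v} \<inter> {x, y})"
    if "(u, v) \<in> parcs G" "(x, y) \<in> parcs G" "{u, v} \<noteq> {x, y}" for u v x y
    using assms that unfolding plane_drawing_def by blast
  show "plane_embedding (pverts G) (edge_sets G) p g"
    unfolding plane_embedding_def
  proof (intro conjI ballI impI)
    show "inj_on p (pverts G)" using assms by (simp add: plane_drawing_def)
    fix e assume "e \<in> edge_sets G"
    then obtain u v where uv: "e = {u, v}" "(u, v) \<in> parcs G" by (auto simp: edge_sets_def)
    show "Path_Connected.arc (g e)" "{pathstart (g e), pathfinish (g e)} = p ` e" "path_image (g e) \<inter> p ` pverts G = p ` e"
      using d[OF uv(2)] by (simp_all add: uv(1))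
    fix e' assume "e' \<in> edge_sets G" "e \<noteq> e'"
    then obtain x y where xy: "e' = {x, y}" "(x, y) \<in> parcs G" by (auto simp: edge_sets_def)
    show "path_image (g e) \<inter> path_image (g e') \<subseteq> p ` (e \<inter> e')"
      unfolding uv(1) xy(1) by (rule m) (use uv xy \<open>e \<noteq> e'\<close> in auto)
  qed
qed

text \<open>The closed vertex list becomes an arc walk by pairing each entry with its successor, so
  the number of arcs is the length of \<open>c\<close>.\<close>

lemma has_cycle_of_lengthI:
  assumes "is_cycle (edge_sets G) c"
  shows "has_cycle_of_length G (length c)"
proof -
  have walk: "pcas (hd xs) (zip xs (tl xs)) (last xs)" "set (zip xs (tl xs)) \<subseteq> parcs G"
    "pawalk_verts (hd xs) (zip xs (tl xs)) = xs"
    if "xs \<noteq> []" "path_edges xs \<subseteq> edge_sets G" for xs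
    using that by (induction xs rule: path_edges.induct) (auto simp: edge_sets_iff)
  have c: "distinct c" "3 \<le> length c" "path_edges (c @ [hd c]) \<subseteq> edge_sets G"
    using assms by (auto simp: is_cycle_def cycle_edges_def)
  then have ne: "c \<noteq> []" by auto
  define as where "as = zip (c @ [hd c]) (tl (c @ [hd c]))"
  have "pcas (hd c) as (hd c)" "set as \<subseteq> parcs G" "pawalk_verts (hd c) as = c @ [hd c]"
    using walk[of "c @ [hd c]"] c ne by (auto simp: as_def)
  moreover have "hd c \<in> pverts G"
  proof -
    have "set (c @ [hd c]) = \<Union> (path_edges (c @ [hd c]))"
      using c(2) by (subst Union_path_edges) auto
    then show ?thesis using c(3) simple_graph_edge_sets unfolding simple_graph_def by fastforce
  qed
  ultimately have "awalk (hd c) as (hd c)" "distinct (tl (pawalk_verts (hd c) as))"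
    using c ne by (auto simp: awalk_def tl_append2 distinct_tl dest: hd_in_set) (cases c; auto)+
  moreover have "length as = length c" by (simp add: as_def)
  ultimately show ?thesis
    unfolding has_cycle_of_length_def cycle_def using ne by (metis length_0_conv)
qed

text \<open>With unit weights the cost of a walk is its number of arcs, so a cheapest path of cost 2
  passes through one middle vertex. This inclusion suffices to transfer upper bounds on the number
  of earlier neighbors.\<close>

lemma square_arc_nbrs2:
  assumes "(u, v) \<in> parcs (square G)"
  shows "v \<in> nbrs2 (edge_sets G) u"
proof (cases "(u, v) \<in> parcs G")
  case True
  then show ?thesis using pair_no_loops by (fastforce simp: nbrs2_def nbrs_edge_sets)
next
  case False
  then have uv: "u \<in> pverts G" "\<mu> (\<lambda>_. 1) u v = 2" using assms by (auto simp: square_def)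
  \<comment> \<open>The empty walk at \<open>u\<close> has cost 0, so the distance from
    \<open>u\<close> to itself is not 2.\<close>
  have "u \<noteq> v"
  proof
    assume "u = v"
    then have "awalk u [] v" using uv(1) by (simp add: awalk_def)
    from min_cost_le_walk_cost[OF this, of "\<lambda>_. 1"] show False using uv(2) by simp
  qed
  \<comment> \<open>Without a connecting walk the distance would be infinite.\<close>
  have "u \<rightarrow>\<^sup>*\<^bsub>with_proj G\<^esub> v" using shortest_path_inf[of u v "\<lambda>_. 1"] uv(2) by auto
  then obtain q where q: "apath u q v" "\<mu> (\<lambda>_. 1) u v = awalk_cost (\<lambda>_. 1) q"
    using min_cost_awalk[of u v "\<lambda>_. 1"] by auto
  have "awalk_cost (\<lambda>_. 1) q = real (length q)" by (induction q) auto
  then have "length q = 2" using q(2) uv(2) by simp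
  then obtain a b where "q = [a, b]" by (auto simp: numeral_2_eq_2 length_Suc_conv)
  then have "(u, snd a) \<in> parcs G" "(snd a, v) \<in> parcs G"
    using q(1) by (cases a; cases b; auto simp: apath_def awalk_def)+
  then show ?thesis using \<open>u \<noteq> v\<close> by (auto simp: nbrs2_def nbrs_edge_sets)
qed

lemma card_nbrs_le_max_degree:
  assumes "v \<in> pverts G"
  shows "card (nbrs (edge_sets G) v) \<le> max_degree G"
proof -
  have "out_arcs (with_proj G) v = (\<lambda>w. (v, w)) ` nbrs (edge_sets G) v"
    by (auto simp: out_arcs_def nbrs_edge_sets)
  then have "out_degree (with_proj G) v = card (nbrs (edge_sets G) v)"
    unfolding out_degree_def by (simp add: card_image inj_on_def)
  moreover have "out_degree (with_proj G) v \<le> max_degree G"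
    unfolding max_degree_def using assms pair_finite_verts by (intro Max_ge) auto
  ultimately show ?thesis by simp
qed

end

theorem mainTheorem1:
  fixes G :: "'a pair_pre_digraph"
  assumes "pair_graph G"
    and "planar G"
    and "\<not> has_cycle_of_length G 4"
    and "\<not> has_cycle_of_length G 5"
    and "max_degree G \<ge> 32"
  shows "\<exists>vs. distinct vs \<and> set vs = pverts G \<and>
           (\<forall>i < length vs.
              card (earlier_neighbors G vs i) \<le> 3 \<and>
              card (earlier_neighbors (square G) vs i) \<le> max_degree G + 2)"
proof -
  interpret pair_graph G by (rule assms(1))
  obtain p g where "plane_drawing G p g" using assms(2) by (auto simp: planar_def)
  then interpret plane: plane_graph "pverts G" "edge_sets G" p g by (rule plane_graph_edge_sets)
  have no_cycles: "no_4_5_cycle (edge_sets G)"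
    using has_cycle_of_lengthI assms(3,4) unfolding no_4_5_cycle_def by metis
  have "sparse_graph (pverts G) (edge_sets G) (max_degree G)"
  proof
    \<comment> \<open>Subgraphs inherit the drawing and the absence of 4- and 5-cycles, so the bound
      for plane graphs holds for each of them.\<close>
    fix V' E' assume "V' \<subseteq> pverts G" "E' \<subseteq> edge_sets G" "\<And>e. e \<in> E' \<Longrightarrow> e \<subseteq> V'" "V' \<noteq> {}"
    then show "4 * int (card E') \<le> 6 * int (card V') + 3 * int (card (triangles E')) - 6"
      using plane_graph_sparse[OF plane.sub_plane_graph no_4_5_cycle_subset[OF no_cycles]] by blast
  qed (use simple_graph_edge_sets card_nbrs_le_max_degree no_cycles assms(5) in auto)
  then obtain vs where vs: "removal_order (edge_sets G) (max_degree G) {} vs" "set vs = pverts G"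
    using sparse_graph_order by blast
  have "card (earlier_neighbors G vs i) \<le> 3 \<and> card (earlier_neighbors (square G) vs i) \<le> max_degree G + 2"
    if i: "i < length vs" for i
  proof -
    have "vs = take i vs @ vs ! i # drop (Suc i) vs" using i by (rule id_take_nth_drop)
    then have few: "few_nbrs_in (edge_sets G) (max_degree G) (vs ! i) (set (take i vs))"
      using vs(1) unfolding removal_order_def by (metis sup_bot_left)
    have "earlier_neighbors G vs i \<subseteq> nbrs (edge_sets G) (vs ! i) \<inter> set (take i vs)"
      by (auto simp: earlier_neighbors_def nbrs_edge_sets)
    moreover have "earlier_neighbors (square G) vs i \<subseteq> nbrs2 (edge_sets G) (vs ! i) \<inter> set (take i vs)"
      by (auto simp: earlier_neighbors_def square_arc_nbrs2)
    ultimately show ?thesis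
      using few card_mono[of "nbrs (edge_sets G) (vs ! i) \<inter> set (take i vs)" "earlier_neighbors G vs i"]
        card_mono[of "nbrs2 (edge_sets G) (vs ! i) \<inter> set (take i vs)" "earlier_neighbors (square G) vs i"]
      unfolding few_nbrs_in_def by (meson List.finite_set finite_Int le_trans)
  qed
  then show ?thesis using vs by (auto simp: removal_order_def)
qed

end
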